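(* Let $\mathbb{F}$ be a field and $n,m\ge 1$. Suppose that the cocycle $\mu\in Z^2(\mathbb{N}^{n+1}\times\mathbb{N}^{m+1},\mathbb{F}^\times)$ is of the form $\mu=\nu\times\xi$, where $\nu\in Z^2(\mathbb{N}^{n+1},\mathbb{F}^\times)$ and $\xi\in Z^2(\mathbb{N}^{m+1},\mathbb{F}^\times)$. Let $\mathbf{q}=(q_{ik})_{i,k=0}^{n}$ and $\mathbf{q}'=(q'_{jl})_{j,l=0}^{m}$ be the multiplicatively antisymmetric matrices over $\mathbb{F}^\times$ which correspond to $\nu$ and $\xi$, respectively. Then: 1. the cocycle $\mu^f$ on $\mathbb{N}^{(n+1)(m+1)}$ corresponds to the multiplicatively antisymmetric matrix $\mathbf{g}$ which is the Kronecker product of $\mathbf{q}$ and $\mathbf{q}'$, i.e. $g_{(i,j),(k,l)}=q_{ik}q'_{jl}$; 2. the twist $(\mathcal{A}^n\otimes\mathcal{A}^m)_\mu$ is the classical tensor product $\mathcal{A}^n_{\mathbf{q}}\otimes\mathcal{A}^m_{\mathbf{q}'}$ of two quantum projective spaces (under the identification $X_i\otimes 1\leftrightarrow(x_i\otimes1)'$, $1\otimes Y_j\leftrightarrow(1\otimes y_j)'$); 3. the quantum Segre map $(s_{n,m})_\mu\colon(\mathcal{A}^{(n+1)(m+1)-1})_{\mu^f}\to(\mathcal{A}^n\otimes\mathcal{A}^m)_\mu$ coincides (under the identification in 2 and the identification $Z_{ij}\leftrightarrow z_{ij}'$ of $\mathcal{A}^{(n+1)(m+1)-1}_{\mathbf{g}}$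 with $(\mathcal{A}^{(n+1)(m+1)-1})_{\mu^f}$) with the noncommutative Segre map of Arici, Galuppi and Gateva-Ivanova, i.e. the algebra homomorphism $\mathcal{A}^{(n+1)(m+1)-1}_{\mathbf{g}}\to\mathcal{A}^n_{\mathbf{q}}\otimes\mathcal{A}^m_{\mathbf{q}'}$ given on generators by $Z_{ij}\mapsto X_i\otimes Y_j$.
   Context: Cocycles and twists. For a monoid $S$ with identity $e$, a cocycle $\mu\in Z^2(S,\mathbb{F}^\times)$ is a map $\mu\colon S\times S\to\mathbb{F}^\times$ with $\mu(x,yz)\mu(y,z)=\mu(x,y)\mu(xy,z)$, $\mu(x,e)=\mu(e,x)=1$. Two cocycles are cohomologous if their ratio is a coboundary $\delta h(x,y)=h(x)h(y)/h(xy)$ with $h\colon S\to\mathbb{F}^\times$, $h(e)=1$. The direct product of $\nu\in Z^2(S,\mathbb{F}^\times)$ and $\xi\in Z^2(T,\mathbb{F}^\times)$ is the cocycle $(\nu\times\xi)((s,t),(s',t'))=\nu(s,s')\xi(t,t')$ on $S\times T$. For an $S$-graded unital associative algebra $A$ (with $A_sA_t\subseteq A_{st}$, $1_A\in A_e$), the twist $A_\mu$ is a copy of the graded vector space $A$ (isomorphism $a\mapsto a'$) with product $a'*b'=\mu(x,y)(ab)'$ for $a\in A_x$, $b\in A_y$. Matrices. A matrix $\mathbf{q}$ over $\mathbb{F}^\times$ is multiplicatively antisymmetric if $q_{ii}=1$ and $q_{ij}q_{ji}=1$ for all $i,j$. A cocycle on the free commutative monoid $\mathbb{N}^r$ with ordered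 free generators $g_1,\dots,g_r$ corresponds to the multiplicatively antisymmetric $r\times r$ matrix $\mathbf{q}$ if it is cohomologous to the bimultiplicative cocycle $\mu_{\mathbf{q}}$ with $\mu_{\mathbf{q}}(g_i,g_j)=q_{ij}$ for $i<j$ and $\mu_{\mathbf{q}}(g_i,g_j)=1$ for $i\ge j$; every cocycle on $\mathbb{N}^r$ corresponds to exactly one such matrix. (Indices may run from $0$, or over pairs $(i,j)$ ordered $00,01,\dots,nm$.) Algebras and gradings. $\mathcal{A}^n=\mathbb{F}[x_0,\dots,x_n]$ is graded by $\mathbb{N}^{n+1}$ with $\deg x_i=\alpha_i$ (the $i$th unit vector); $\mathcal{A}^m=\mathbb{F}[y_0,\dots,y_m]$ is graded by $\mathbb{N}^{m+1}$ with $\deg y_j=\beta_j$ (unit vector); $\mathcal{A}^n\otimes\mathcal{A}^m$ is graded by $\mathbb{N}^{n+1}\times\mathbb{N}^{m+1}$. $\mathcal{A}^{(n+1)(m+1)-1}=\mathbb{F}[z_{00},\dots,z_{nm}]$ is graded by $\mathbb{N}^{(n+1)(m+1)}$ with $\deg z_{ij}=e_{ij}$ (matrix units), $0\le i\le n$, $0\le j\le m$. The monoid morphism $f\colon\mathbb{N}^{(n+1)(m+1)}\to\mathbb{N}^{n+1}\times\mathbb{N}^{m+1}$ is given by $f(e_{ij})=(\alpha_i,\beta_j)$, and $\mu^f(s,s')=\mu(f(s),f(s'))$. Quantum projective space. For a multiplicatively antisymmetric $(N+1)\times(N+1)$ matrix $\mathbf{q}$, $\mathcal{A}^N_{\mathbf{q}}$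 is the $\mathbb{F}$-algebra generated by $X_0,\dots,X_N$ with relations $X_jX_i=q_{ji}X_iX_j$ for $0\le i<j\le N$. The generators of $\mathcal{A}^n_{\mathbf{q}}$, $\mathcal{A}^m_{\mathbf{q}'}$, $\mathcal{A}^{(n+1)(m+1)-1}_{\mathbf{g}}$ are denoted $X_i$, $Y_j$, $Z_{ij}$ respectively. The classical tensor product is the one in which the two factors commute. Quantum Segre map. $(s_{n,m})_\mu\colon(\mathcal{A}^{(n+1)(m+1)-1})_{\mu^f}\to(\mathcal{A}^n\otimes\mathcal{A}^m)_\mu$ is the unique algebra morphism with $z_{ij}'\mapsto(x_i\otimes y_j)'$; as a linear map it coincides with the classical Segre map $s_{n,m}(z_{ij})=x_i\otimes y_j$ on the underlying vector spaces. *)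

theory Defs
  imports
    "HOL-Algebra.QuotRing"
    "HOL-Algebra.Module"
    "HOL-Library.Poly_Mapping"
    "HOL-Library.Product_Lexorder"
begin

text \<open>
  The ground field is a type of class \<^class>\<open>field\<close>; monoids and (not necessarily commutative)
  algebras over it are records of HOL-Algebra with explicit carriers.  A function
  on a carrier may take arbitrary values outside, except that algebra morphisms are taken to be
  extensional, so that a morphism is a single object and uniqueness can be stated.
\<close>

section \<open>Cocycles\<close>

definition cocycle :: "('s, 'z) monoid_scheme \<Rightarrow> ('s \<Rightarrow> 's \<Rightarrow> 'k::field) \<Rightarrow> bool" where
  "cocycle S \<mu> \<longleftrightarrow>
     (\<forall>x\<in>carrier S. \<forall>y\<in>carrier S. \<mu> x y \<noteq> 0) \<and>
     (\<forall>x\<in>carrier S. \<forall>y\<in>carrier S. \<forall>z\<in>carrier S.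
        \<mu> x (y \<otimes>\<^bsub>S\<^esub> z) * \<mu> y z = \<mu> x y * \<mu> (x \<otimes>\<^bsub>S\<^esub> y) z) \<and>
     (\<forall>x\<in>carrier S. \<mu> x \<one>\<^bsub>S\<^esub> = 1 \<and> \<mu> \<one>\<^bsub>S\<^esub> x = 1)"

definition cohomologous ::
  "('s, 'z) monoid_scheme \<Rightarrow> ('s \<Rightarrow> 's \<Rightarrow> 'k::field) \<Rightarrow> ('s \<Rightarrow> 's \<Rightarrow> 'k) \<Rightarrow> bool" where
  "cohomologous S \<mu> \<nu> \<longleftrightarrow>
     (\<exists>h. (\<forall>x\<in>carrier S. h x \<noteq> 0) \<and> h \<one>\<^bsub>S\<^esub> = 1 \<and>
          (\<forall>x\<in>carrier S. \<forall>y\<in>carrier S. \<mu> x y / \<nu> x y = h x * h y / h (x \<otimes>\<^bsub>S\<^esub> y)))"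

definition prod_cocycle ::
  "('s \<Rightarrow> 's \<Rightarrow> 'k::field) \<Rightarrow> ('t \<Rightarrow> 't \<Rightarrow> 'k) \<Rightarrow> 's \<times> 't \<Rightarrow> 's \<times> 't \<Rightarrow> 'k" where
  "prod_cocycle \<nu> \<xi> = (\<lambda>(s, t) (s', t'). \<nu> s s' * \<xi> t t')"

definition pullback_cocycle :: "('t \<Rightarrow> 's) \<Rightarrow> ('s \<Rightarrow> 's \<Rightarrow> 'k) \<Rightarrow> 't \<Rightarrow> 't \<Rightarrow> 'k" where
  "pullback_cocycle f \<mu> = (\<lambda>s s'. \<mu> (f s) (f s'))"

definition bimultiplicative :: "('s, 'z) monoid_scheme \<Rightarrow> ('s \<Rightarrow> 's \<Rightarrow> 'k::field) \<Rightarrow> bool" where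
  "bimultiplicative S \<beta> \<longleftrightarrow>
     (\<forall>x\<in>carrier S. \<forall>y\<in>carrier S. \<forall>z\<in>carrier S.
        \<beta> (x \<otimes>\<^bsub>S\<^esub> y) z = \<beta> x z * \<beta> y z \<and> \<beta> x (y \<otimes>\<^bsub>S\<^esub> z) = \<beta> x y * \<beta> x z)"

definition monoid_mor ::
  "('s, 'y) monoid_scheme \<Rightarrow> ('t, 'z) monoid_scheme \<Rightarrow> ('s \<Rightarrow> 't) set" where
  "monoid_mor S T = {f \<in> hom S T. f \<one>\<^bsub>S\<^esub> = \<one>\<^bsub>T\<^esub>}"

text \<open>The free commutative monoid on the generators indexed by \<open>I\<close>, written multiplicatively
  as a record although its operation is the addition of exponent vectors.\<close>

definition nat_vec :: "'i set \<Rightarrow> ('i \<Rightarrow>\<^sub>0 nat) monoid" where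
  "nat_vec I = \<lparr>carrier = {s. Poly_Mapping.keys s \<subseteq> I}, mult = (+), one = 0\<rparr>"

definition unit_vec :: "'i \<Rightarrow> ('i \<Rightarrow>\<^sub>0 nat)" where
  "unit_vec i = Poly_Mapping.single i 1"

definition mult_antisym :: "'i set \<Rightarrow> ('i \<Rightarrow> 'i \<Rightarrow> 'k::field) \<Rightarrow> bool" where
  "mult_antisym I q \<longleftrightarrow>
     (\<forall>i\<in>I. \<forall>j\<in>I. q i j \<noteq> 0) \<and> (\<forall>i\<in>I. q i i = 1) \<and> (\<forall>i\<in>I. \<forall>j\<in>I. q i j * q j i = 1)"

definition corresponds ::
  "'i::linorder set \<Rightarrow> (('i \<Rightarrow>\<^sub>0 nat) \<Rightarrow> ('i \<Rightarrow>\<^sub>0 nat) \<Rightarrow> 'k::field) \<Rightarrow> ('i \<Rightarrow> 'i \<Rightarrow> 'k) \<Rightarrow> bool" where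
  "corresponds I \<mu> q \<longleftrightarrow>
     cocycle (nat_vec I) \<mu> \<and> mult_antisym I q \<and>
     (\<exists>\<beta>. cocycle (nat_vec I) \<beta> \<and> bimultiplicative (nat_vec I) \<beta> \<and>
          (\<forall>i\<in>I. \<forall>j\<in>I. \<beta> (unit_vec i) (unit_vec j) = (if i < j then q i j else 1)) \<and>
          cohomologous (nat_vec I) \<mu> \<beta>)"

definition kronecker ::
  "('i \<Rightarrow> 'i \<Rightarrow> 'k::field) \<Rightarrow> ('j \<Rightarrow> 'j \<Rightarrow> 'k) \<Rightarrow> 'i \<times> 'j \<Rightarrow> 'i \<times> 'j \<Rightarrow> 'k" where
  "kronecker q q' = (\<lambda>(i, j) (k, l). q i k * q' j l)"


section \<open>Algebras\<close>

definition alg_hom ::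
  "('k, 'a, 'y) module_scheme \<Rightarrow> ('k, 'b, 'z) module_scheme \<Rightarrow> ('a \<Rightarrow> 'b) set" where
  "alg_hom A B = {h \<in> ring_hom A B \<inter> extensional (carrier A).
     \<forall>c. \<forall>a\<in>carrier A. h (c \<odot>\<^bsub>A\<^esub> a) = c \<odot>\<^bsub>B\<^esub> h a}"

definition alg_iso ::
  "('k, 'a, 'y) module_scheme \<Rightarrow> ('k, 'b, 'z) module_scheme \<Rightarrow> ('a \<Rightarrow> 'b) set" where
  "alg_iso A B = {h \<in> alg_hom A B. bij_betw h (carrier A) (carrier B)}"

definition lin_span :: "('k, 'a, 'z) module_scheme \<Rightarrow> 'a set \<Rightarrow> 'a set" where
  "lin_span A X = \<Inter>{W. X \<subseteq> W \<and> W \<subseteq> carrier A \<and> \<zero>\<^bsub>A\<^esub> \<in> W \<and>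
     (\<forall>u\<in>W. \<forall>v\<in>W. u \<oplus>\<^bsub>A\<^esub> v \<in> W) \<and> (\<forall>c. \<forall>u\<in>W. c \<odot>\<^bsub>A\<^esub> u \<in> W)}"

definition quot_alg :: "('k, 'a, 'z) module_scheme \<Rightarrow> 'a set \<Rightarrow> ('k, 'a set) module" where
  "quot_alg A J =
     \<lparr>carrier = carrier (A Quot J), mult = mult (A Quot J), one = one (A Quot J),
      zero = zero (A Quot J), add = add (A Quot J),
      smult = (\<lambda>c U. \<Union>u\<in>U. J +>\<^bsub>A\<^esub> (c \<odot>\<^bsub>A\<^esub> u))\<rparr>"

text \<open>The monoid algebra of \<open>G\<close>.  Polynomial algebras are monoid algebras of free commutative
  monoids, free algebras are monoid algebras of free monoids; as a vector space, the monoid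
  algebra is the free vector space on the carrier of \<open>G\<close>.\<close>

definition monoid_alg :: "('g, 'z) monoid_scheme \<Rightarrow> ('k::field, 'g \<Rightarrow>\<^sub>0 'k) module" where
  "monoid_alg G =
     \<lparr>carrier = {p. Poly_Mapping.keys p \<subseteq> carrier G},
      mult = (\<lambda>p r. \<Sum>x\<in>Poly_Mapping.keys p. \<Sum>y\<in>Poly_Mapping.keys r.
        Poly_Mapping.single (x \<otimes>\<^bsub>G\<^esub> y) (Poly_Mapping.lookup p x * Poly_Mapping.lookup r y)),
      one = Poly_Mapping.single \<one>\<^bsub>G\<^esub> 1,
      zero = 0,
      add = (+),
      smult = (\<lambda>c. Poly_Mapping.map ((*) c))\<rparr>"

subsection \<open>Polynomial algebras\<close>

definition poly_alg :: "'i set \<Rightarrow> ('k::field, ('i \<Rightarrow>\<^sub>0 nat) \<Rightarrow>\<^sub>0 'k) module" where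
  "poly_alg I = monoid_alg (nat_vec I)"

definition poly_var :: "'i \<Rightarrow> (('i \<Rightarrow>\<^sub>0 nat) \<Rightarrow>\<^sub>0 'k::field)" where
  "poly_var i = Poly_Mapping.single (unit_vec i) 1"

definition poly_gr :: "('i \<Rightarrow>\<^sub>0 nat) \<Rightarrow> (('i \<Rightarrow>\<^sub>0 nat) \<Rightarrow>\<^sub>0 'k::field) set" where
  "poly_gr s = range (Poly_Mapping.single s)"

subsection \<open>Quantum projective spaces\<close>

definition free_monoid :: "'i set \<Rightarrow> 'i list monoid" where
  "free_monoid I = \<lparr>carrier = lists I, mult = (@), one = []\<rparr>"

definition qspace_ideal ::
  "'i::linorder set \<Rightarrow> ('i \<Rightarrow> 'i \<Rightarrow> 'k::field) \<Rightarrow> ('i list \<Rightarrow>\<^sub>0 'k) set" where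
  "qspace_ideal I q = Idl\<^bsub>monoid_alg (free_monoid I)\<^esub>
     {Poly_Mapping.single [j, i] 1 - Poly_Mapping.single [i, j] (q j i) | i j.
        i \<in> I \<and> j \<in> I \<and> i < j}"

definition qspace ::
  "'i::linorder set \<Rightarrow> ('i \<Rightarrow> 'i \<Rightarrow> 'k::field) \<Rightarrow> ('k, ('i list \<Rightarrow>\<^sub>0 'k) set) module" where
  "qspace I q = quot_alg (monoid_alg (free_monoid I)) (qspace_ideal I q)"

definition qspace_gen ::
  "'i::linorder set \<Rightarrow> ('i \<Rightarrow> 'i \<Rightarrow> 'k::field) \<Rightarrow> 'i \<Rightarrow> ('i list \<Rightarrow>\<^sub>0 'k) set" where
  "qspace_gen I q i =
     qspace_ideal I q +>\<^bsub>monoid_alg (free_monoid I)\<^esub> Poly_Mapping.single [i] 1"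

subsection \<open>Tensor products\<close>

text \<open>\<open>A \<otimes> B\<close> is the free vector space on \<open>carrier A \<times> carrier B\<close> modulo the span of the bilinearity
  relations.  The free vector space is taken with the product of the monoid algebra of the
  multiplicative monoid of \<open>A \<times> B\<close>, which induces
  \<open>(a \<otimes> b) (a' \<otimes> b') = a a' \<otimes> b b'\<close> on the quotient.\<close>

definition tensor_free ::
  "('k::field, 'a, 'y) module_scheme \<Rightarrow> ('k, 'b, 'z) module_scheme \<Rightarrow> ('k, 'a \<times> 'b \<Rightarrow>\<^sub>0 'k) module" where
  "tensor_free A B = monoid_alg (A \<times>\<times> B)"

definition tensor_rel ::
  "('k::field, 'a, 'y) module_scheme \<Rightarrow> ('k, 'b, 'z) module_scheme \<Rightarrow> ('a \<times> 'b \<Rightarrow>\<^sub>0 'k) set" where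
  "tensor_rel A B = lin_span (tensor_free A B)
     ({Poly_Mapping.single (a \<oplus>\<^bsub>A\<^esub> a', b) 1 - Poly_Mapping.single (a, b) 1
         - Poly_Mapping.single (a', b) 1 | a a' b.
         a \<in> carrier A \<and> a' \<in> carrier A \<and> b \<in> carrier B} \<union>
      {Poly_Mapping.single (a, b \<oplus>\<^bsub>B\<^esub> b') 1 - Poly_Mapping.single (a, b) 1
         - Poly_Mapping.single (a, b') 1 | a b b'.
         a \<in> carrier A \<and> b \<in> carrier B \<and> b' \<in> carrier B} \<union>
      {Poly_Mapping.single (c \<odot>\<^bsub>A\<^esub> a, b) 1 - Poly_Mapping.single (a, b) c | c a b.
         a \<in> carrier A \<and> b \<in> carrier B} \<union>
      {Poly_Mapping.single (a, c \<odot>\<^bsub>B\<^esub> b) 1 - Poly_Mapping.single (a, b) c | c a b.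
         a \<in> carrier A \<and> b \<in> carrier B})"

definition tensor_alg ::
  "('k::field, 'a, 'y) module_scheme \<Rightarrow> ('k, 'b, 'z) module_scheme \<Rightarrow>
     ('k, ('a \<times> 'b \<Rightarrow>\<^sub>0 'k) set) module" where
  "tensor_alg A B = quot_alg (tensor_free A B) (tensor_rel A B)"

definition pure_tensor ::
  "('k::field, 'a, 'y) module_scheme \<Rightarrow> ('k, 'b, 'z) module_scheme \<Rightarrow>
     'a \<Rightarrow> 'b \<Rightarrow> ('a \<times> 'b \<Rightarrow>\<^sub>0 'k) set" where
  "pure_tensor A B a b = tensor_rel A B +>\<^bsub>tensor_free A B\<^esub> Poly_Mapping.single (a, b) 1"

definition tensor_gr ::
  "('k::field, 'a, 'y) module_scheme \<Rightarrow> ('k, 'b, 'z) module_scheme \<Rightarrow>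
     ('s \<Rightarrow> 'a set) \<Rightarrow> ('t \<Rightarrow> 'b set) \<Rightarrow> 's \<times> 't \<Rightarrow> ('a \<times> 'b \<Rightarrow>\<^sub>0 'k) set set" where
  "tensor_gr A B grA grB = (\<lambda>(s, t). lin_span (tensor_alg A B)
     {pure_tensor A B a b | a b. a \<in> grA s \<and> b \<in> grB t})"

subsection \<open>Twists of graded algebras\<close>

text \<open>The family of homogeneous components of \<open>a\<close>; well-defined if \<open>A\<close> is the direct sum of the
  \<open>gr s\<close>, \<open>s \<in> carrier S\<close>.\<close>

definition hcomp ::
  "('k, 'a, 'y) module_scheme \<Rightarrow> ('s, 'z) monoid_scheme \<Rightarrow> ('s \<Rightarrow> 'a set) \<Rightarrow> 'a \<Rightarrow> 's \<Rightarrow> 'a" where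
  "hcomp A S gr a = (THE c. (\<forall>s\<in>carrier S. c s \<in> gr s) \<and> (\<forall>s. s \<notin> carrier S \<longrightarrow> c s = \<zero>\<^bsub>A\<^esub>) \<and>
     finite {s. c s \<noteq> \<zero>\<^bsub>A\<^esub>} \<and> a = (\<Oplus>\<^bsub>A\<^esub>s\<in>{s. c s \<noteq> \<zero>\<^bsub>A\<^esub>}. c s))"

definition hsupp ::
  "('k, 'a, 'y) module_scheme \<Rightarrow> ('s, 'z) monoid_scheme \<Rightarrow> ('s \<Rightarrow> 'a set) \<Rightarrow> 'a \<Rightarrow> 's set" where
  "hsupp A S gr a = {s. hcomp A S gr a s \<noteq> \<zero>\<^bsub>A\<^esub>}"

text \<open>The copy \<open>a'\<close> of \<open>a\<close> in the twist is \<open>a\<close> itself: only the product is changed, to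
  the bilinear extension of \<open>a * b = \<mu> s t (a b)\<close> for \<open>a\<close>, \<open>b\<close> homogeneous of degrees \<open>s\<close>, \<open>t\<close>.\<close>

definition twist ::
  "('k, 'a, 'y) module_scheme \<Rightarrow> ('s, 'z) monoid_scheme \<Rightarrow> ('s \<Rightarrow> 'a set) \<Rightarrow>
     ('s \<Rightarrow> 's \<Rightarrow> 'k) \<Rightarrow> ('k, 'a, 'y) module_scheme" where
  "twist A S gr \<mu> = A\<lparr>mult := (\<lambda>a b. \<Oplus>\<^bsub>A\<^esub>s\<in>hsupp A S gr a. \<Oplus>\<^bsub>A\<^esub>t\<in>hsupp A S gr b.
     \<mu> s t \<odot>\<^bsub>A\<^esub> (hcomp A S gr a s \<otimes>\<^bsub>A\<^esub> hcomp A S gr b t))\<rparr>"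


section \<open>Segre maps\<close>

text \<open>Below \<open>I\<close> and \<open>J\<close> index the variables of the two factors, so the \<open>z\<^sub>i\<^sub>j\<close> are indexed by
  \<open>I \<times> J\<close>, ordered lexicographically.\<close>

abbreviation poly_tensor ::
  "'i set \<Rightarrow> 'j set \<Rightarrow>
     ('k::field, ((('i \<Rightarrow>\<^sub>0 nat) \<Rightarrow>\<^sub>0 'k) \<times> (('j \<Rightarrow>\<^sub>0 nat) \<Rightarrow>\<^sub>0 'k) \<Rightarrow>\<^sub>0 'k) set) module" where
  "poly_tensor I J \<equiv> tensor_alg (poly_alg I) (poly_alg J)"

definition poly_tensor_twist ::
  "'i set \<Rightarrow> 'j set \<Rightarrow> (('i \<Rightarrow>\<^sub>0 nat) \<times> ('j \<Rightarrow>\<^sub>0 nat) \<Rightarrow> ('i \<Rightarrow>\<^sub>0 nat) \<times> ('j \<Rightarrow>\<^sub>0 nat) \<Rightarrow> 'k::field) \<Rightarrow>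
     ('k, ((('i \<Rightarrow>\<^sub>0 nat) \<Rightarrow>\<^sub>0 'k) \<times> (('j \<Rightarrow>\<^sub>0 nat) \<Rightarrow>\<^sub>0 'k) \<Rightarrow>\<^sub>0 'k) set) module" where
  "poly_tensor_twist I J \<mu> = twist (poly_tensor I J) (nat_vec I \<times>\<times> nat_vec J)
     (tensor_gr (poly_alg I) (poly_alg J) poly_gr poly_gr) \<mu>"

definition poly_twist ::
  "'i set \<Rightarrow> (('i \<Rightarrow>\<^sub>0 nat) \<Rightarrow> ('i \<Rightarrow>\<^sub>0 nat) \<Rightarrow> 'k::field) \<Rightarrow> ('k, ('i \<Rightarrow>\<^sub>0 nat) \<Rightarrow>\<^sub>0 'k) module" where
  "poly_twist I \<mu> = twist (poly_alg I) (nat_vec I) poly_gr \<mu>"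

definition is_classical_segre ::
  "'i set \<Rightarrow> 'j set \<Rightarrow> ((('i \<times> 'j \<Rightarrow>\<^sub>0 nat) \<Rightarrow>\<^sub>0 'k::field) \<Rightarrow>
     ((('i \<Rightarrow>\<^sub>0 nat) \<Rightarrow>\<^sub>0 'k) \<times> (('j \<Rightarrow>\<^sub>0 nat) \<Rightarrow>\<^sub>0 'k) \<Rightarrow>\<^sub>0 'k) set) \<Rightarrow> bool" where
  "is_classical_segre I J \<sigma> \<longleftrightarrow>
     \<sigma> \<in> alg_hom (poly_alg (I \<times> J)) (poly_tensor I J) \<and>
     (\<forall>i\<in>I. \<forall>j\<in>J. \<sigma> (poly_var (i, j)) =
        pure_tensor (poly_alg I) (poly_alg J) (poly_var i) (poly_var j))"

definition is_quantum_segre ::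
  "'i set \<Rightarrow> 'j set \<Rightarrow> (('i \<times> 'j \<Rightarrow>\<^sub>0 nat) \<Rightarrow> ('i \<Rightarrow>\<^sub>0 nat) \<times> ('j \<Rightarrow>\<^sub>0 nat)) \<Rightarrow>
     (('i \<Rightarrow>\<^sub>0 nat) \<times> ('j \<Rightarrow>\<^sub>0 nat) \<Rightarrow> ('i \<Rightarrow>\<^sub>0 nat) \<times> ('j \<Rightarrow>\<^sub>0 nat) \<Rightarrow> 'k) \<Rightarrow>
     ((('i \<times> 'j \<Rightarrow>\<^sub>0 nat) \<Rightarrow>\<^sub>0 'k::field) \<Rightarrow>
     ((('i \<Rightarrow>\<^sub>0 nat) \<Rightarrow>\<^sub>0 'k) \<times> (('j \<Rightarrow>\<^sub>0 nat) \<Rightarrow>\<^sub>0 'k) \<Rightarrow>\<^sub>0 'k) set) \<Rightarrow> bool" where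
  "is_quantum_segre I J f \<mu> \<sigma> \<longleftrightarrow>
     \<sigma> \<in> alg_hom (poly_twist (I \<times> J) (pullback_cocycle f \<mu>)) (poly_tensor_twist I J \<mu>) \<and>
     (\<forall>i\<in>I. \<forall>j\<in>J. \<sigma> (poly_var (i, j)) =
        pure_tensor (poly_alg I) (poly_alg J) (poly_var i) (poly_var j))"

text \<open>The noncommutative Segre map of Arici, Galuppi and Gateva-Ivanova.\<close>

definition is_nc_segre ::
  "'i::linorder set \<Rightarrow> 'j::linorder set \<Rightarrow> ('i \<Rightarrow> 'i \<Rightarrow> 'k::field) \<Rightarrow> ('j \<Rightarrow> 'j \<Rightarrow> 'k) \<Rightarrow>
     ((('i \<times> 'j) list \<Rightarrow>\<^sub>0 'k) set \<Rightarrow>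
      (('i list \<Rightarrow>\<^sub>0 'k) set \<times> ('j list \<Rightarrow>\<^sub>0 'k) set \<Rightarrow>\<^sub>0 'k) set) \<Rightarrow> bool" where
  "is_nc_segre I J q q' \<phi> \<longleftrightarrow>
     \<phi> \<in> alg_hom (qspace (I \<times> J) (kronecker q q')) (tensor_alg (qspace I q) (qspace J q')) \<and>
     (\<forall>i\<in>I. \<forall>j\<in>J. \<phi> (qspace_gen (I \<times> J) (kronecker q q') (i, j)) =
        pure_tensor (qspace I q) (qspace J q') (qspace_gen I q i) (qspace_gen J q' j))"

text \<open>The identification of \<open>\<A>\<^bsub>q\<^esub> \<otimes> \<A>\<^bsub>q'\<^esub>\<close> with the twist of the tensor product of polynomial
  algebras, and that of \<open>\<A>\<^bsub>g\<^esub>\<close> with a twist of the polynomial algebra.\<close>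

definition is_tensor_ident ::
  "'i::linorder set \<Rightarrow> 'j::linorder set \<Rightarrow> ('i \<Rightarrow> 'i \<Rightarrow> 'k::field) \<Rightarrow> ('j \<Rightarrow> 'j \<Rightarrow> 'k) \<Rightarrow>
     (('i \<Rightarrow>\<^sub>0 nat) \<times> ('j \<Rightarrow>\<^sub>0 nat) \<Rightarrow> ('i \<Rightarrow>\<^sub>0 nat) \<times> ('j \<Rightarrow>\<^sub>0 nat) \<Rightarrow> 'k) \<Rightarrow>
     ((('i list \<Rightarrow>\<^sub>0 'k) set \<times> ('j list \<Rightarrow>\<^sub>0 'k) set \<Rightarrow>\<^sub>0 'k) set \<Rightarrow>
      ((('i \<Rightarrow>\<^sub>0 nat) \<Rightarrow>\<^sub>0 'k) \<times> (('j \<Rightarrow>\<^sub>0 nat) \<Rightarrow>\<^sub>0 'k) \<Rightarrow>\<^sub>0 'k) set) \<Rightarrow> bool" where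
  "is_tensor_ident I J q q' \<mu> \<Psi> \<longleftrightarrow>
     \<Psi> \<in> alg_iso (tensor_alg (qspace I q) (qspace J q')) (poly_tensor_twist I J \<mu>) \<and>
     (\<forall>i\<in>I. \<Psi> (pure_tensor (qspace I q) (qspace J q') (qspace_gen I q i) \<one>\<^bsub>qspace J q'\<^esub>) =
        pure_tensor (poly_alg I) (poly_alg J) (poly_var i) \<one>\<^bsub>poly_alg J\<^esub>) \<and>
     (\<forall>j\<in>J. \<Psi> (pure_tensor (qspace I q) (qspace J q') \<one>\<^bsub>qspace I q\<^esub> (qspace_gen J q' j)) =
        pure_tensor (poly_alg I) (poly_alg J) \<one>\<^bsub>poly_alg I\<^esub> (poly_var j))"

definition is_poly_ident ::
  "'i::linorder set \<Rightarrow> ('i \<Rightarrow> 'i \<Rightarrow> 'k::field) \<Rightarrow> (('i \<Rightarrow>\<^sub>0 nat) \<Rightarrow> ('i \<Rightarrow>\<^sub>0 nat) \<Rightarrow> 'k) \<Rightarrow>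
     (('i list \<Rightarrow>\<^sub>0 'k) set \<Rightarrow> (('i \<Rightarrow>\<^sub>0 nat) \<Rightarrow>\<^sub>0 'k)) \<Rightarrow> bool" where
  "is_poly_ident I g \<mu> \<Phi> \<longleftrightarrow>
     \<Phi> \<in> alg_iso (qspace I g) (poly_twist I \<mu>) \<and> (\<forall>i\<in>I. \<Phi> (qspace_gen I g i) = poly_var i)"

end

theory Submission
  imports "HOL-Library.Multiset" Defs
begin

text \<open>
  Every algebra in the statement is isomorphic to a twisted monoid algebra: the free vector space
  on a monoid \<open>S\<close> with product \<open>s * t = c s t (s t)\<close> for a cocycle \<open>c\<close>.  Twisting a graded algebra
  with one-dimensional components multiplies \<open>c\<close> by \<open>\<mu>\<close>, tensoring takes direct products of
  cocycles, and the quantum space of \<open>q\<close> is the twist of the polynomial algebra by any cocycle \<open>c\<close>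
  with \<open>c e\<^sub>i e\<^sub>j = q\<^sub>i\<^sub>j c e\<^sub>j e\<^sub>i\<close>, since the relations reduce each word to a multiple of its sorted
  word and the sorted words map to nonzero multiples of distinct monomials.  These commutation
  relations of the generators also characterize the matrix of a cocycle, because a cocycle which is
  symmetric on generators is a coboundary; for \<open>\<mu>\<^sup>f\<close> they give the Kronecker product.
  In coordinates all Segre maps are the linear extension of \<open>f\<close>, and morphisms are determined by
  their values on generators.
\<close>

text \<open>The algebras of the statement are quotients by ideals or by spans, or twists defined
  through homogeneous components, over unrelated types; little can be computed in them directly.
  Each is therefore equipped with an explicit isomorphism onto a twisted monoid algebra
  (\<open>tw_coords\<close>), and equations are checked on coordinates. The identifications must
  send generators to generators in the twist by the given \<open>\<mu>\<close>; passing to a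
  cohomologous normal form could rescale monomials. This is why the quantum spaces are compared with
  the twists by \<open>\<nu>\<close>, \<open>\<xi>\<close> and the pullback of \<open>\<mu>\<close>
  themselves. Both kinds of quotient, by the quadratic relations and by bilinearity, follow one
  pattern: a surjection \<open>\<pi>\<close> is given on a basis, and a section
  \<open>\<tau>\<close>, inverse to it modulo the relations, shows that the relations exhaust its
  kernel. Finally, the coordinate map of a twist does not depend on the cocycle, which is what makes
  the classical and the quantum Segre map comparable as linear maps.\<close>

abbreviation "keys \<equiv> Poly_Mapping.keys"
abbreviation "lookup \<equiv> Poly_Mapping.lookup"

section \<open>Linear extension\<close>

definition scl :: "'k::field \<Rightarrow> ('g \<Rightarrow>\<^sub>0 'k) \<Rightarrow> 'g \<Rightarrow>\<^sub>0 'k" where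
  "scl c = Poly_Mapping.map ((*) c)"

definition lext :: "('g \<Rightarrow> 'h \<Rightarrow>\<^sub>0 'k) \<Rightarrow> ('g \<Rightarrow>\<^sub>0 'k) \<Rightarrow> 'h \<Rightarrow>\<^sub>0 'k::field" where
  "lext g p = (\<Sum>x\<in>keys p. scl (lookup p x) (g x))"

lemma lookup_scl [simp]: "lookup (scl c p) x = c * lookup p x"
  unfolding scl_def by transfer (auto simp: when_def)

lemma scl_add: "scl c (p + r) = scl c p + scl c r"
  by (rule poly_mapping_eqI) (simp add: lookup_add algebra_simps)

lemma scl_diff: "scl c (p - r) = scl c p - scl c r"
  by (rule poly_mapping_eqI) (simp add: lookup_minus algebra_simps)

lemma scl_add_left: "scl (c + d) p = scl c p + scl d p"
  by (rule poly_mapping_eqI) (simp add: lookup_add algebra_simps)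

lemma scl_scl [simp]: "scl c (scl d p) = scl (c * d) p"
  by (rule poly_mapping_eqI) simp

lemma scl_one [simp]: "scl 1 p = p"
  by (rule poly_mapping_eqI) simp

lemma scl_zero [simp]: "scl 0 p = 0" "scl c 0 = 0"
  by (rule poly_mapping_eqI, simp)+

lemma scl_minus_one: "scl (- 1) p = - p"
  by (rule poly_mapping_eqI) simp

lemma scl_single [simp]: "scl c (Poly_Mapping.single x k) = Poly_Mapping.single x (c * k)"
  by (rule poly_mapping_eqI) (simp add: lookup_single when_def)

lemma scl_sum: "scl c (sum g F) = (\<Sum>x\<in>F. scl c (g x))"
  by (rule poly_mapping_eqI) (simp add: lookup_sum sum_distrib_left)

lemma keys_scl_subset: "keys (scl c p) \<subseteq> keys p"
  by (auto simp: in_keys_iff)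

text \<open>Vectors to be added have different supports; a common index set, with zero coefficients
  on the surplus, makes their extensions comparable.\<close>

lemma lext_superset:
  assumes "finite F" "keys p \<subseteq> F"
  shows "lext g p = (\<Sum>x\<in>F. scl (lookup p x) (g x))"
  unfolding lext_def using assms by (intro sum.mono_neutral_left) (auto simp: in_keys_iff)

lemma lext_add: "lext g (p + r) = lext g p + lext g r"
  using keys_add[of p r]
  by (simp add: lext_superset[of "keys p \<union> keys r"] lookup_add scl_add_left sum.distrib)

lemma lext_scl: "lext g (scl c p) = scl c (lext g p)"
  using lext_superset[OF finite_keys keys_scl_subset, of g c p] by (simp add: lext_def scl_sum)

lemma lext_single [simp]: "lext g (Poly_Mapping.single x k) = scl k (g x)"
  by (simp add: lext_superset[of "{x}"] lookup_single)

lemma lext_zero [simp]: "lext g 0 = 0"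
  by (simp add: lext_def)

lemma lext_diff: "lext g (p - r) = lext g p - lext g r"
  using lext_add[of g p "scl (- 1) r"] unfolding lext_scl by (simp add: scl_minus_one)

lemma lext_cong: "(\<And>x. x \<in> keys p \<Longrightarrow> g x = h x) \<Longrightarrow> lext g p = lext h p"
  unfolding lext_def by (intro sum.cong) auto

lemma lext_fun_add: "lext (\<lambda>x. g x + h x) p = lext g p + lext h p"
  by (simp add: lext_def scl_add sum.distrib)

lemma lext_fun_scl: "lext (\<lambda>x. scl c (g x)) p = scl c (lext g p)"
  by (simp add: lext_def scl_sum mult.commute)

lemma keys_lext:
  assumes "\<And>x. x \<in> keys p \<Longrightarrow> keys (g x) \<subseteq> X"
  shows "keys (lext g p) \<subseteq> X"
  unfolding lext_def
  by (rule order.trans[OF keys_sum], rule UN_least) (meson assms keys_scl_subset order.trans)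

text \<open>The expansion of a vector in the basis. It feeds the induction principle below and later
  the decomposition into homogeneous components.\<close>

lemma lext_single_id: "lext (\<lambda>x. Poly_Mapping.single x 1) p = p"
proof (rule poly_mapping_eqI)
  fix k
  have "lookup (lext (\<lambda>x. Poly_Mapping.single x 1) p) k =
      (\<Sum>x\<in>keys p. if x = k then lookup p x else 0)"
    unfolding lext_def lookup_sum by (intro sum.cong) (auto simp: lookup_single when_def)
  then show "lookup (lext (\<lambda>x. Poly_Mapping.single x 1) p) k = lookup p k"
    by (simp add: in_keys_iff)
qed

text \<open>Induction for additive statements about vectors over \<open>X\<close>. The supports of
  both summands are available in the case \<open>add\<close> because most of the statements to be
  proved make sense only on the carrier.\<close>

lemma keys_induct [consumes 1, case_names zero single add]:
  assumes "keys p \<subseteq> X" and zero: "P 0"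
    and single: "\<And>x k. x \<in> X \<Longrightarrow> P (Poly_Mapping.single x k)"
    and add: "\<And>p r. keys p \<subseteq> X \<Longrightarrow> keys r \<subseteq> X \<Longrightarrow> P p \<Longrightarrow> P r \<Longrightarrow> P (p + r)"
  shows "P (p :: 'g \<Rightarrow>\<^sub>0 'k::field)"
proof -
  let ?s = "\<lambda>x. Poly_Mapping.single x (lookup p x)"
  have "keys (sum ?s F) \<subseteq> X \<and> P (sum ?s F)" if "F \<subseteq> X" "finite F" for F
    using that(2,1)
  proof (induction F)
    case (insert x F)
    have "keys (?s x) \<subseteq> X" using insert by auto
    then show ?case using insert keys_add[of "?s x" "sum ?s F"] by (auto intro!: add single)
  qed (simp add: zero)
  moreover have "sum ?s (keys p) = p"
    using lext_single_id[of p] by (simp add: lext_def)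
  ultimately show ?thesis using assms(1) by (metis finite_keys)
qed

section \<open>Twisted monoid algebras\<close>

text \<open>Two nested linear extensions instead of a double sum: bilinearity is then an instance of
  linearity of \<open>lext\<close>.\<close>

definition tw_mult ::
  "('g, 'z) monoid_scheme \<Rightarrow> ('g \<Rightarrow> 'g \<Rightarrow> 'k::field) \<Rightarrow> ('g \<Rightarrow>\<^sub>0 'k) \<Rightarrow> ('g \<Rightarrow>\<^sub>0 'k) \<Rightarrow> 'g \<Rightarrow>\<^sub>0 'k" where
  "tw_mult S c p r = lext (\<lambda>x. lext (\<lambda>y. Poly_Mapping.single (x \<otimes>\<^bsub>S\<^esub> y) (c x y)) r) p"

definition tw_alg ::
  "('g, 'z) monoid_scheme \<Rightarrow> ('g \<Rightarrow> 'g \<Rightarrow> 'k::field) \<Rightarrow> ('k, 'g \<Rightarrow>\<^sub>0 'k) module" where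
  "tw_alg S c = \<lparr>carrier = {p. keys p \<subseteq> carrier S}, mult = tw_mult S c,
     one = Poly_Mapping.single \<one>\<^bsub>S\<^esub> 1, zero = 0, add = (+), smult = scl\<rparr>"

lemma tw_alg_simps [simp]:
  "carrier (tw_alg S c) = {p. keys p \<subseteq> carrier S}" "monoid.mult (tw_alg S c) = tw_mult S c"
  "one (tw_alg S c) = Poly_Mapping.single \<one>\<^bsub>S\<^esub> 1" "zero (tw_alg S c) = 0"
  "add (tw_alg S c) = (+)" "smult (tw_alg S c) = scl"
  by (simp_all add: tw_alg_def)

text \<open>With the trivial cocycle, polynomial algebras, free algebras and the free spaces
  underlying tensor products all become twisted monoid algebras.\<close>

lemma monoid_alg_tw_alg: "monoid_alg S = tw_alg S (\<lambda>_ _. 1)"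
proof -
  have "(\<lambda>c. Poly_Mapping.map ((*) c)) = scl"
    by (simp add: scl_def fun_eq_iff)
  then show ?thesis
    unfolding monoid_alg_def tw_alg_def
    by (simp add: tw_mult_def fun_eq_iff lext_def scl_sum)
qed

lemma tw_mult_add_left: "tw_mult S c (p + p') r = tw_mult S c p r + tw_mult S c p' r"
  by (simp add: tw_mult_def lext_add)

lemma tw_mult_add_right: "tw_mult S c p (r + r') = tw_mult S c p r + tw_mult S c p r'"
  by (simp add: tw_mult_def lext_add lext_fun_add)

lemma tw_mult_scl [simp]:
  "tw_mult S c (scl k p) r = scl k (tw_mult S c p r)"
  "tw_mult S c p (scl k r) = scl k (tw_mult S c p r)"
  by (simp_all add: tw_mult_def lext_scl lext_fun_scl)

lemma tw_mult_zero [simp]: "tw_mult S c 0 r = 0" "tw_mult S c p 0 = 0"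
  by (simp_all add: tw_mult_def lext_def)

lemma tw_mult_single [simp]:
  "tw_mult S c (Poly_Mapping.single x k) (Poly_Mapping.single y l) =
     Poly_Mapping.single (x \<otimes>\<^bsub>S\<^esub> y) (k * l * c x y)"
  by (simp add: tw_mult_def mult.assoc)

lemma (in monoid) keys_tw_mult:
  assumes "keys p \<subseteq> carrier G" "keys r \<subseteq> carrier G"
  shows "keys (tw_mult G c p r) \<subseteq> carrier G"
  unfolding tw_mult_def using assms by (intro keys_lext) auto

lemma tw_mult_cong:
  assumes "\<And>x y. x \<in> carrier S \<Longrightarrow> y \<in> carrier S \<Longrightarrow> c x y = d x y"
    and "keys p \<subseteq> carrier S" "keys r \<subseteq> carrier S"
  shows "tw_mult S c p r = tw_mult S d p r"
  unfolding tw_mult_def using assms by (intro lext_cong) (metis subsetD)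

lemma keys_add_subset: "keys p \<subseteq> X \<Longrightarrow> keys r \<subseteq> X \<Longrightarrow> keys (p + r) \<subseteq> X"
  using keys_add[of p r] by auto

lemma keys_scl_in: "keys p \<subseteq> X \<Longrightarrow> keys (scl k p) \<subseteq> X"
  using keys_scl_subset[of k p] by auto

text \<open>On basis elements associativity is the cocycle identity and the unit laws are the
  normalization of \<open>c\<close>; multilinearity does the rest.\<close>

lemma ring_tw_alg:
  fixes S :: "('g, 'z) monoid_scheme" and c :: "'g \<Rightarrow> 'g \<Rightarrow> 'k::field"
  assumes "monoid S" "cocycle S c"
  shows "ring (tw_alg S c)"
proof -
  interpret S: monoid S by fact
  have assoc: "tw_mult S c (tw_mult S c p r) t = tw_mult S c p (tw_mult S c r t)"
    if "keys p \<subseteq> carrier S" "keys r \<subseteq> carrier S" "keys t \<subseteq> carrier S" for p r t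
    using that
  proof (induction p rule: keys_induct)
    case (single x k)
    from single(2,1,3) show ?case
    proof (induction r rule: keys_induct)
      case (single y l)
      from single(3,1,2) show ?case
      proof (induction t rule: keys_induct)
        case (single z m)
        then have "c x (y \<otimes>\<^bsub>S\<^esub> z) * c y z = c x y * c (x \<otimes>\<^bsub>S\<^esub> y) z"
          using assms(2) by (auto simp: cocycle_def)
        then have "(k * l * c x y) * m * c (x \<otimes>\<^bsub>S\<^esub> y) z = k * (l * m * c y z) * c x (y \<otimes>\<^bsub>S\<^esub> z)"
          by (simp only: mult_ac)
        with single show ?case by (simp only: tw_mult_single S.m_assoc)
      qed (simp_all add: tw_mult_add_right)
    qed (simp_all add: tw_mult_add_left tw_mult_add_right)
  qed (simp_all add: tw_mult_add_left)
  have one: "tw_mult S c (Poly_Mapping.single \<one>\<^bsub>S\<^esub> 1) p = p"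
    "tw_mult S c p (Poly_Mapping.single \<one>\<^bsub>S\<^esub> 1) = p" if "keys p \<subseteq> carrier S" for p
    using that assms(2)
    by (induction p rule: keys_induct)
      (auto simp: tw_mult_add_left tw_mult_add_right cocycle_def)
  show ?thesis
  proof (rule ringI)
    show "abelian_group (tw_alg S c)"
    proof (rule abelian_groupI)
      fix p assume "p \<in> carrier (tw_alg S c)"
      then show "\<exists>r\<in>carrier (tw_alg S c). r \<oplus>\<^bsub>tw_alg S c\<^esub> p = \<zero>\<^bsub>tw_alg S c\<^esub>"
        by (intro bexI[of _ "- p"]) auto
    qed (auto simp: keys_add_subset add_ac)
    show "monoid (tw_alg S c)"
      by (rule monoidI) (auto simp: S.keys_tw_mult assoc one)
  qed (simp_all add: tw_mult_add_left tw_mult_add_right)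
qed

section \<open>Algebras with coordinates in a twisted monoid algebra\<close>

text \<open>Closure of \<open>A\<close> under its operations is stated separately because
  \<^const>\<open>alg_hom\<close> does not impose it on the source.\<close>

definition tw_coords ::
  "('g, 'z) monoid_scheme \<Rightarrow> ('g \<Rightarrow> 'g \<Rightarrow> 'k::field) \<Rightarrow> ('k, 'a, 'y) module_scheme \<Rightarrow>
     ('a \<Rightarrow> 'g \<Rightarrow>\<^sub>0 'k) \<Rightarrow> bool" where
  "tw_coords S c A h \<longleftrightarrow> monoid S \<and> cocycle S c \<and> h \<in> alg_iso A (tw_alg S c) \<and>
     \<zero>\<^bsub>A\<^esub> \<in> carrier A \<and> \<one>\<^bsub>A\<^esub> \<in> carrier A \<and> h \<zero>\<^bsub>A\<^esub> = 0 \<and>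
     (\<forall>a\<in>carrier A. \<forall>b\<in>carrier A. a \<oplus>\<^bsub>A\<^esub> b \<in> carrier A \<and> a \<otimes>\<^bsub>A\<^esub> b \<in> carrier A) \<and>
     (\<forall>k. \<forall>a\<in>carrier A. k \<odot>\<^bsub>A\<^esub> a \<in> carrier A)"

lemma alg_homI:
  assumes "\<And>a. a \<in> carrier A \<Longrightarrow> h a \<in> carrier B"
    and "\<And>a b. a \<in> carrier A \<Longrightarrow> b \<in> carrier A \<Longrightarrow> h (a \<otimes>\<^bsub>A\<^esub> b) = h a \<otimes>\<^bsub>B\<^esub> h b"
    and "\<And>a b. a \<in> carrier A \<Longrightarrow> b \<in> carrier A \<Longrightarrow> h (a \<oplus>\<^bsub>A\<^esub> b) = h a \<oplus>\<^bsub>B\<^esub> h b"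
    and "h \<one>\<^bsub>A\<^esub> = \<one>\<^bsub>B\<^esub>"
    and "\<And>k a. a \<in> carrier A \<Longrightarrow> h (k \<odot>\<^bsub>A\<^esub> a) = k \<odot>\<^bsub>B\<^esub> h a"
    and "h \<in> extensional (carrier A)"
  shows "h \<in> alg_hom A B"
  using assms by (auto simp: alg_hom_def intro!: ring_hom_memI)

lemma alg_homD:
  assumes "h \<in> alg_hom A B"
  shows "a \<in> carrier A \<Longrightarrow> h a \<in> carrier B"
    and "a \<in> carrier A \<Longrightarrow> b \<in> carrier A \<Longrightarrow> h (a \<otimes>\<^bsub>A\<^esub> b) = h a \<otimes>\<^bsub>B\<^esub> h b"
    and "a \<in> carrier A \<Longrightarrow> b \<in> carrier A \<Longrightarrow> h (a \<oplus>\<^bsub>A\<^esub> b) = h a \<oplus>\<^bsub>B\<^esub> h b"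
    and "h \<one>\<^bsub>A\<^esub> = \<one>\<^bsub>B\<^esub>"
    and "a \<in> carrier A \<Longrightarrow> h (k \<odot>\<^bsub>A\<^esub> a) = k \<odot>\<^bsub>B\<^esub> h a"
    and "h \<in> extensional (carrier A)"
  using assms by (auto simp: alg_hom_def ring_hom_def)

lemma tw_coordsD:
  assumes "tw_coords S c A h"
  shows "monoid S" "cocycle S c" "h \<in> alg_iso A (tw_alg S c)" "h \<in> alg_hom A (tw_alg S c)"
    "\<zero>\<^bsub>A\<^esub> \<in> carrier A" "\<one>\<^bsub>A\<^esub> \<in> carrier A" "h \<zero>\<^bsub>A\<^esub> = 0"
    "a \<in> carrier A \<Longrightarrow> b \<in> carrier A \<Longrightarrow> a \<oplus>\<^bsub>A\<^esub> b \<in> carrier A"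
    "a \<in> carrier A \<Longrightarrow> b \<in> carrier A \<Longrightarrow> a \<otimes>\<^bsub>A\<^esub> b \<in> carrier A"
    "a \<in> carrier A \<Longrightarrow> k \<odot>\<^bsub>A\<^esub> a \<in> carrier A"
  using assms by (auto simp: tw_coords_def alg_iso_def)

lemma tw_coords_hom:
  assumes "tw_coords S c A h"
  shows "a \<in> carrier A \<Longrightarrow> keys (h a) \<subseteq> carrier S"
    and "a \<in> carrier A \<Longrightarrow> b \<in> carrier A \<Longrightarrow> h (a \<otimes>\<^bsub>A\<^esub> b) = tw_mult S c (h a) (h b)"
    and "a \<in> carrier A \<Longrightarrow> b \<in> carrier A \<Longrightarrow> h (a \<oplus>\<^bsub>A\<^esub> b) = h a + h b"
    and "h \<one>\<^bsub>A\<^esub> = Poly_Mapping.single \<one>\<^bsub>S\<^esub> 1"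
    and "a \<in> carrier A \<Longrightarrow> h (k \<odot>\<^bsub>A\<^esub> a) = scl k (h a)"
  using alg_homD[OF tw_coordsD(4)[OF assms]] by auto

text \<open>The device by which almost all equations in \<open>A\<close> are proved: both sides are
  compared in coordinates.\<close>

lemma tw_coords_inj:
  assumes "tw_coords S c A h" "a \<in> carrier A" "b \<in> carrier A" "h a = h b"
  shows "a = b"
  using assms tw_coordsD(3)[OF assms(1)] by (auto simp: alg_iso_def bij_betw_def inj_on_def)

lemma tw_coords_surj:
  assumes "tw_coords S c A h" "keys p \<subseteq> carrier S"
  obtains a where "a \<in> carrier A" "h a = p"
  using assms tw_coordsD(3)[OF assms(1)] by (force simp: alg_iso_def bij_betw_def)

lemma tw_coords_inv:
  assumes "tw_coords S c A h" "keys p \<subseteq> carrier S"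
  shows "inv_into (carrier A) h p \<in> carrier A" "h (inv_into (carrier A) h p) = p"
proof -
  have "p \<in> h ` carrier A" using tw_coords_surj[OF assms] by (metis imageI)
  then show "inv_into (carrier A) h p \<in> carrier A" "h (inv_into (carrier A) h p) = p"
    by (simp_all add: inv_into_into f_inv_into_f)
qed

lemma tw_coords_inv_h:
  assumes "tw_coords S c A h" "a \<in> carrier A"
  shows "inv_into (carrier A) h (h a) = a"
  using assms tw_coordsD(3)[OF assms(1)] by (simp add: alg_iso_def bij_betw_def)

lemma tw_coordsI:
  assumes "monoid S" "cocycle S c" "h \<in> extensional (carrier A)"
    and "bij_betw h (carrier A) {p. keys p \<subseteq> carrier S}"
    and "\<zero>\<^bsub>A\<^esub> \<in> carrier A" "\<one>\<^bsub>A\<^esub> \<in> carrier A" "h \<zero>\<^bsub>A\<^esub> = 0" "h \<one>\<^bsub>A\<^esub> = Poly_Mapping.single \<one>\<^bsub>S\<^esub> 1"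
    and "\<And>a b. a \<in> carrier A \<Longrightarrow> b \<in> carrier A \<Longrightarrow>
      a \<oplus>\<^bsub>A\<^esub> b \<in> carrier A \<and> h (a \<oplus>\<^bsub>A\<^esub> b) = h a + h b"
    and "\<And>a b. a \<in> carrier A \<Longrightarrow> b \<in> carrier A \<Longrightarrow>
      a \<otimes>\<^bsub>A\<^esub> b \<in> carrier A \<and> h (a \<otimes>\<^bsub>A\<^esub> b) = tw_mult S c (h a) (h b)"
    and "\<And>k a. a \<in> carrier A \<Longrightarrow> k \<odot>\<^bsub>A\<^esub> a \<in> carrier A \<and> h (k \<odot>\<^bsub>A\<^esub> a) = scl k (h a)"
  shows "tw_coords S c A h"
  using assms bij_betw_apply[OF assms(4)]
  by (auto simp: tw_coords_def alg_iso_def intro!: alg_homI)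

text \<open>The ring axioms are transported back along the coordinates. They are needed for finite
  sums in \<open>A\<close> and for the multiplicative monoid of two factors of a tensor
  product.\<close>

lemma ring_tw_coords:
  assumes h: "tw_coords S c A h"
  shows "ring A"
proof -
  note [simp] = tw_coordsD(5-10)[OF h] tw_coords_hom[OF h]
  note eqI = tw_coords_inj[OF h]
  interpret R: ring "tw_alg S c" using h by (intro ring_tw_alg tw_coordsD)
  have [simp]: "h a \<in> carrier (tw_alg S c)" if "a \<in> carrier A" for a using that by simp
  show ?thesis
  proof (rule ringI)
    show "abelian_group A"
    proof (rule abelian_groupI)
      fix a assume a: "a \<in> carrier A"
      \<comment> \<open>The additive inverse is supplied by the scalar \<open>- 1\<close>, since the
        record has no operation of negation.\<close>
      have "(- 1) \<odot>\<^bsub>A\<^esub> a \<oplus>\<^bsub>A\<^esub> a = \<zero>\<^bsub>A\<^esub>"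
        using a by (intro eqI) (auto simp: scl_minus_one)
      then show "\<exists>b\<in>carrier A. b \<oplus>\<^bsub>A\<^esub> a = \<zero>\<^bsub>A\<^esub>"
        using a by (intro bexI[of _ "(- 1) \<odot>\<^bsub>A\<^esub> a"]) auto
    qed (auto intro!: eqI simp: add_ac)
    show "monoid A"
    proof (rule monoidI)
      fix a b d assume abd: "a \<in> carrier A" "b \<in> carrier A" "d \<in> carrier A"
      then show "a \<otimes>\<^bsub>A\<^esub> b \<otimes>\<^bsub>A\<^esub> d = a \<otimes>\<^bsub>A\<^esub> (b \<otimes>\<^bsub>A\<^esub> d)"
        using R.m_assoc[of "h a" "h b" "h d"] by (intro eqI) simp_all
      show "\<one>\<^bsub>A\<^esub> \<otimes>\<^bsub>A\<^esub> a = a"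
        using abd R.l_one[of "h a"] by (intro eqI) simp_all
      show "a \<otimes>\<^bsub>A\<^esub> \<one>\<^bsub>A\<^esub> = a"
        using abd R.r_one[of "h a"] by (intro eqI) simp_all
    qed simp_all
  qed (auto intro!: eqI simp: tw_mult_add_left tw_mult_add_right)
qed

text \<open>Values of a cocycle off the carrier are irrelevant. This matters because
  \<open>\<mu>\<close> is only known to agree with the product of \<open>\<nu>\<close> and
  \<open>\<xi>\<close> on the carrier.\<close>

lemma tw_coords_cong:
  assumes "tw_coords S c A h"
    and "\<And>s t. s \<in> carrier S \<Longrightarrow> t \<in> carrier S \<Longrightarrow> c s t = d s t" and "cocycle S d"
  shows "tw_coords S d A h"
proof (rule tw_coordsI)
  show "monoid S" "cocycle S d" "h \<in> extensional (carrier A)"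
    "bij_betw h (carrier A) {p. keys p \<subseteq> carrier S}"
    using assms tw_coordsD(3)[OF assms(1)] by (auto simp: tw_coords_def alg_iso_def alg_hom_def)
next
  fix a b assume "a \<in> carrier A" "b \<in> carrier A"
  then show "a \<otimes>\<^bsub>A\<^esub> b \<in> carrier A \<and> h (a \<otimes>\<^bsub>A\<^esub> b) = tw_mult S d (h a) (h b)"
    using tw_mult_cong[of S c d "h a" "h b"] assms(2)
    by (simp add: tw_coordsD(9)[OF assms(1)] tw_coords_hom(1,2)[OF assms(1)])
qed (simp_all add: tw_coordsD[OF assms(1)] tw_coords_hom[OF assms(1)])

lemma tw_coords_tw_alg:
  assumes "monoid S" "cocycle S c"
  shows "tw_coords S c (tw_alg S c) (restrict id (carrier (tw_alg S c)))"
proof -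
  interpret monoid S by fact
  show ?thesis
    using assms by (intro tw_coordsI)
      (auto simp: keys_add_subset keys_scl_in keys_tw_mult bij_betw_def inj_on_def)
qed

text \<open>A morphism between coordinate algebras is conjugated by the coordinate maps, then
  restricted to the carrier because morphisms are extensional.\<close>

lemma tw_coords_lift_hom:
  assumes A: "tw_coords S c A \<alpha>" and B: "tw_coords T d B \<beta>"
    and g: "g \<in> alg_hom (tw_alg S c) (tw_alg T d)"
  obtains \<Psi> where "\<Psi> \<in> alg_hom A B" "\<And>a. a \<in> carrier A \<Longrightarrow> \<beta> (\<Psi> a) = g (\<alpha> a)"
proof
  let ?\<Psi> = "restrict (\<lambda>a. inv_into (carrier B) \<beta> (g (\<alpha> a))) (carrier A)"
  interpret T: monoid T by (rule tw_coordsD(1)[OF B])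
  note g = alg_homD[OF g, simplified]
  note [simp] = tw_coordsD(5-10)[OF A] tw_coords_hom[OF A] tw_coordsD(5-10)[OF B] tw_coords_hom[OF B]
    tw_coords_inv[OF B] g
  show eq: "\<beta> (?\<Psi> a) = g (\<alpha> a)" if "a \<in> carrier A" for a
    using that by simp
  show "?\<Psi> \<in> alg_hom A B"
  proof (rule alg_homI)
    show "?\<Psi> \<one>\<^bsub>A\<^esub> = \<one>\<^bsub>B\<^esub>"
      by (rule tw_coords_inj[OF B]) simp_all
  qed (auto intro!: tw_coords_inj[OF B] simp: T.keys_tw_mult keys_add_subset keys_scl_in)
qed

text \<open>The lift of the identity: two algebras with coordinates in the same twisted monoid
  algebra are isomorphic, and the isomorphism preserves coordinates.\<close>

lemma tw_coords_lift_iso: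
  assumes A: "tw_coords S c A \<alpha>" and B: "tw_coords S c B \<beta>"
  obtains \<Psi> where "\<Psi> \<in> alg_iso A B" "\<And>a. a \<in> carrier A \<Longrightarrow> \<beta> (\<Psi> a) = \<alpha> a"
proof -
  let ?R = "tw_alg S c"
  have "restrict id (carrier ?R) \<in> alg_hom ?R ?R"
    using tw_coordsD[OF A] by (intro tw_coordsD(4)[OF tw_coords_tw_alg])
  then obtain \<Psi> where \<Psi>: "\<Psi> \<in> alg_hom A B"
    "\<And>a. a \<in> carrier A \<Longrightarrow> \<beta> (\<Psi> a) = restrict id (carrier ?R) (\<alpha> a)"
    using tw_coords_lift_hom[OF A B] by blast
  have eq: "\<beta> (\<Psi> a) = \<alpha> a" if "a \<in> carrier A" for a
    using \<Psi>(2)[OF that] tw_coords_hom(1)[OF A that] by simp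
  have "bij_betw \<Psi> (carrier A) (carrier B)"
  proof (rule bij_betwI')
    fix a b assume "a \<in> carrier A" "b \<in> carrier A"
    then show "\<Psi> a = \<Psi> b \<longleftrightarrow> a = b" using eq tw_coords_inj[OF A] by metis
  next
    fix b assume b: "b \<in> carrier B"
    then obtain a where a: "a \<in> carrier A" "\<alpha> a = \<beta> b"
      using tw_coords_surj[OF A] tw_coords_hom(1)[OF B] by metis
    then show "\<exists>a\<in>carrier A. b = \<Psi> a"
      using eq tw_coords_inj[OF B] b alg_homD(1)[OF \<Psi>(1)] by metis
  qed (use alg_homD(1)[OF \<Psi>(1)] in auto)
  then show thesis using that \<Psi>(1) eq by (auto simp: alg_iso_def)
qed

text \<open>Generation of \<open>S\<close> by \<open>X\<close>, encoded as an induction principle.\<close>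

definition mon_gen :: "('g, 'z) monoid_scheme \<Rightarrow> 'g set \<Rightarrow> bool" where
  "mon_gen S X \<longleftrightarrow> X \<subseteq> carrier S \<and> (\<forall>P. P \<one>\<^bsub>S\<^esub> \<longrightarrow>
     (\<forall>x\<in>X. \<forall>s\<in>carrier S. P s \<longrightarrow> P (x \<otimes>\<^bsub>S\<^esub> s)) \<longrightarrow> (\<forall>s\<in>carrier S. P s))"

text \<open>The product of basis elements \<open>x\<close> and \<open>s\<close> is a nonzero
  multiple of the basis element of their product in \<open>S\<close>, so agreement spreads from the
  generators to the whole basis and then linearly.\<close>

lemma alg_hom_eqI:
  assumes A: "tw_coords S c A \<alpha>" and X: "mon_gen S X"
    and h: "h \<in> alg_hom A B" and h': "h' \<in> alg_hom A B"
    and eq: "\<And>a x. a \<in> carrier A \<Longrightarrow> x \<in> X \<Longrightarrow> \<alpha> a = Poly_Mapping.single x 1 \<Longrightarrow> h a = h' a"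
  shows "h = h'"
proof -
  note [simp] = tw_coordsD(5-10)[OF A] tw_coords_hom[OF A]
  interpret S: monoid S by (rule tw_coordsD(1)[OF A])
  \<comment> \<open>\<open>E p\<close> speaks about the element of \<open>A\<close> with coordinates
    \<open>p\<close>: the inductions run over coordinates, the conclusion concerns
    \<open>A\<close>.\<close>
  define E where "E p \<longleftrightarrow> (\<forall>a\<in>carrier A. \<alpha> a = p \<longrightarrow> h a = h' a)" for p
  have E_scl: "E (scl k p)" if "E p" "keys p \<subseteq> carrier S" for k p
    unfolding E_def
  proof (intro ballI impI)
    fix a assume a: "a \<in> carrier A" "\<alpha> a = scl k p"
    note p = that(2)
    obtain b where b: "b \<in> carrier A" "\<alpha> b = p" by (rule tw_coords_surj[OF A p])
    then have "a = k \<odot>\<^bsub>A\<^esub> b" using a by (intro tw_coords_inj[OF A]) auto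
    then show "h a = h' a"
      using b that(1) alg_homD(5)[OF h b(1)] alg_homD(5)[OF h' b(1)] by (simp add: E_def)
  qed
  have E_add: "E (p + r)" if "E p" "keys p \<subseteq> carrier S" "E r" "keys r \<subseteq> carrier S" for p r
    unfolding E_def
  proof (intro ballI impI)
    fix a assume a: "a \<in> carrier A" "\<alpha> a = p + r"
    note pr = that(2,4)
    obtain b d where b: "b \<in> carrier A" "\<alpha> b = p" "d \<in> carrier A" "\<alpha> d = r"
      by (rule tw_coords_surj[OF A pr(1)], rule tw_coords_surj[OF A pr(2)])
    then have "a = b \<oplus>\<^bsub>A\<^esub> d" using a by (intro tw_coords_inj[OF A]) auto
    then show "h a = h' a"
      using b that(1,3) alg_homD(3)[OF h b(1,3)] alg_homD(3)[OF h' b(1,3)] by (simp add: E_def)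
  qed
  have E_one: "E (Poly_Mapping.single \<one>\<^bsub>S\<^esub> 1)"
    unfolding E_def
  proof (intro ballI impI)
    fix a assume "a \<in> carrier A" "\<alpha> a = Poly_Mapping.single \<one>\<^bsub>S\<^esub> 1"
    then have "a = \<one>\<^bsub>A\<^esub>" by (intro tw_coords_inj[OF A]) auto
    then show "h a = h' a" using alg_homD(4)[OF h] alg_homD(4)[OF h'] by simp
  qed
  have E_mult: "E (Poly_Mapping.single (x \<otimes>\<^bsub>S\<^esub> s) 1)"
    if "x \<in> X" "s \<in> carrier S" "E (Poly_Mapping.single s 1)" for x s
    unfolding E_def
  proof (intro ballI impI)
    fix a assume a: "a \<in> carrier A" "\<alpha> a = Poly_Mapping.single (x \<otimes>\<^bsub>S\<^esub> s) 1"
    have xs: "x \<in> carrier S" "s \<in> carrier S" using that X by (auto simp: mon_gen_def)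
    then have k: "keys (Poly_Mapping.single x (1::'c)) \<subseteq> carrier S"
      "keys (Poly_Mapping.single s (1::'c)) \<subseteq> carrier S" by simp_all
    obtain b d where b: "b \<in> carrier A" "\<alpha> b = Poly_Mapping.single x 1"
      "d \<in> carrier A" "\<alpha> d = Poly_Mapping.single s 1"
      by (rule tw_coords_surj[OF A k(1)], rule tw_coords_surj[OF A k(2)])
    \<comment> \<open>Dividing by this value recovers the basis element from the product of the two
      factors.\<close>
    have "c x s \<noteq> 0" using xs tw_coordsD(2)[OF A] by (auto simp: cocycle_def)
    then have "a = (1 / c x s) \<odot>\<^bsub>A\<^esub> (b \<otimes>\<^bsub>A\<^esub> d)"
      using a b by (intro tw_coords_inj[OF A]) auto
    moreover have "h b = h' b" "h d = h' d"
      using b that(1,3) eq by (auto simp: E_def)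
    ultimately show "h a = h' a"
      using b alg_homD(2,5)[OF h] alg_homD(2,5)[OF h'] by simp
  qed
  have E_single: "E (Poly_Mapping.single s 1)" if "s \<in> carrier S" for s
    using X[unfolded mon_gen_def, THEN conjunct2, rule_format, of "\<lambda>s. E (Poly_Mapping.single s 1)"]
      E_one E_mult that by blast
  have "E p" if "keys p \<subseteq> carrier S" for p
    using that
  proof (induction p rule: keys_induct)
    case zero
    show ?case using E_scl[OF E_one, of 0] by simp
  next
    case (single s k)
    then show ?case using E_scl[OF E_single[OF single], of k] by simp
  qed (rule E_add)
  then have "h a = h' a" if "a \<in> carrier A" for a
    using that tw_coords_hom(1)[OF A that] unfolding E_def by blast
  then show ?thesis
    by (rule extensionalityI[OF alg_homD(6)[OF h] alg_homD(6)[OF h']])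
qed

section \<open>Coordinates on quotients of twisted monoid algebras\<close>

lemma quot_alg_simps [simp]:
  "carrier (quot_alg A J) = carrier (A Quot J)" "monoid.mult (quot_alg A J) = mult (A Quot J)"
  "one (quot_alg A J) = one (A Quot J)" "zero (quot_alg A J) = zero (A Quot J)"
  "add (quot_alg A J) = add (A Quot J)"
  "smult (quot_alg A J) = (\<lambda>c U. \<Union>u\<in>U. J +>\<^bsub>A\<^esub> (c \<odot>\<^bsub>A\<^esub> u))"
  by (simp_all add: quot_alg_def)

text \<open>The first isomorphism theorem, with the coordinates induced by \<open>\<pi>\<close>.
  That \<open>J\<close> is an ideal is a consequence of its being a kernel; for the bilinearity
  relations, which are defined as a mere linear span, this is how the quotient becomes an
  algebra.\<close>

lemma tw_coords_quot_alg:
  fixes G :: "('g, 'y) monoid_scheme" and S :: "('s, 'z) monoid_scheme"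
    and b :: "'g \<Rightarrow> 'g \<Rightarrow> 'k::field" and c :: "'s \<Rightarrow> 's \<Rightarrow> 'k"
  assumes "monoid G" "cocycle G b" "monoid S" "cocycle S c"
    and \<pi>: "\<pi> \<in> alg_hom (tw_alg G b) (tw_alg S c)"
    and surj: "\<pi> ` carrier (tw_alg G b) = carrier (tw_alg S c)"
    and J: "J = {p. keys p \<subseteq> carrier G \<and> \<pi> p = 0}"
  obtains h where "tw_coords S c (quot_alg (tw_alg G b) J) h"
    and "\<And>p. keys p \<subseteq> carrier G \<Longrightarrow>
      J +>\<^bsub>tw_alg G b\<^esub> p \<in> carrier (quot_alg (tw_alg G b) J) \<and> h (J +>\<^bsub>tw_alg G b\<^esub> p) = \<pi> p"
proof -
  let ?R = "tw_alg G b" and ?R' = "tw_alg S c"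
  interpret ring_hom_ring ?R ?R' \<pi>
    using assms by (intro ring_hom_ringI2 ring_tw_alg) (auto simp: alg_hom_def)
  have Jk: "J = a_kernel ?R ?R' \<pi>"
    unfolding a_kernel_def' J by simp
  interpret J: ideal J ?R unfolding Jk by (rule kernel_is_ideal)
  \<comment> \<open>\<open>\<pi>\<close> is constant on cosets, so the image of a coset is a
    singleton.\<close>
  define h where "h = restrict (\<lambda>U. the_elem (\<pi> ` U)) (carrier (?R Quot J))"
  have coset: "J +>\<^bsub>?R\<^esub> p \<in> carrier (?R Quot J)" if "keys p \<subseteq> carrier G" for p
    using that ring_hom_closed[OF J.rcos_ring_hom, of p] by simp
  have cosetE: "\<exists>p. keys p \<subseteq> carrier G \<and> U = J +>\<^bsub>?R\<^esub> p" if "U \<in> carrier (?R Quot J)" for U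
    using that by (auto simp: FactRing_def A_RCOSETS_def')
  have h: "h (J +>\<^bsub>?R\<^esub> p) = \<pi> p" if "keys p \<subseteq> carrier G" for p
    using that coset[OF that] the_elem_simp[of p] by (simp add: h_def Jk)
  have eq_iff: "J +>\<^bsub>?R\<^esub> p = J +>\<^bsub>?R\<^esub> r \<longleftrightarrow> \<pi> p = \<pi> r"
    if "keys p \<subseteq> carrier G" "keys r \<subseteq> carrier G" for p r
  proof
    assume "J +>\<^bsub>?R\<^esub> p = J +>\<^bsub>?R\<^esub> r"
    then show "\<pi> p = \<pi> r" using h that by metis
  next
    assume "\<pi> p = \<pi> r"
    then show "J +>\<^bsub>?R\<^esub> p = J +>\<^bsub>?R\<^esub> r"
      using homeq_imp_rcos[of p r] that R.a_repr_independence[OF _ _ J.a_subgroup] by (simp add: Jk)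
  qed
  \<comment> \<open>By definition a scalar multiple of a coset is a union of cosets over all
    representatives. They coincide because \<open>\<pi>\<close> is linear and constant on the given
    coset.\<close>
  have smult: "k \<odot>\<^bsub>quot_alg ?R J\<^esub> (J +>\<^bsub>?R\<^esub> p) = J +>\<^bsub>?R\<^esub> scl k p" if p: "keys p \<subseteq> carrier G" for k p
  proof -
    have "J +>\<^bsub>?R\<^esub> scl k u = J +>\<^bsub>?R\<^esub> scl k p" if u: "u \<in> J +>\<^bsub>?R\<^esub> p" for u
    proof -
      obtain j where j: "j \<in> J" "u = j + p"
        using u by (auto simp: a_r_coset_def')
      then have "keys u \<subseteq> carrier G" "\<pi> u = \<pi> p"
        using p hom_add[of j p] by (auto simp: J keys_add_subset)
      then show ?thesis
        using p alg_homD(5)[OF \<pi>, of u k] alg_homD(5)[OF \<pi>, of p k]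
        by (subst eq_iff) (auto simp: keys_scl_in)
    qed
    moreover have "J +>\<^bsub>?R\<^esub> p \<noteq> {}" using p J.a_rcos_self[of p] by auto
    ultimately have "(\<Union>u\<in>J +>\<^bsub>?R\<^esub> p. J +>\<^bsub>?R\<^esub> scl k u) = J +>\<^bsub>?R\<^esub> scl k p"
      by (rule SUP_eq_const[rotated])
    then show ?thesis by simp
  qed
  note quot = J.rcos_ring_hom[THEN ring_hom_mult, symmetric] J.rcos_ring_hom[THEN ring_hom_add, symmetric]
    J.rcos_ring_hom[THEN ring_hom_one, symmetric]
  have "tw_coords S c (quot_alg ?R J) h"
  proof (rule tw_coordsI)
    show "h \<in> extensional (carrier (quot_alg ?R J))"
      by (simp add: h_def)
    show "bij_betw h (carrier (quot_alg ?R J)) {p. keys p \<subseteq> carrier S}"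
    proof (rule bij_betwI')
      fix U V assume "U \<in> carrier (quot_alg ?R J)" "V \<in> carrier (quot_alg ?R J)"
      then obtain p r where "keys p \<subseteq> carrier G" "U = J +>\<^bsub>?R\<^esub> p"
        "keys r \<subseteq> carrier G" "V = J +>\<^bsub>?R\<^esub> r" using cosetE unfolding quot_alg_simps by meson
      then show "h U = h V \<longleftrightarrow> U = V"
        by (simp add: h eq_iff)
    next
      fix U assume "U \<in> carrier (quot_alg ?R J)"
      then obtain p where p: "keys p \<subseteq> carrier G" "U = J +>\<^bsub>?R\<^esub> p"
        using cosetE unfolding quot_alg_simps by meson
      then show "h U \<in> {p. keys p \<subseteq> carrier S}"
        using alg_homD(1)[OF \<pi>, of p] by (simp add: h)
    next
      fix p :: "'s \<Rightarrow>\<^sub>0 'k" assume "p \<in> {p. keys p \<subseteq> carrier S}"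
      then have "p \<in> \<pi> ` carrier ?R" unfolding surj by simp
      then obtain r where "keys r \<subseteq> carrier G" "p = \<pi> r" by auto
      then show "\<exists>U\<in>carrier (quot_alg ?R J). p = h U"
        using h[of r] coset[of r] by (intro bexI[of _ "J +>\<^bsub>?R\<^esub> r"]) simp_all
    qed
    have z: "\<zero>\<^bsub>?R Quot J\<^esub> = J +>\<^bsub>?R\<^esub> 0"
      using R.a_coset_add_zero[OF J.a_subset] by (simp add: FactRing_def)
    show "\<zero>\<^bsub>quot_alg ?R J\<^esub> \<in> carrier (quot_alg ?R J)" "h \<zero>\<^bsub>quot_alg ?R J\<^esub> = 0"
      using coset[of 0] h[of 0] hom_zero by (simp_all add: z)
    have o: "\<one>\<^bsub>?R Quot J\<^esub> = J +>\<^bsub>?R\<^esub> \<one>\<^bsub>?R\<^esub>"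
      by (simp add: FactRing_def)
    show "\<one>\<^bsub>quot_alg ?R J\<^esub> \<in> carrier (quot_alg ?R J)"
      "h \<one>\<^bsub>quot_alg ?R J\<^esub> = Poly_Mapping.single \<one>\<^bsub>S\<^esub> 1"
      using coset[of "\<one>\<^bsub>?R\<^esub>"] h[of "\<one>\<^bsub>?R\<^esub>"] hom_one R.one_closed unfolding quot_alg_simps o by auto
    fix U V and k :: 'k
    assume U: "U \<in> carrier (quot_alg ?R J)"
    then obtain p where p: "keys p \<subseteq> carrier G" "U = J +>\<^bsub>?R\<^esub> p"
      using cosetE unfolding quot_alg_simps by meson
    show "k \<odot>\<^bsub>quot_alg ?R J\<^esub> U \<in> carrier (quot_alg ?R J) \<and> h (k \<odot>\<^bsub>quot_alg ?R J\<^esub> U) = scl k (h U)"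
      using p coset h alg_homD(5)[OF \<pi>, of p k] unfolding p(2) smult[OF p(1)]
      by (auto simp: keys_scl_in)
    assume V: "V \<in> carrier (quot_alg ?R J)"
    then obtain r where r: "keys r \<subseteq> carrier G" "V = J +>\<^bsub>?R\<^esub> r"
      using cosetE unfolding quot_alg_simps by meson
    have cl: "keys (tw_mult G b p r) \<subseteq> carrier G"
      using R.m_closed[of p r] p r by simp
    have "U \<otimes>\<^bsub>quot_alg ?R J\<^esub> V = J +>\<^bsub>?R\<^esub> tw_mult G b p r" "U \<oplus>\<^bsub>quot_alg ?R J\<^esub> V = J +>\<^bsub>?R\<^esub> (p + r)"
      using quot(1,2)[of p r] p r by simp_all
    then show "U \<oplus>\<^bsub>quot_alg ?R J\<^esub> V \<in> carrier (quot_alg ?R J) \<and> h (U \<oplus>\<^bsub>quot_alg ?R J\<^esub> V) = h U + h V"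
      "U \<otimes>\<^bsub>quot_alg ?R J\<^esub> V \<in> carrier (quot_alg ?R J) \<and>
         h (U \<otimes>\<^bsub>quot_alg ?R J\<^esub> V) = tw_mult S c (h U) (h V)"
      using p r cl hom_mult[of p r] hom_add[of p r] coset h by (auto simp: keys_add_subset)
  qed fact+
  then show thesis using h coset that by simp
qed

text \<open>Multiplicativity is a bilinear condition, hence checked on pairs of basis elements. The
  factor \<open>b x y\<close> is the cocycle of the source: 1 for the presentations by generators
  and relations, a pullback for the Segre maps.\<close>

lemma lext_alg_hom:
  fixes G :: "('g, 'y) monoid_scheme" and S :: "('s, 'z) monoid_scheme"
    and b :: "'g \<Rightarrow> 'g \<Rightarrow> 'k::field" and c :: "'s \<Rightarrow> 's \<Rightarrow> 'k"
  assumes "monoid G" "monoid S"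
    and keys: "\<And>x. x \<in> carrier G \<Longrightarrow> keys (\<phi> x) \<subseteq> carrier S"
    and one: "\<phi> \<one>\<^bsub>G\<^esub> = Poly_Mapping.single \<one>\<^bsub>S\<^esub> 1"
    and mult: "\<And>x y. x \<in> carrier G \<Longrightarrow> y \<in> carrier G \<Longrightarrow>
      scl (b x y) (\<phi> (x \<otimes>\<^bsub>G\<^esub> y)) = tw_mult S c (\<phi> x) (\<phi> y)"
  shows "restrict (lext \<phi>) (carrier (tw_alg G b)) \<in> alg_hom (tw_alg G b) (tw_alg S c)"
proof -
  interpret G: monoid G by fact
  have "lext \<phi> (tw_mult G b p r) = tw_mult S c (lext \<phi> p) (lext \<phi> r)"
    if "keys p \<subseteq> carrier G" "keys r \<subseteq> carrier G" for p r
    using that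
  proof (induction p rule: keys_induct)
    case (single x k)
    from single(2,1) show ?case
    proof (induction r rule: keys_induct)
      case (single y l)
      then have "lext \<phi> (tw_mult G b (Poly_Mapping.single x k) (Poly_Mapping.single y l)) =
          scl (k * l) (scl (b x y) (\<phi> (x \<otimes>\<^bsub>G\<^esub> y)))" by simp
      then show ?case unfolding mult[OF single(2,1)] by (simp add: mult.commute)
    qed (simp_all add: lext_add tw_mult_add_right)
  qed (simp_all add: lext_add tw_mult_add_left)
  moreover have "keys (lext \<phi> p) \<subseteq> carrier S" if "keys p \<subseteq> carrier G" for p
    using that by (intro keys_lext keys) auto
  ultimately show ?thesis
    by (intro alg_homI)
      (simp_all add: lext_add lext_scl one G.keys_tw_mult keys_add_subset keys_scl_in)
qed

lemma tw_mult_diff_left: "tw_mult S c (p - p') r = tw_mult S c p r - tw_mult S c p' r"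
  by (simp add: tw_mult_def lext_diff)

lemma tw_mult_diff_right: "tw_mult S c p (r - r') = tw_mult S c p r - tw_mult S c p r'"
  using tw_mult_add_right[of S c p "r - r'" r'] by (simp add: algebra_simps)

text \<open>If \<open>\<tau>\<close> inverts \<open>\<phi>\<close> modulo \<open>J\<close> on basis elements, then it does so everywhere.\<close>

lemma lext_kernel_subset:
  assumes "0 \<in> J" and add: "\<And>p r. p \<in> J \<Longrightarrow> r \<in> J \<Longrightarrow> p + r \<in> J"
    and scl: "\<And>k p. p \<in> J \<Longrightarrow> scl k p \<in> J"
    and basis: "\<And>x. x \<in> X \<Longrightarrow> Poly_Mapping.single x 1 - lext \<tau> (\<phi> x) \<in> J"
    and p: "keys p \<subseteq> X" "lext \<phi> p = 0"
  shows "p \<in> J"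
proof -
  \<comment> \<open>This difference is linear in \<open>p\<close>, and on the kernel of
    \<open>lext \<phi>\<close> it is \<open>p\<close> itself.\<close>
  have "p - lext \<tau> (lext \<phi> p) \<in> J"
    using p(1)
  proof (induction p rule: keys_induct)
    case (single x k)
    then show ?case using scl[OF basis[OF single], of k] by (simp add: scl_diff lext_scl)
  next
    case (add p r)
    then show ?case using assms(2)[OF add(3,4)] by (simp add: lext_add algebra_simps)
  qed (simp add: assms(1))
  then show ?thesis by (simp add: p(2))
qed

section \<open>Products of generators in a twist of a polynomial algebra\<close>

lemma nat_vec_simps [simp]:
  "carrier (nat_vec I) = {s. keys s \<subseteq> I}" "monoid.mult (nat_vec I) = (+)" "one (nat_vec I) = 0"
  by (simp_all add: nat_vec_def)

lemma keys_nat_add_subset: "keys p \<subseteq> X \<Longrightarrow> keys r \<subseteq> X \<Longrightarrow> keys (p + r :: _ \<Rightarrow>\<^sub>0 nat) \<subseteq> X"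
  using keys_add[of p r] by auto

lemma monoid_nat_vec: "monoid (nat_vec I)"
  by (rule monoidI) (simp_all add: add.assoc keys_nat_add_subset)

lemma keys_unit_vec [simp]: "keys (unit_vec i) = {i}"
  by (simp add: unit_vec_def)

text \<open>Abelianization of the free monoid: a word goes to the exponent vector of its
  monomial.\<close>

definition exps :: "'i list \<Rightarrow> 'i \<Rightarrow>\<^sub>0 nat" where
  "exps w = sum_list (map unit_vec w)"

text \<open>In the twist by \<open>c\<close>, the product of the variables listed in \<open>w\<close> is \<open>wcoef c w\<close> times the
  monomial \<open>exps w\<close>.\<close>

primrec wcoef :: "(('i \<Rightarrow>\<^sub>0 nat) \<Rightarrow> ('i \<Rightarrow>\<^sub>0 nat) \<Rightarrow> 'k::field) \<Rightarrow> 'i list \<Rightarrow> 'k" where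
  "wcoef c [] = 1"
| "wcoef c (x # w) = c (unit_vec x) (exps w) * wcoef c w"

lemma exps_simps [simp]:
  "exps [] = 0" "exps (x # w) = unit_vec x + exps w" "exps (w @ v) = exps w + exps v"
  by (simp_all add: exps_def)

lemma keys_exps: "w \<in> lists I \<Longrightarrow> keys (exps w) \<subseteq> I"
  by (induction w) (simp_all add: keys_nat_add_subset)

text \<open>Exponent vectors of words are multisets of letters, so normal forms can be taken from
  library sorting.\<close>

lemma lookup_exps: "lookup (exps w) i = count (mset w) i"
  by (induction w) (auto simp: lookup_add unit_vec_def lookup_single when_def)

lemma exps_eq_iff: "exps w = exps v \<longleftrightarrow> mset w = mset v"
  by (metis lookup_exps multiset_eqI poly_mapping_eqI)

lemma exps_sort [simp]: "exps (sort w) = exps w" "exps (insort x w) = exps (x # w)"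
  by (subst exps_eq_iff, simp)+

text \<open>The normal form of a monomial in a quantum space. The choice is harmless: a sorted word
  is determined by its multiset of letters.\<close>

definition sorted_word :: "('i::linorder \<Rightarrow>\<^sub>0 nat) \<Rightarrow> 'i list" where
  "sorted_word s = (SOME w. sorted w \<and> exps w = s)"

lemma sorted_word: "sorted (sorted_word s)" "exps (sorted_word s) = s"
proof -
  have "count (Abs_multiset (lookup s)) = lookup s"
    by (rule Abs_multiset_inverse) (use finite_keys[of s] in \<open>simp add: keys.rep_eq\<close>)
  moreover obtain w where "mset w = Abs_multiset (lookup s)" using ex_mset by blast
  ultimately have "exps (sort w) = s"
    by (intro poly_mapping_eqI) (simp add: lookup_exps)
  then have "sorted (sort w) \<and> exps (sort w) = s" by simp
  then have "sorted (sorted_word s) \<and> exps (sorted_word s) = s"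
    unfolding sorted_word_def by (rule someI)
  then show "sorted (sorted_word s)" "exps (sorted_word s) = s" by auto
qed

lemma sorted_word_exps: "sorted_word (exps w) = sort w"
  using sorted_word[of "exps w"] properties_for_sort[of "sorted_word (exps w)" w]
  by (simp add: exps_eq_iff)

lemma set_exps: "set w = keys (exps w)"
  by (auto simp: in_keys_iff lookup_exps)

lemma sorted_word_in_lists: "keys s \<subseteq> I \<Longrightarrow> sorted_word s \<in> lists I"
  using set_exps[of "sorted_word s"] by (auto simp: sorted_word in_lists_conv_set)

lemma cocycle_nat_vec:
  assumes "cocycle (nat_vec I) c"
  shows "keys x \<subseteq> I \<Longrightarrow> keys y \<subseteq> I \<Longrightarrow> c x y \<noteq> 0"
    and "keys x \<subseteq> I \<Longrightarrow> keys y \<subseteq> I \<Longrightarrow> keys z \<subseteq> I \<Longrightarrow> c x (y + z) * c y z = c x y * c (x + y) z"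
    and "keys x \<subseteq> I \<Longrightarrow> c x 0 = 1" "keys x \<subseteq> I \<Longrightarrow> c 0 x = 1"
  using assms by (auto simp: cocycle_def)

lemma wcoef_nonzero:
  assumes "cocycle (nat_vec I) c" "w \<in> lists I"
  shows "wcoef c w \<noteq> 0"
  using assms(2) by (induction w) (auto simp: cocycle_nat_vec[OF assms(1)] keys_exps)

text \<open>Iterating the cocycle identity along \<open>w\<close>. This is what makes sending a word
  to \<open>wcoef\<close> times its monomial multiplicative.\<close>

lemma wcoef_append:
  assumes c: "cocycle (nat_vec I) c" and "w \<in> lists I" "v \<in> lists I"
  shows "wcoef c (w @ v) = wcoef c w * wcoef c v * c (exps w) (exps v)"
  using assms(2)
proof (induction w)
  case Nil
  then show ?case using assms(3) by (simp add: cocycle_nat_vec[OF c] keys_exps)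
next
  case (Cons x w)
  have "c (unit_vec x) (exps w + exps v) * c (exps w) (exps v) =
      c (unit_vec x) (exps w) * c (unit_vec x + exps w) (exps v)"
    using Cons assms(3) by (intro cocycle_nat_vec(2)[OF c]) (auto intro!: keys_exps)
  then show ?case using Cons by (simp add: mult_ac)
qed

text \<open>Each exponent vector is \<open>exps\<close> of a word, so the claim is list
  induction.\<close>

lemma mon_gen_nat_vec: "mon_gen (nat_vec I) (unit_vec ` (I :: 'i::linorder set))"
  unfolding mon_gen_def
proof (intro conjI allI impI ballI)
  fix P and s :: "'i \<Rightarrow>\<^sub>0 nat"
  assume P: "P \<one>\<^bsub>nat_vec I\<^esub>" "\<forall>x\<in>unit_vec ` I. \<forall>s\<in>carrier (nat_vec I). P s \<longrightarrow> P (x \<otimes>\<^bsub>nat_vec I\<^esub> s)"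
    and "s \<in> carrier (nat_vec I)"
  have "P (exps w)" if "w \<in> lists I" for w
    using that
  proof (induction w)
    case (Cons x w)
    then show ?case using P(2) keys_exps[of w I] by simp
  qed (use P in simp)
  from this[of "sorted_word s"] show "P s"
    using \<open>s \<in> _\<close> by (auto simp: sorted_word sorted_word_in_lists)
qed auto

section \<open>Quantum spaces\<close>

lemma monoid_free_monoid: "monoid (free_monoid I)"
  by (rule monoidI) (auto simp: free_monoid_def)

lemma free_monoid_simps [simp]:
  "carrier (free_monoid I) = lists I" "monoid.mult (free_monoid I) = (@)" "one (free_monoid I) = []"
  by (simp_all add: free_monoid_def)

lemma cocycle_one: "cocycle S (\<lambda>_ _. 1)"
  by (simp add: cocycle_def)

context
  fixes I :: "'i::linorder set" and q :: "'i \<Rightarrow> 'i \<Rightarrow> 'k::field" and F J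
  defines "F \<equiv> tw_alg (free_monoid I) (\<lambda>_ _. 1 :: 'k)" and "J \<equiv> qspace_ideal I q"
begin

private abbreviation "rels \<equiv> {Poly_Mapping.single [j, i] 1 - Poly_Mapping.single [i, j] (q j i) | i j.
        i \<in> I \<and> j \<in> I \<and> i < j}"

private lemma ring_F: "ring F"
  unfolding F_def by (intro ring_tw_alg monoid_free_monoid cocycle_one)

private lemma rels_F: "rels \<subseteq> carrier F"
proof -
  have "keys (Poly_Mapping.single [j, i] 1 - Poly_Mapping.single [i, j] (q j i)) \<subseteq> lists I"
    if "i \<in> I" "j \<in> I" for i j
    using keys_add_subset[of "Poly_Mapping.single [j, i] 1" "lists I"
        "Poly_Mapping.single [i, j] (- q j i)"] that
    by (simp add: single_uminus)
  then show ?thesis by (auto simp: F_def simp del: in_lists_conv_set)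
qed

private lemma J_eq: "J = Idl\<^bsub>F\<^esub> rels"
  by (simp add: J_def qspace_ideal_def monoid_alg_tw_alg F_def)

private lemma ideal_J: "ideal J F"
  unfolding J_eq by (intro ring.genideal_ideal ring_F rels_F)

text \<open>An ideal is closed under multiplication by ring elements; scalars act through multiples
  of the empty word.\<close>

private lemma J_closed:
  assumes "p \<in> J"
  shows "r \<in> J \<Longrightarrow> p + r \<in> J" "scl k p \<in> J"
    "w \<in> lists I \<Longrightarrow> tw_mult (free_monoid I) (\<lambda>_ _. 1) (Poly_Mapping.single w 1) p \<in> J"
    "w \<in> lists I \<Longrightarrow> tw_mult (free_monoid I) (\<lambda>_ _. 1) p (Poly_Mapping.single w 1) \<in> J"
proof -
  interpret J: ideal J F by (rule ideal_J)
  have l: "tw_mult (free_monoid I) (\<lambda>_ _. 1) (Poly_Mapping.single w k) p \<in> J"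
    and r: "tw_mult (free_monoid I) (\<lambda>_ _. 1) p (Poly_Mapping.single w k) \<in> J" if "w \<in> lists I" for w k
    using J.I_l_closed[OF assms, of "Poly_Mapping.single w k"]
      J.I_r_closed[OF assms, of "Poly_Mapping.single w k"] that by (simp_all add: F_def)
  have "p \<in> carrier F" using assms J.a_subset by auto
  then have "tw_mult (free_monoid I) (\<lambda>_ _. 1) (Poly_Mapping.single [] 1) p = p"
    using J.l_one[of p] by (simp add: F_def)
  then show "scl k p \<in> J"
    using l[of "[]" k] tw_mult_scl(1)[of "free_monoid I" "\<lambda>_ _. 1" k "Poly_Mapping.single [] 1" p] by simp
  show "tw_mult (free_monoid I) (\<lambda>_ _. 1) (Poly_Mapping.single w 1) p \<in> J"
    "tw_mult (free_monoid I) (\<lambda>_ _. 1) p (Poly_Mapping.single w 1) \<in> J" if "w \<in> lists I"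
    using l r that by blast+
  show "r \<in> J \<Longrightarrow> p + r \<in> J" using additive_subgroup.a_closed[OF J.is_additive_subgroup assms] by (simp add: F_def)
qed

private lemma zero_J: "0 \<in> J"
  using additive_subgroup.zero_closed[OF ideal.axioms(1)[OF ideal_J]] by (simp add: F_def)

text \<open>The letter \<open>x\<close> moves past smaller letters one relation at a time. The
  accumulated scalar stays existential: it is determined afterwards by applying a map that kills
  \<open>J\<close>.\<close>

private lemma insort_mod_J:
  assumes "x \<in> I" "v \<in> lists I"
  shows "\<exists>k. Poly_Mapping.single (x # v) 1 - Poly_Mapping.single (insort x v) k \<in> J"
  using assms(2)
proof (induction v)
  case Nil
  then show ?case by (intro exI[of _ 1]) (simp add: zero_J)
next
  case (Cons y v)
  show ?case
  proof (cases "x \<le> y")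
    case True
    then show ?thesis by (intro exI[of _ 1]) (simp add: zero_J)
  next
    case False
    obtain k where k: "Poly_Mapping.single (x # v) 1 - Poly_Mapping.single (insort x v) k \<in> J"
      using Cons by auto
    \<comment> \<open>A defining relation, with \<open>y\<close> as the smaller letter; it is
      multiplied by \<open>v\<close> on the right, and the induction hypothesis by \<open>y\<close>
      on the left.\<close>
    have "Poly_Mapping.single [x, y] 1 - Poly_Mapping.single [y, x] (q x y) \<in> J"
      using ring.genideal_self[OF ring_F rels_F] Cons False assms(1) unfolding J_eq by force
    from J_closed(4)[OF this Cons(2)] have "Poly_Mapping.single (x # y # v) 1 -
        Poly_Mapping.single (y # x # v) (q x y) \<in> J"
      by (simp add: tw_mult_diff_left)
    moreover from J_closed(2)[OF J_closed(3)[OF k, of "[y]"], of "q x y"]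
    have "Poly_Mapping.single (y # x # v) (q x y) -
        Poly_Mapping.single (y # insort x v) (q x y * k) \<in> J"
      using Cons by (simp add: tw_mult_diff_right scl_diff)
    ultimately have "Poly_Mapping.single (x # y # v) 1 -
        Poly_Mapping.single (y # insort x v) (q x y * k) \<in> J"
      using J_closed(1) by fastforce
    then show ?thesis using False by auto
  qed
qed

text \<open>Insertion sort, with the scalars of the successive insertions multiplied.\<close>

private lemma sort_mod_J:
  assumes "w \<in> lists I"
  shows "\<exists>k. Poly_Mapping.single w 1 - Poly_Mapping.single (sort w) k \<in> J"
  using assms
proof (induction w)
  case Nil
  then show ?case by (intro exI[of _ 1]) (simp add: zero_J)
next
  case (Cons x w)
  then obtain k where k: "Poly_Mapping.single w 1 - Poly_Mapping.single (sort w) k \<in> J" by auto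
  obtain l where l: "Poly_Mapping.single (x # sort w) 1 - Poly_Mapping.single (insort x (sort w)) l \<in> J"
    using insort_mod_J[of x "sort w"] Cons(1,2) by fastforce
  have "Poly_Mapping.single (x # w) 1 - Poly_Mapping.single (x # sort w) k \<in> J"
    using J_closed(3)[OF k, of "[x]"] Cons by (simp add: tw_mult_diff_right)
  from J_closed(1)[OF this J_closed(2)[OF l, of k]]
  have "Poly_Mapping.single (x # w) 1 - Poly_Mapping.single (sort (x # w)) (k * l) \<in> J"
    by (simp add: scl_diff)
  then show ?case by blast
qed

text \<open>A basis theorem of Poincare-Birkhoff-Witt type. Only the commutation ratios of
  \<open>c\<close> on generators enter, and generators go to variables with coefficient 1.\<close>

lemma tw_coords_qspace:
  assumes c: "cocycle (nat_vec I) c"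
    and cq: "\<And>i j. i \<in> I \<Longrightarrow> j \<in> I \<Longrightarrow> i < j \<Longrightarrow>
      c (unit_vec j) (unit_vec i) = q j i * c (unit_vec i) (unit_vec j)"
  obtains h where "tw_coords (nat_vec I) c (qspace I q) h"
    and "\<And>i. i \<in> I \<Longrightarrow>
      qspace_gen I q i \<in> carrier (qspace I q) \<and> h (qspace_gen I q i) = poly_var i"
proof -
  let ?\<phi> = "\<lambda>w. Poly_Mapping.single (exps w) (wcoef c w)"
  \<comment> \<open>The section: the sorted word of a monomial, divided by its coefficient so that
    \<open>?\<phi>\<close> returns the monomial itself.\<close>
  let ?\<tau> = "\<lambda>s. Poly_Mapping.single (sorted_word s) (1 / wcoef c (sorted_word s))"
  define \<pi> where "\<pi> = restrict (lext ?\<phi>) (carrier F)"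
  interpret monoid "nat_vec I" by (rule monoid_nat_vec)
  have hom: "\<pi> \<in> alg_hom F (tw_alg (nat_vec I) c)"
    unfolding \<pi>_def F_def
    by (rule lext_alg_hom)
      (simp_all add: monoid_free_monoid monoid_nat_vec keys_exps wcoef_append[OF c] del: in_lists_conv_set)
  have \<tau>: "lext ?\<phi> (?\<tau> s) = Poly_Mapping.single s 1" "sorted_word s \<in> lists I" if "keys s \<subseteq> I" for s
    using sorted_word_in_lists[OF that] wcoef_nonzero[OF c sorted_word_in_lists[OF that]]
    by (simp_all add: sorted_word)
  have \<tau>_lext: "lext ?\<phi> (lext ?\<tau> p) = p" if "keys p \<subseteq> carrier (nat_vec I)" for p
    using that
  proof (induction p rule: keys_induct)
    case (single s k)
    have "lext ?\<phi> (lext ?\<tau> (Poly_Mapping.single s k)) = scl k (lext ?\<phi> (?\<tau> s))"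
      by (simp only: lext_single lext_scl)
    then show ?case using single by (simp add: \<tau>(1) del: lext_single)
  qed (simp_all add: lext_add)
  have \<tau>_keys: "keys (lext ?\<tau> p) \<subseteq> lists I" if "keys p \<subseteq> carrier (nat_vec I)" for p
  proof (rule keys_lext)
    fix s assume "s \<in> keys p"
    then show "keys (?\<tau> s) \<subseteq> lists I" using that \<tau>(2)[of s] by (auto split: if_splits)
  qed
  have surj: "\<pi> ` carrier F = carrier (tw_alg (nat_vec I) c)"
  proof
    show "\<pi> ` carrier F \<subseteq> carrier (tw_alg (nat_vec I) c)" using alg_homD(1)[OF hom] by blast
    show "carrier (tw_alg (nat_vec I) c) \<subseteq> \<pi> ` carrier F"
    proof
      fix p :: "('i \<Rightarrow>\<^sub>0 nat) \<Rightarrow>\<^sub>0 'k" assume "p \<in> carrier (tw_alg (nat_vec I) c)"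
      then have p: "keys p \<subseteq> carrier (nat_vec I)" by simp
      have "p = \<pi> (lext ?\<tau> p)" using \<tau>_lext[OF p] \<tau>_keys[OF p] by (simp add: \<pi>_def F_def)
      then show "p \<in> \<pi> ` carrier F" using \<tau>_keys[OF p] by (auto simp: F_def simp del: in_lists_conv_set)
    qed
  qed
  have sub: "J \<subseteq> {p. keys p \<subseteq> carrier (free_monoid I) \<and> \<pi> p = 0}"
  proof -
    interpret ring_hom_ring F "tw_alg (nat_vec I) c" \<pi>
      using hom c by (intro ring_hom_ringI2 ring_F ring_tw_alg monoid_nat_vec) (auto simp: alg_hom_def)
    have ker: "a_kernel F (tw_alg (nat_vec I) c) \<pi> =
        {p. keys p \<subseteq> carrier (free_monoid I) \<and> \<pi> p = 0}"
      unfolding a_kernel_def' by (simp add: F_def)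
    have "rels \<subseteq> a_kernel F (tw_alg (nat_vec I) c) \<pi>"
    proof
      fix p assume p: "p \<in> rels"
      then have "keys p \<subseteq> carrier (free_monoid I)" using rels_F by (auto simp: F_def)
      \<comment> \<open>A defining relation goes to the monomial of its two letters times \<open>c
        (unit_vec j) (unit_vec i) - q j i * c (unit_vec i) (unit_vec j)\<close>, which is zero by
        \<open>cq\<close>.\<close>
      moreover have "lext ?\<phi> p = 0"
        using p by (auto simp: lext_diff cocycle_nat_vec[OF c] cq add.commute)
      ultimately show "p \<in> a_kernel F (tw_alg (nat_vec I) c) \<pi>"
        unfolding ker by (simp add: \<pi>_def F_def)
    qed
    then show ?thesis
      unfolding J_eq ker[symmetric] by (intro R.genideal_minimal kernel_is_ideal)
  qed
  have "p \<in> J" if p: "keys p \<subseteq> carrier (free_monoid I)" "\<pi> p = 0" for p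
  proof (rule lext_kernel_subset[where \<phi> = ?\<phi> and \<tau> = ?\<tau> and X = "lists I"])
    fix w assume w: "w \<in> lists I"
    \<comment> \<open>The scalar \<open>k\<close> is found by applying \<open>?\<phi>\<close>, which
      kills \<open>J\<close>, and reading off the coefficient of \<open>exps w\<close>: it is the
      ratio of the coefficients of \<open>w\<close> and \<open>sort w\<close>, exactly the factor
      that \<open>?\<tau>\<close> produces.\<close>
    obtain k where k: "Poly_Mapping.single w 1 - Poly_Mapping.single (sort w) k \<in> J"
      using sort_mod_J[OF w] by auto
    then have "lext ?\<phi> (Poly_Mapping.single w 1 - Poly_Mapping.single (sort w) k) = 0"
      using subsetD[OF sub k] by (auto simp: \<pi>_def F_def)
    then have "lookup (lext ?\<phi> (Poly_Mapping.single w 1 - Poly_Mapping.single (sort w) k)) (exps w) = 0"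
      by simp
    then have "wcoef c w = k * wcoef c (sort w)"
      by (simp add: lext_diff lookup_minus)
    moreover have "wcoef c (sort w) \<noteq> 0" using w by (intro wcoef_nonzero[OF c]) auto
    ultimately show "Poly_Mapping.single w 1 - lext ?\<tau> (?\<phi> w) \<in> J"
      using k by (simp add: sorted_word_exps)
  next
    show "lext ?\<phi> p = 0" "keys p \<subseteq> lists I" using p by (simp_all add: \<pi>_def F_def)
  qed (auto intro: J_closed zero_J)
  then have J: "J = {p. keys p \<subseteq> carrier (free_monoid I) \<and> \<pi> p = 0}" using sub by auto
  obtain h where h: "tw_coords (nat_vec I) c (quot_alg F J) h"
    "\<And>p. keys p \<subseteq> carrier (free_monoid I) \<Longrightarrow>
      J +>\<^bsub>F\<^esub> p \<in> carrier (quot_alg F J) \<and> h (J +>\<^bsub>F\<^esub> p) = \<pi> p"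
    using tw_coords_quot_alg[OF monoid_free_monoid cocycle_one monoid_nat_vec c
        hom[unfolded F_def] surj[unfolded F_def] J] unfolding F_def by blast
  show thesis
  proof
    show "tw_coords (nat_vec I) c (qspace I q) h"
      using h(1) by (simp add: qspace_def J_def F_def monoid_alg_tw_alg)
    fix i assume "i \<in> I"
    then have "J +>\<^bsub>F\<^esub> Poly_Mapping.single [i] 1 \<in> carrier (quot_alg F J) \<and>
        h (J +>\<^bsub>F\<^esub> Poly_Mapping.single [i] 1) = poly_var i"
      using h(2)[of "Poly_Mapping.single [i] 1"]
      by (simp add: \<pi>_def F_def poly_var_def cocycle_nat_vec[OF c])
    then show "qspace_gen I q i \<in> carrier (qspace I q) \<and> h (qspace_gen I q i) = poly_var i"
      by (simp add: qspace_gen_def qspace_def J_def F_def monoid_alg_tw_alg)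
  qed
qed

end

section \<open>Tensor products\<close>

definition tens :: "('s \<Rightarrow>\<^sub>0 'k::field) \<Rightarrow> ('t \<Rightarrow>\<^sub>0 'k) \<Rightarrow> 's \<times> 't \<Rightarrow>\<^sub>0 'k" where
  "tens p r = lext (\<lambda>s. lext (\<lambda>t. Poly_Mapping.single (s, t) 1) r) p"

lemma tens_add: "tens (p + p') r = tens p r + tens p' r" "tens p (r + r') = tens p r + tens p r'"
  by (simp_all add: tens_def lext_add lext_fun_add)

lemma tens_scl: "tens (scl k p) r = scl k (tens p r)" "tens p (scl k r) = scl k (tens p r)"
  by (simp_all add: tens_def lext_scl lext_fun_scl)

lemma tens_zero [simp]: "tens 0 r = 0" "tens p 0 = 0"
  by (simp_all add: tens_def lext_def)

lemma tens_single [simp]: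
  "tens (Poly_Mapping.single s k) (Poly_Mapping.single t l) = Poly_Mapping.single (s, t) (k * l)"
  by (simp add: tens_def)

lemma keys_tens:
  assumes "keys p \<subseteq> X" "keys r \<subseteq> Y"
  shows "keys (tens p r) \<subseteq> X \<times> Y"
  unfolding tens_def using assms by (intro keys_lext) auto

text \<open>Both sides are linear in each of the four arguments and agree on basis elements. The
  product of cocycles thus encodes that the two tensor factors commute with each other.\<close>

lemma tens_tw_mult:
  assumes "keys p \<subseteq> carrier S" "keys p' \<subseteq> carrier S" "keys r \<subseteq> carrier T" "keys r' \<subseteq> carrier T"
  shows "tens (tw_mult S c p p') (tw_mult T d r r') =
    tw_mult (S \<times>\<times> T) (prod_cocycle c d) (tens p r) (tens p' r')"
  using assms
proof (induction p rule: keys_induct)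
  case (single s k)
  from single(2,1,3,4) show ?case
  proof (induction p' rule: keys_induct)
    case (single s' k')
    from single(3,1,2,4) show ?case
    proof (induction r rule: keys_induct)
      case (single t l)
      from single(4,1,2,3) show ?case
        by (induction r' rule: keys_induct)
          (simp_all add: tw_mult_add_left tw_mult_add_right tens_add prod_cocycle_def mult_ac)
    qed (simp_all add: tw_mult_add_left tw_mult_add_right tens_add)
  qed (simp_all add: tw_mult_add_left tw_mult_add_right tens_add)
qed (simp_all add: tw_mult_add_left tw_mult_add_right tens_add)

lemma cocycle_prod:
  assumes "cocycle S c" "cocycle T d"
  shows "cocycle (S \<times>\<times> T) (prod_cocycle c d)"
proof -
  have "c x (y \<otimes>\<^bsub>S\<^esub> z) * d x' (y' \<otimes>\<^bsub>T\<^esub> z') * (c y z * d y' z') =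
      c x y * d x' y' * (c (x \<otimes>\<^bsub>S\<^esub> y) z * d (x' \<otimes>\<^bsub>T\<^esub> y') z')"
    if "x \<in> carrier S" "y \<in> carrier S" "z \<in> carrier S"
      "x' \<in> carrier T" "y' \<in> carrier T" "z' \<in> carrier T" for x y z x' y' z'
  proof -
    have "c x (y \<otimes>\<^bsub>S\<^esub> z) * c y z = c x y * c (x \<otimes>\<^bsub>S\<^esub> y) z"
      "d x' (y' \<otimes>\<^bsub>T\<^esub> z') * d y' z' = d x' y' * d (x' \<otimes>\<^bsub>T\<^esub> y') z'"
      using that assms unfolding cocycle_def by blast+
    then have "(c x (y \<otimes>\<^bsub>S\<^esub> z) * c y z) * (d x' (y' \<otimes>\<^bsub>T\<^esub> z') * d y' z') =
      (c x y * c (x \<otimes>\<^bsub>S\<^esub> y) z) * (d x' y' * d (x' \<otimes>\<^bsub>T\<^esub> y') z')" by simp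
    then show ?thesis by (simp only: mult_ac)
  qed
  then show ?thesis
    using assms unfolding cocycle_def prod_cocycle_def by auto
qed

lemma lin_span_minimal:
  assumes "X \<subseteq> W" "W \<subseteq> carrier A" "\<zero>\<^bsub>A\<^esub> \<in> W" "\<And>u v. u \<in> W \<Longrightarrow> v \<in> W \<Longrightarrow> u \<oplus>\<^bsub>A\<^esub> v \<in> W"
    "\<And>k u. u \<in> W \<Longrightarrow> k \<odot>\<^bsub>A\<^esub> u \<in> W"
  shows "lin_span A X \<subseteq> W"
  unfolding lin_span_def using assms by (intro Inter_lower) auto

lemma lin_span_superset: "X \<subseteq> lin_span A X"
  unfolding lin_span_def by auto

lemma lin_span_closed:
  shows "\<zero>\<^bsub>A\<^esub> \<in> lin_span A X" "u \<in> lin_span A X \<Longrightarrow> v \<in> lin_span A X \<Longrightarrow> u \<oplus>\<^bsub>A\<^esub> v \<in> lin_span A X"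
    "u \<in> lin_span A X \<Longrightarrow> k \<odot>\<^bsub>A\<^esub> u \<in> lin_span A X"
  unfolding lin_span_def by auto

text \<open>The bilinear map \<open>tens (\<alpha> a) (\<beta> b)\<close> has a linear extension
  whose kernel is the span of the bilinearity relations, because modulo them each pair expands into
  pairs of basis elements.\<close>

lemma tw_coords_tensor_alg:
  fixes A :: "('k::field, 'a, 'y) module_scheme" and B :: "('k, 'b, 'z) module_scheme"
    and S :: "('s, 'v) monoid_scheme" and T :: "('t, 'w) monoid_scheme"
  assumes A: "tw_coords S c A \<alpha>" and B: "tw_coords T d B \<beta>"
  obtains \<theta> where "tw_coords (S \<times>\<times> T) (prod_cocycle c d) (tensor_alg A B) \<theta>"
    and "\<And>a b. a \<in> carrier A \<Longrightarrow> b \<in> carrier B \<Longrightarrow>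
      pure_tensor A B a b \<in> carrier (tensor_alg A B) \<and>
      \<theta> (pure_tensor A B a b) = tens (\<alpha> a) (\<beta> b)"
proof -
  note [simp] = tw_coordsD(5-10)[OF A] tw_coords_hom[OF A] tw_coordsD(5-10)[OF B] tw_coords_hom[OF B]
    tw_coords_inv[OF A] tw_coords_inv[OF B] tw_coords_inv_h[OF A] tw_coords_inv_h[OF B]
  let ?\<alpha>' = "inv_into (carrier A) \<alpha>" and ?\<beta>' = "inv_into (carrier B) \<beta>"
  let ?ST = "S \<times>\<times> T" and ?cd = "prod_cocycle c d"
  define F where "F = tw_alg (A \<times>\<times> B) (\<lambda>_ _. 1 :: 'k)"
  have F: "tensor_free A B = F"
    by (simp add: tensor_free_def monoid_alg_tw_alg F_def)
  define W where "W = tensor_rel A B"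
  have mAB: "monoid (A \<times>\<times> B)" and mST: "monoid ?ST"
    using ringE(2)[OF ring_tw_coords[OF A]] ringE(2)[OF ring_tw_coords[OF B]]
      tw_coordsD(1)[OF A] tw_coordsD(1)[OF B] by (intro DirProd_monoid; simp)+
  have cST: "cocycle ?ST ?cd"
    using A B by (intro cocycle_prod tw_coordsD)
  define \<phi> where "\<phi> = (\<lambda>(a, b). tens (\<alpha> a) (\<beta> b))"
  \<comment> \<open>The section sends a basis element to the pair of elements of \<open>A\<close>
    and \<open>B\<close> having its two entries as coordinates.\<close>
  define \<tau> where "\<tau> = (\<lambda>(s, t). Poly_Mapping.single
    (?\<alpha>' (Poly_Mapping.single s 1), ?\<beta>' (Poly_Mapping.single t 1)) (1::'k))"
  define \<pi> where "\<pi> = restrict (lext \<phi>) (carrier F)"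
  have \<phi>_keys: "keys (\<phi> x) \<subseteq> carrier ?ST" if "x \<in> carrier (A \<times>\<times> B)" for x
  proof -
    obtain a b where "x = (a, b)" "a \<in> carrier A" "b \<in> carrier B" using \<open>x \<in> _\<close> by auto
    then show ?thesis using keys_tens[of "\<alpha> a" "carrier S" "\<beta> b" "carrier T"] by (simp add: \<phi>_def)
  qed
  have \<tau>_carrier: "?\<alpha>' (Poly_Mapping.single s k) \<in> carrier A" "\<alpha> (?\<alpha>' (Poly_Mapping.single s k)) = Poly_Mapping.single s k"
    if "s \<in> carrier S" for s k
    using that by (auto intro!: tw_coords_inv[OF A])
  have \<tau>_carrier': "?\<beta>' (Poly_Mapping.single t k) \<in> carrier B" "\<beta> (?\<beta>' (Poly_Mapping.single t k)) = Poly_Mapping.single t k"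
    if "t \<in> carrier T" for t k
    using that by (auto intro!: tw_coords_inv[OF B])
  have hom: "\<pi> \<in> alg_hom F (tw_alg ?ST ?cd)"
    unfolding \<pi>_def F_def
  proof (rule lext_alg_hom[OF mAB mST \<phi>_keys])
    fix x y assume "x \<in> carrier (A \<times>\<times> B)" "y \<in> carrier (A \<times>\<times> B)"
    then show "scl 1 (\<phi> (x \<otimes>\<^bsub>A \<times>\<times> B\<^esub> y)) = tw_mult ?ST ?cd (\<phi> x) (\<phi> y)"
      by (auto simp: \<phi>_def tens_tw_mult)
  qed (simp_all add: \<phi>_def)
  have \<tau>_keys: "keys (lext \<tau> p) \<subseteq> carrier A \<times> carrier B" if "keys p \<subseteq> carrier ?ST" for p
    using that by (intro keys_lext) (auto simp: \<tau>_def \<tau>_carrier \<tau>_carrier')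
  have \<tau>_lext: "lext \<phi> (lext \<tau> p) = p" if "keys p \<subseteq> carrier ?ST" for p
    using that
    by (induction p rule: keys_induct) (auto simp: lext_add \<phi>_def \<tau>_def \<tau>_carrier \<tau>_carrier')
  have surj: "\<pi> ` carrier F = carrier (tw_alg ?ST ?cd)"
  proof
    show "\<pi> ` carrier F \<subseteq> carrier (tw_alg ?ST ?cd)" using alg_homD(1)[OF hom] by blast
    show "carrier (tw_alg ?ST ?cd) \<subseteq> \<pi> ` carrier F"
    proof
      fix p assume "p \<in> carrier (tw_alg ?ST ?cd)"
      then have p: "keys p \<subseteq> carrier ?ST" by simp
      have "p = \<pi> (lext \<tau> p)" using \<tau>_lext[OF p] \<tau>_keys[OF p] by (simp add: \<pi>_def F_def)
      then show "p \<in> \<pi> ` carrier F" using \<tau>_keys[OF p] by (auto simp: F_def)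
    qed
  qed
  let ?rels = "{Poly_Mapping.single (a \<oplus>\<^bsub>A\<^esub> a', b) (1::'k) - Poly_Mapping.single (a, b) 1
         - Poly_Mapping.single (a', b) 1 | a a' b.
         a \<in> carrier A \<and> a' \<in> carrier A \<and> b \<in> carrier B} \<union>
      {Poly_Mapping.single (a, b \<oplus>\<^bsub>B\<^esub> b') 1 - Poly_Mapping.single (a, b) 1
         - Poly_Mapping.single (a, b') 1 | a b b'.
         a \<in> carrier A \<and> b \<in> carrier B \<and> b' \<in> carrier B} \<union>
      {Poly_Mapping.single (k \<odot>\<^bsub>A\<^esub> a, b) 1 - Poly_Mapping.single (a, b) k | k a b.
         a \<in> carrier A \<and> b \<in> carrier B} \<union>
      {Poly_Mapping.single (a, k \<odot>\<^bsub>B\<^esub> b) 1 - Poly_Mapping.single (a, b) k | k a b.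
         a \<in> carrier A \<and> b \<in> carrier B}"
  have W: "W = lin_span F ?rels" by (simp add: W_def tensor_rel_def F)
  have W_zero: "0 \<in> W" and W_add: "u \<in> W \<Longrightarrow> v \<in> W \<Longrightarrow> u + v \<in> W" and W_scl: "u \<in> W \<Longrightarrow> scl k u \<in> W"
    for u v k
    using lin_span_closed[where A = F and X = ?rels] unfolding W by (simp_all add: F_def)
  have rels: "Poly_Mapping.single (a \<oplus>\<^bsub>A\<^esub> a', b) 1 - Poly_Mapping.single (a, b) 1
         - Poly_Mapping.single (a', b) 1 \<in> W"
      "Poly_Mapping.single (a, b \<oplus>\<^bsub>B\<^esub> b') 1 - Poly_Mapping.single (a, b) 1
         - Poly_Mapping.single (a, b') 1 \<in> W"
      "Poly_Mapping.single (k \<odot>\<^bsub>A\<^esub> a, b) 1 - Poly_Mapping.single (a, b) k \<in> W"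
      "Poly_Mapping.single (a, k \<odot>\<^bsub>B\<^esub> b) 1 - Poly_Mapping.single (a, b) k \<in> W"
    if "a \<in> carrier A" "a' \<in> carrier A" "b \<in> carrier B" "b' \<in> carrier B" for a a' b b' k
    using that unfolding W by (intro subsetD[OF lin_span_superset], blast)+
  have keys_diff: "keys (p - r) \<subseteq> X" if "keys p \<subseteq> X" "keys r \<subseteq> X" for p r :: "'a \<times> 'b \<Rightarrow>\<^sub>0 'k" and X
    using keys_add_subset[of p X "- r"] that by simp
  have sub: "W \<subseteq> {p. keys p \<subseteq> carrier (A \<times>\<times> B) \<and> \<pi> p = 0}"
    unfolding W
  proof (rule lin_span_minimal)
    have ker: "keys p \<subseteq> carrier A \<times> carrier B \<and> lext \<phi> p = 0" if "p \<in> ?rels" for p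
      using that by (elim UnE CollectE exE conjE)
        (simp_all add: keys_diff lext_diff \<phi>_def tens_add tens_scl)
    show "?rels \<subseteq> {p. keys p \<subseteq> carrier (A \<times>\<times> B) \<and> \<pi> p = 0}"
      by (rule subsetI, drule ker) (simp add: \<pi>_def F_def)
  qed (auto simp: \<pi>_def F_def lext_add lext_scl keys_add_subset keys_scl_in)
  \<comment> \<open>The expansion of a pair modulo \<open>W\<close>, phrased in coordinates so that
    linear induction applies; it is proved for a basis element in the first argument, then in
    general.\<close>
  let ?Q = "\<lambda>p r. Poly_Mapping.single (?\<alpha>' p, ?\<beta>' r) 1 - lext \<tau> (tens p r) \<in> W"
  have zero_A: "?\<alpha>' 0 = \<zero>\<^bsub>A\<^esub>" "k \<odot>\<^bsub>A\<^esub> \<zero>\<^bsub>A\<^esub> = \<zero>\<^bsub>A\<^esub>" for k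
    by (rule tw_coords_inj[OF A]; simp)+
  have zero_B: "?\<beta>' 0 = \<zero>\<^bsub>B\<^esub>" "k \<odot>\<^bsub>B\<^esub> \<zero>\<^bsub>B\<^esub> = \<zero>\<^bsub>B\<^esub>" for k
    by (rule tw_coords_inj[OF B]; simp)+
  have Q_single: "?Q (Poly_Mapping.single s 1) r" if "s \<in> carrier S" "keys r \<subseteq> carrier T" for s r
    using that(2)
  proof (induction r rule: keys_induct)
    case zero
    \<comment> \<open>The homogeneity relation with scalar 0 puts a pair with a zero entry into
      \<open>W\<close>.\<close>
    show ?case
      using rels(4)[of "?\<alpha>' (Poly_Mapping.single s 1)" "\<zero>\<^bsub>A\<^esub>" "\<zero>\<^bsub>B\<^esub>" "\<zero>\<^bsub>B\<^esub>" 0] \<tau>_carrier[OF that(1)]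
      by (simp add: zero_B)
  next
    case (single t k)
    have "?\<beta>' (Poly_Mapping.single t k) = k \<odot>\<^bsub>B\<^esub> ?\<beta>' (Poly_Mapping.single t 1)"
      using single by (intro tw_coords_inj[OF B]) (auto simp: \<tau>_carrier')
    then show ?case
      using rels(4)[of "?\<alpha>' (Poly_Mapping.single s 1)" "\<zero>\<^bsub>A\<^esub>" "?\<beta>' (Poly_Mapping.single t 1)" "\<zero>\<^bsub>B\<^esub>" k]
        \<tau>_carrier[OF that(1)] \<tau>_carrier'[OF single] by (simp add: \<tau>_def)
  next
    case (add r r')
    have "?\<beta>' (r + r') = ?\<beta>' r \<oplus>\<^bsub>B\<^esub> ?\<beta>' r'"
      using add by (intro tw_coords_inj[OF B]) (auto simp: keys_add_subset)
    then have "Poly_Mapping.single (?\<alpha>' (Poly_Mapping.single s 1), ?\<beta>' (r + r')) 1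
        - Poly_Mapping.single (?\<alpha>' (Poly_Mapping.single s 1), ?\<beta>' r) 1
        - Poly_Mapping.single (?\<alpha>' (Poly_Mapping.single s 1), ?\<beta>' r') 1 \<in> W"
      using rels(2)[of "?\<alpha>' (Poly_Mapping.single s 1)" "\<zero>\<^bsub>A\<^esub>" "?\<beta>' r" "?\<beta>' r'"]
        \<tau>_carrier[OF that(1)] add by simp
    from W_add[OF this W_add[OF add(3,4)]] show ?case
      by (simp add: tens_add lext_add algebra_simps)
  qed
  have Q: "?Q p r" if "keys p \<subseteq> carrier S" "keys r \<subseteq> carrier T" for p r
    using that(1)
  proof (induction p rule: keys_induct)
    case zero
    show ?case
      using rels(3)[of "\<zero>\<^bsub>A\<^esub>" "\<zero>\<^bsub>A\<^esub>" "?\<beta>' r" "\<zero>\<^bsub>B\<^esub>" 0] that(2) by (simp add: zero_A)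
  next
    case (single s k)
    have "?\<alpha>' (Poly_Mapping.single s k) = k \<odot>\<^bsub>A\<^esub> ?\<alpha>' (Poly_Mapping.single s 1)"
      using single by (intro tw_coords_inj[OF A]) (auto simp: \<tau>_carrier)
    then have "Poly_Mapping.single (?\<alpha>' (Poly_Mapping.single s k), ?\<beta>' r) 1
        - Poly_Mapping.single (?\<alpha>' (Poly_Mapping.single s 1), ?\<beta>' r) k \<in> W"
      using rels(3)[of "?\<alpha>' (Poly_Mapping.single s 1)" "\<zero>\<^bsub>A\<^esub>" "?\<beta>' r" "\<zero>\<^bsub>B\<^esub>" k]
        \<tau>_carrier[OF single] that(2) by simp
    from W_add[OF this W_scl[OF Q_single[OF single that(2)], of k]] show ?case
      using tens_scl(1)[of k "Poly_Mapping.single s 1" r]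
      by (simp add: scl_diff lext_scl)
  next
    case (add p p')
    have "?\<alpha>' (p + p') = ?\<alpha>' p \<oplus>\<^bsub>A\<^esub> ?\<alpha>' p'"
      using add by (intro tw_coords_inj[OF A]) (auto simp: keys_add_subset)
    then have "Poly_Mapping.single (?\<alpha>' (p + p'), ?\<beta>' r) 1
        - Poly_Mapping.single (?\<alpha>' p, ?\<beta>' r) 1 - Poly_Mapping.single (?\<alpha>' p', ?\<beta>' r) 1 \<in> W"
      using rels(1)[of "?\<alpha>' p" "?\<alpha>' p'" "?\<beta>' r" "\<zero>\<^bsub>B\<^esub>"] that(2) add by simp
    from W_add[OF this W_add[OF add(3,4)]] show ?case
      by (simp add: tens_add lext_add algebra_simps)
  qed
  have "p \<in> W" if p: "keys p \<subseteq> carrier (A \<times>\<times> B)" "\<pi> p = 0" for p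
  proof (rule lext_kernel_subset[where \<phi> = \<phi> and \<tau> = \<tau> and X = "carrier (A \<times>\<times> B)"])
    fix x assume "x \<in> carrier (A \<times>\<times> B)"
    then obtain a b where "x = (a, b)" "a \<in> carrier A" "b \<in> carrier B" by auto
    then show "Poly_Mapping.single x 1 - lext \<tau> (\<phi> x) \<in> W"
      using Q[of "\<alpha> a" "\<beta> b"] by (simp add: \<phi>_def)
  next
    show "lext \<phi> p = 0" using p by (simp add: \<pi>_def F_def)
  qed (use W_zero W_add W_scl p in auto)
  then have W_eq: "W = {p. keys p \<subseteq> carrier (A \<times>\<times> B) \<and> \<pi> p = 0}" using sub by auto
  obtain h where h: "tw_coords ?ST ?cd (quot_alg F W) h"
    "\<And>p. keys p \<subseteq> carrier (A \<times>\<times> B) \<Longrightarrow>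
      W +>\<^bsub>F\<^esub> p \<in> carrier (quot_alg F W) \<and> h (W +>\<^bsub>F\<^esub> p) = \<pi> p"
    using tw_coords_quot_alg[OF mAB cocycle_one mST cST
        hom[unfolded F_def] surj[unfolded F_def] W_eq] unfolding F_def by blast
  show thesis
  proof
    show "tw_coords ?ST ?cd (tensor_alg A B) h"
      using h(1) by (simp add: tensor_alg_def W_def F)
    fix a b assume "a \<in> carrier A" "b \<in> carrier B"
    then have "W +>\<^bsub>F\<^esub> Poly_Mapping.single (a, b) 1 \<in> carrier (quot_alg F W) \<and>
        h (W +>\<^bsub>F\<^esub> Poly_Mapping.single (a, b) 1) = tens (\<alpha> a) (\<beta> b)"
      using h(2)[of "Poly_Mapping.single (a, b) 1"] by (simp add: \<pi>_def F_def \<phi>_def)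
    then show "pure_tensor A B a b \<in> carrier (tensor_alg A B) \<and>
        h (pure_tensor A B a b) = tens (\<alpha> a) (\<beta> b)"
      by (simp add: pure_tensor_def tensor_alg_def F W_def)
  qed
qed

section \<open>Twists of graded algebras\<close>

lemma single_eq_zero_iff: "Poly_Mapping.single x k = 0 \<longleftrightarrow> k = 0"
  by (metis lookup_single_eq lookup_zero single_zero)

lemma tw_coords_finsum:
  assumes A: "tw_coords S c A \<alpha>" and "finite F" "\<And>i. i \<in> F \<Longrightarrow> g i \<in> carrier A"
  shows "(\<Oplus>\<^bsub>A\<^esub>i\<in>F. g i) \<in> carrier A" "\<alpha> (\<Oplus>\<^bsub>A\<^esub>i\<in>F. g i) = (\<Sum>i\<in>F. \<alpha> (g i))"
proof -
  interpret ring A by (rule ring_tw_coords[OF A])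
  have "(\<Oplus>\<^bsub>A\<^esub>i\<in>F. g i) \<in> carrier A \<and> \<alpha> (\<Oplus>\<^bsub>A\<^esub>i\<in>F. g i) = (\<Sum>i\<in>F. \<alpha> (g i))"
    using assms(2,3)
  proof (induction F)
    case (insert i F)
    then show ?case
      using tw_coords_hom(3)[OF A, of "g i" "\<Oplus>\<^bsub>A\<^esub>i\<in>F. g i"] by (auto simp: finsum_insert)
  qed (use tw_coordsD(7)[OF A] in simp)
  then show "(\<Oplus>\<^bsub>A\<^esub>i\<in>F. g i) \<in> carrier A" "\<alpha> (\<Oplus>\<^bsub>A\<^esub>i\<in>F. g i) = (\<Sum>i\<in>F. \<alpha> (g i))" by auto
qed

text \<open>The homogeneous components are the coordinate lines, so a component is one term of the
  basis expansion. Uniqueness, without which \<open>THE\<close> says nothing, comes from comparing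
  coefficients.\<close>

lemma hcomp_tw_coords:
  assumes A: "tw_coords S c A \<alpha>"
    and gr: "\<And>s. s \<in> carrier S \<Longrightarrow> gr s = {a \<in> carrier A. \<exists>k. \<alpha> a = Poly_Mapping.single s k}"
    and a: "a \<in> carrier A"
  shows "hcomp A S gr a = (\<lambda>s. inv_into (carrier A) \<alpha> (Poly_Mapping.single s (lookup (\<alpha> a) s)))"
    (is "_ = ?c")
proof -
  have keys: "keys (\<alpha> a) \<subseteq> carrier S" by (rule tw_coords_hom(1)[OF A a])
  have k: "keys (Poly_Mapping.single s (lookup (\<alpha> a) s)) \<subseteq> carrier S" for s
    using keys by (auto simp: in_keys_iff)
  have c: "?c s \<in> carrier A" "\<alpha> (?c s) = Poly_Mapping.single s (lookup (\<alpha> a) s)" for s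
    using tw_coords_inv[OF A k] by auto
  have zero_iff: "b = \<zero>\<^bsub>A\<^esub> \<longleftrightarrow> \<alpha> b = 0" if "b \<in> carrier A" for b
    using tw_coords_inj[OF A that tw_coordsD(5)[OF A]] tw_coordsD(7)[OF A] by auto
  have supp: "{s. ?c s \<noteq> \<zero>\<^bsub>A\<^esub>} = keys (\<alpha> a)"
    unfolding zero_iff[OF c(1)] c(2) single_eq_zero_iff by (auto simp: in_keys_iff)
  show ?thesis
    unfolding hcomp_def
  proof (rule the_equality, intro conjI ballI allI impI)
    fix s assume "s \<in> carrier S"
    then show "?c s \<in> gr s" using c gr by auto
  next
    fix s assume "s \<notin> carrier S"
    then have "s \<notin> keys (\<alpha> a)" using keys by auto
    then show "?c s = \<zero>\<^bsub>A\<^esub>" using supp by auto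
  next
    show "finite {s. ?c s \<noteq> \<zero>\<^bsub>A\<^esub>}" unfolding supp by simp
  next
    have "\<alpha> (\<Oplus>\<^bsub>A\<^esub>s\<in>keys (\<alpha> a). ?c s) = (\<Sum>s\<in>keys (\<alpha> a). Poly_Mapping.single s (lookup (\<alpha> a) s))"
      using tw_coords_finsum(2)[OF A, of "keys (\<alpha> a)" ?c] c by simp
    also have "\<dots> = \<alpha> a" using lext_single_id[of "\<alpha> a"] by (simp add: lext_def)
    finally show "a = (\<Oplus>\<^bsub>A\<^esub>s\<in>{s. ?c s \<noteq> \<zero>\<^bsub>A\<^esub>}. ?c s)"
      unfolding supp using c a by (intro tw_coords_inj[OF A] tw_coords_finsum(1)[OF A]) auto
  next
    fix c'
    assume "(\<forall>s\<in>carrier S. c' s \<in> gr s) \<and> (\<forall>s. s \<notin> carrier S \<longrightarrow> c' s = \<zero>\<^bsub>A\<^esub>) \<and>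
      finite {s. c' s \<noteq> \<zero>\<^bsub>A\<^esub>} \<and> a = (\<Oplus>\<^bsub>A\<^esub>s\<in>{s. c' s \<noteq> \<zero>\<^bsub>A\<^esub>}. c' s)"
    then have c': "\<forall>s\<in>carrier S. c' s \<in> gr s" "\<forall>s. s \<notin> carrier S \<longrightarrow> c' s = \<zero>\<^bsub>A\<^esub>"
      "finite {s. c' s \<noteq> \<zero>\<^bsub>A\<^esub>}" and sum: "a = (\<Oplus>\<^bsub>A\<^esub>s\<in>{s. c' s \<noteq> \<zero>\<^bsub>A\<^esub>}. c' s)"
      by blast+
    have carr: "c' s \<in> carrier A" for s
      using c'(1,2) gr tw_coordsD(5)[OF A] by (cases "s \<in> carrier S") auto
    have hom: "\<exists>k. \<alpha> (c' s) = Poly_Mapping.single s k" for s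
    proof (cases "s \<in> carrier S")
      case False
      then show ?thesis using c'(2) tw_coordsD(7)[OF A] by (intro exI[of _ 0]) simp
    qed (use c'(1) gr in auto)
    then obtain k where k: "\<alpha> (c' s) = Poly_Mapping.single s (k s)" for s by metis
    \<comment> \<open>The term of degree \<open>s\<close> contributes to the coefficient of
      \<open>s\<close> alone, so the scalars of any decomposition are the coefficients of
      \<open>\<alpha> a\<close>.\<close>
    have "\<alpha> a = (\<Sum>s\<in>{s. c' s \<noteq> \<zero>\<^bsub>A\<^esub>}. Poly_Mapping.single s (k s))"
      using tw_coords_finsum(2)[OF A c'(3), of c'] carr unfolding sum[symmetric] k by simp
    then have "lookup (\<alpha> a) s = (\<Sum>t\<in>{s. c' s \<noteq> \<zero>\<^bsub>A\<^esub>}. if t = s then k t else 0)" for s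
      unfolding lookup_sum by (simp add: lookup_sum lookup_single when_def)
    then have "lookup (\<alpha> a) s = (if c' s = \<zero>\<^bsub>A\<^esub> then 0 else k s)" for s
      using c'(3) by simp
    moreover have "k s = 0" if "c' s = \<zero>\<^bsub>A\<^esub>" for s
      using k[of s] tw_coordsD(7)[OF A] that single_eq_zero_iff[of s "k s"] by simp
    ultimately have "lookup (\<alpha> a) s = k s" for s by auto
    then have "\<alpha> (c' s) = \<alpha> (?c s)" for s using c(2) k by simp
    then show "c' = ?c" using tw_coords_inj[OF A carr c(1)] by blast
  qed
qed

lemma twist_simps [simp]:
  "carrier (twist A S gr \<mu>) = carrier A" "one (twist A S gr \<mu>) = one A"
  "zero (twist A S gr \<mu>) = zero A" "add (twist A S gr \<mu>) = add A" "smult (twist A S gr \<mu>) = smult A"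
  by (simp_all add: twist_def)

text \<open>The coordinate map stays the same and only the cocycle changes: the double sum over
  homogeneous components is \<open>tw_mult\<close> written out in coordinates.\<close>

lemma tw_coords_twist:
  fixes A :: "('k::field, 'a, 'y) module_scheme"
  assumes A: "tw_coords S (\<lambda>_ _. 1) A \<alpha>" and \<mu>: "cocycle S \<mu>"
    and gr: "\<And>s. s \<in> carrier S \<Longrightarrow> gr s = {a \<in> carrier A. \<exists>k. \<alpha> a = Poly_Mapping.single s k}"
  shows "tw_coords S \<mu> (twist A S gr \<mu>) \<alpha>"
proof (rule tw_coordsI)
  show "monoid S" "cocycle S \<mu>" "\<alpha> \<in> extensional (carrier (twist A S gr \<mu>))"
    "bij_betw \<alpha> (carrier (twist A S gr \<mu>)) {p. keys p \<subseteq> carrier S}"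
    using A \<mu> tw_coordsD(3)[OF A] by (auto simp: tw_coords_def alg_iso_def alg_hom_def)
next
  fix a b assume "a \<in> carrier (twist A S gr \<mu>)" "b \<in> carrier (twist A S gr \<mu>)"
  then have a: "a \<in> carrier A" and b: "b \<in> carrier A" by auto
  let ?c = "\<lambda>a s. inv_into (carrier A) \<alpha> (Poly_Mapping.single s (lookup (\<alpha> a) s))"
  have c: "?c a s \<in> carrier A" "\<alpha> (?c a s) = Poly_Mapping.single s (lookup (\<alpha> a) s)"
    if "a \<in> carrier A" for a s
  proof -
    have "keys (Poly_Mapping.single s (lookup (\<alpha> a) s)) \<subseteq> carrier S"
      using tw_coords_hom(1)[OF A that] by (auto simp: in_keys_iff)
    from tw_coords_inv[OF A this]
    show "?c a s \<in> carrier A" "\<alpha> (?c a s) = Poly_Mapping.single s (lookup (\<alpha> a) s)" by auto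
  qed
  have zero_iff: "b = \<zero>\<^bsub>A\<^esub> \<longleftrightarrow> \<alpha> b = 0" if "b \<in> carrier A" for b
    using tw_coords_inj[OF A that tw_coordsD(5)[OF A]] tw_coordsD(7)[OF A] by auto
  have hc: "hcomp A S gr a = ?c a" if "a \<in> carrier A" for a
    by (rule hcomp_tw_coords[OF A _ that]) (rule gr)
  have supp: "hsupp A S gr a = keys (\<alpha> a)" if "a \<in> carrier A" for a
    unfolding hsupp_def hc[OF that] zero_iff[OF c(1)[OF that]]
      c(2)[OF that] single_eq_zero_iff by (auto simp: in_keys_iff)
  let ?t = "\<lambda>s t. \<mu> s t \<odot>\<^bsub>A\<^esub> (?c a s \<otimes>\<^bsub>A\<^esub> ?c b t)"
  have t: "?t s t \<in> carrier A"
    "\<alpha> (?t s t) = Poly_Mapping.single (s \<otimes>\<^bsub>S\<^esub> t) (lookup (\<alpha> a) s * (lookup (\<alpha> b) t * \<mu> s t))" for s t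
    using c[OF a] c[OF b] by (simp_all add: tw_coordsD[OF A] tw_coords_hom[OF A] mult_ac)
  have prod: "a \<otimes>\<^bsub>twist A S gr \<mu>\<^esub> b = (\<Oplus>\<^bsub>A\<^esub>s\<in>keys (\<alpha> a). \<Oplus>\<^bsub>A\<^esub>t\<in>keys (\<alpha> b). ?t s t)"
    by (simp add: twist_def supp hc a b)
  note inner = tw_coords_finsum[OF A finite_keys[of "\<alpha> b"], of "?t s" for s, OF t(1)]
  note outer = tw_coords_finsum[OF A finite_keys[of "\<alpha> a"], of "\<lambda>s. \<Oplus>\<^bsub>A\<^esub>t\<in>keys (\<alpha> b). ?t s t", OF inner(1)]
  have "tw_mult S \<mu> (\<alpha> a) (\<alpha> b) = (\<Sum>s\<in>keys (\<alpha> a). \<Sum>t\<in>keys (\<alpha> b). \<alpha> (?t s t))"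
    by (simp add: tw_mult_def lext_def scl_sum t(2))
  then show "a \<otimes>\<^bsub>twist A S gr \<mu>\<^esub> b \<in> carrier (twist A S gr \<mu>) \<and>
      \<alpha> (a \<otimes>\<^bsub>twist A S gr \<mu>\<^esub> b) = tw_mult S \<mu> (\<alpha> a) (\<alpha> b)"
    unfolding prod outer(2) inner(2) using outer(1) by simp
qed (simp_all add: tw_coordsD[OF A] tw_coords_hom[OF A])

section \<open>Cocycles on free commutative monoids\<close>

text \<open>By the cocycle identity, prefixing \<open>x\<close> and \<open>y\<close> to a word costs
  \<open>c (unit_vec x) (unit_vec y)\<close> times a factor symmetric in the two letters, so
  adjacent letters can be exchanged when \<open>c\<close> is symmetric on generators.\<close>

lemma wcoef_insort:
  assumes c: "cocycle (nat_vec I) c"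
    and sym: "\<And>i j. i \<in> I \<Longrightarrow> j \<in> I \<Longrightarrow> c (unit_vec i) (unit_vec j) = c (unit_vec j) (unit_vec i)"
    and x: "x \<in> I" and "w \<in> lists I"
  shows "wcoef c (insort x w) = wcoef c (x # w)"
  using assms(4)
proof (induction w)
  case (Cons y w)
  let ?x = "unit_vec x" and ?y = "unit_vec y" and ?w = "exps w"
  have I: "y \<in> I" "keys ?w \<subseteq> I" using Cons keys_exps[of w I] by auto
  have "c ?x (?y + ?w) * c ?y ?w = c ?x ?y * c (?x + ?y) ?w"
    "c ?y (?x + ?w) * c ?x ?w = c ?y ?x * c (?y + ?x) ?w"
    using I x by (intro cocycle_nat_vec(2)[OF c]; simp)+
  then have "c ?x (?y + ?w) * c ?y ?w = c ?y (?x + ?w) * c ?x ?w"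
    using sym[OF x I(1)] by (simp add: add.commute)
  then have "c ?x (?y + ?w) * c ?y ?w * wcoef c w = c ?y (?x + ?w) * c ?x ?w * wcoef c w" by simp
  then show ?case using Cons by (auto simp: mult.assoc)
qed simp

lemma wcoef_sort:
  assumes c: "cocycle (nat_vec I) c"
    and sym: "\<And>i j. i \<in> I \<Longrightarrow> j \<in> I \<Longrightarrow> c (unit_vec i) (unit_vec j) = c (unit_vec j) (unit_vec i)"
    and "w \<in> lists I"
  shows "wcoef c (sort w) = wcoef c w"
  using assms(3)
proof (induction w)
  case (Cons x w)
  then have "sort w \<in> lists I" by auto
  then show ?case using Cons wcoef_insort[OF c sym, of x "sort w"] by simp
qed simp

text \<open>The twisted monomials commute, so rescaling each of them to the ordered product of its
  variables trivializes the cocycle.\<close>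

lemma symmetric_cocycle_coboundary:
  fixes c :: "('i::linorder \<Rightarrow>\<^sub>0 nat) \<Rightarrow> ('i \<Rightarrow>\<^sub>0 nat) \<Rightarrow> 'k::field"
  assumes c: "cocycle (nat_vec I) c"
    and sym: "\<And>i j. i \<in> I \<Longrightarrow> j \<in> I \<Longrightarrow> c (unit_vec i) (unit_vec j) = c (unit_vec j) (unit_vec i)"
  obtains h where "\<And>x. keys x \<subseteq> I \<Longrightarrow> h x \<noteq> 0" "h 0 = 1"
    "\<And>x y. keys x \<subseteq> I \<Longrightarrow> keys y \<subseteq> I \<Longrightarrow> c x y = h x * h y / h (x + y)"
proof
  let ?a = "\<lambda>x. wcoef c (sorted_word x)"
  note nz = wcoef_nonzero[OF c sorted_word_in_lists]
  \<comment> \<open>The trivializing function is the inverse of the coefficient, because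
    \<open>?a (x + y) = ?a x * ?a y * c x y\<close>.\<close>
  show "1 / ?a x \<noteq> 0" if "keys x \<subseteq> I" for x using nz[OF that] by simp
  have "sorted_word (0 :: 'i \<Rightarrow>\<^sub>0 nat) = []" using sorted_word_exps[of "[]"] by simp
  then show "1 / ?a 0 = 1" by simp
  fix x y :: "'i \<Rightarrow>\<^sub>0 nat" assume xy: "keys x \<subseteq> I" "keys y \<subseteq> I"
  let ?w = "sorted_word x @ sorted_word y"
  have "sorted_word (x + y) = sort ?w"
    using sorted_word_exps[of ?w] by (simp add: sorted_word)
  then have "?a (x + y) = wcoef c ?w"
    using wcoef_sort[OF c sym, of ?w] xy by (simp add: sorted_word_in_lists del: in_lists_conv_set)
  also have "\<dots> = ?a x * ?a y * c x y"
    using xy by (subst wcoef_append[OF c]) (simp_all add: sorted_word sorted_word_in_lists del: in_lists_conv_set)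
  finally show "c x y = 1 / ?a x * (1 / ?a y) / (1 / ?a (x + y))"
    using nz[OF xy(1)] nz[OF xy(2)] by simp
qed

text \<open>The bimultiplicative function with values \<open>u\<close> on pairs of generators. With
  \<open>u i j\<close> equal to \<open>q i j\<close> for \<open>i < j\<close> and 1 otherwise it is
  the standard cocycle of the matrix \<open>q\<close>.\<close>

definition bichar :: "'i set \<Rightarrow> ('i \<Rightarrow> 'i \<Rightarrow> 'k::field) \<Rightarrow> ('i \<Rightarrow>\<^sub>0 nat) \<Rightarrow> ('i \<Rightarrow>\<^sub>0 nat) \<Rightarrow> 'k" where
  "bichar I u s t = (\<Prod>i\<in>I. \<Prod>j\<in>I. u i j ^ (lookup s i * lookup t j))"

lemma bichar_add:
  "bichar I u (s + s') t = bichar I u s t * bichar I u s' t"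
  "bichar I u s (t + t') = bichar I u s t * bichar I u s t'"
  by (simp_all add: bichar_def lookup_add algebra_simps power_add prod.distrib)

lemma bichar_unit_vec:
  assumes "finite I" "i \<in> I" "j \<in> I"
  shows "bichar I u (unit_vec i) (unit_vec j) = u i j"
proof -
  have "bichar I u (unit_vec i) (unit_vec j) =
      (\<Prod>i'\<in>I. if i' = i then (\<Prod>j'\<in>I. if j' = j then u i j else 1) else 1)"
    unfolding bichar_def unit_vec_def lookup_single when_def
    by (intro prod.cong refl) (auto intro!: prod.cong)
  then show ?thesis using assms by simp
qed

lemma bichar_cocycle:
  assumes "finite I" "\<And>i j. i \<in> I \<Longrightarrow> j \<in> I \<Longrightarrow> u i j \<noteq> 0"
  shows "cocycle (nat_vec I) (bichar I u)" "bimultiplicative (nat_vec I) (bichar I u)"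
proof -
  have "bichar I u x 0 = 1" "bichar I u 0 x = 1" for x
    by (simp_all add: bichar_def)
  then show "cocycle (nat_vec I) (bichar I u)"
    using assms by (auto simp: cocycle_def bichar_add) (simp add: bichar_def)
  show "bimultiplicative (nat_vec I) (bichar I u)"
    by (auto simp: bimultiplicative_def bichar_add)
qed

lemma cocycle_divide:
  assumes "cocycle S c" "cocycle S d"
  shows "cocycle S (\<lambda>x y. c x y / d x y)"
  using assms unfolding cocycle_def by (simp add: divide_simps)

text \<open>Coboundaries on a commutative monoid are symmetric, so the commutation ratio on
  generators is an invariant of the cohomology class; for the standard cocycle it is
  \<open>q i j\<close> by antisymmetry.\<close>

lemma correspondsD:
  assumes "corresponds I c q" "i \<in> I" "j \<in> I"
  shows "c (unit_vec i) (unit_vec j) = q i j * c (unit_vec j) (unit_vec i)"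
proof -
  obtain \<beta> where q: "mult_antisym I q"
    and \<beta>: "\<And>i j. i \<in> I \<Longrightarrow> j \<in> I \<Longrightarrow> \<beta> (unit_vec i) (unit_vec j) = (if i < j then q i j else 1)"
    and "cohomologous (nat_vec I) c \<beta>"
    using assms(1) unfolding corresponds_def by blast
  then obtain h where
    h: "\<And>x y. keys x \<subseteq> I \<Longrightarrow> keys y \<subseteq> I \<Longrightarrow> c x y / \<beta> x y = h x * h y / h (x + y)"
    unfolding cohomologous_def by auto
  have sym: "c (unit_vec i) (unit_vec j) / \<beta> (unit_vec i) (unit_vec j) =
      c (unit_vec j) (unit_vec i) / \<beta> (unit_vec j) (unit_vec i)"
    using assms h[of "unit_vec i" "unit_vec j"] h[of "unit_vec j" "unit_vec i"]
    by (simp add: mult.commute add.commute)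
  have q': "q i j * q j i = 1" "q i j \<noteq> 0" "q j i \<noteq> 0" "i = j \<Longrightarrow> q i j = 1"
    using q assms by (auto simp: mult_antisym_def)
  consider "i < j" | "i = j" | "j < i" by fastforce
  then show ?thesis
  proof cases
    \<comment> \<open>Here the standard cocycle contributes \<open>q j i\<close> on the other side,
      and antisymmetry inverts it.\<close>
    case 3
    then have "\<not> i < j" by (simp add: order_less_not_sym)
    with 3 have "c (unit_vec i) (unit_vec j) = c (unit_vec j) (unit_vec i) / q j i"
      using sym assms \<beta> by simp
    moreover have "1 / q j i = q i j" using q' by (simp add: field_simps)
    ultimately show ?thesis by (metis mult.commute mult_1 times_divide_eq_left)
  qed (use sym assms \<beta> q' in \<open>auto simp: field_simps split: if_splits\<close>)
qed

text \<open>The quotient of \<open>c\<close> by the standard cocycle of \<open>q\<close> is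
  symmetric on generators, hence a coboundary.\<close>

lemma correspondsI:
  fixes c :: "('i::linorder \<Rightarrow>\<^sub>0 nat) \<Rightarrow> ('i \<Rightarrow>\<^sub>0 nat) \<Rightarrow> 'k::field"
  assumes "finite I" and c: "cocycle (nat_vec I) c" and q: "mult_antisym I q"
    and cq: "\<And>i j. i \<in> I \<Longrightarrow> j \<in> I \<Longrightarrow> i < j \<Longrightarrow>
      c (unit_vec i) (unit_vec j) = q i j * c (unit_vec j) (unit_vec i)"
  shows "corresponds I c q"
proof -
  define \<beta> where "\<beta> = bichar I (\<lambda>i j. if i < j then q i j else 1)"
  have \<beta>: "cocycle (nat_vec I) \<beta>" "bimultiplicative (nat_vec I) \<beta>"
    unfolding \<beta>_def using q by (intro bichar_cocycle assms(1); auto simp: mult_antisym_def)+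
  have \<beta>_unit: "\<beta> (unit_vec i) (unit_vec j) = (if i < j then q i j else 1)" if "i \<in> I" "j \<in> I" for i j
    unfolding \<beta>_def by (rule bichar_unit_vec[OF assms(1) that])
  have q0: "q i j \<noteq> 0" if "i \<in> I" "j \<in> I" for i j using q that by (auto simp: mult_antisym_def)
  have sym: "c (unit_vec i) (unit_vec j) / \<beta> (unit_vec i) (unit_vec j) =
      c (unit_vec j) (unit_vec i) / \<beta> (unit_vec j) (unit_vec i)" if "i \<in> I" "j \<in> I" for i j
    using cq[OF that] cq[OF that(2,1)] q0[OF that] q0[OF that(2,1)]
    by (cases i j rule: linorder_cases) (auto simp: \<beta>_unit that dest: less_asym)
  obtain h where "\<And>x. keys x \<subseteq> I \<Longrightarrow> h x \<noteq> 0" "h 0 = 1"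
    "\<And>x y. keys x \<subseteq> I \<Longrightarrow> keys y \<subseteq> I \<Longrightarrow> c x y / \<beta> x y = h x * h y / h (x + y)"
    using symmetric_cocycle_coboundary[OF cocycle_divide[OF c \<beta>(1)] sym] by blast
  then have "cohomologous (nat_vec I) c \<beta>"
    unfolding cohomologous_def by auto
  then show ?thesis
    unfolding corresponds_def using c q \<beta> \<beta>_unit by blast
qed

section \<open>Pullbacks\<close>

lemma monoid_morD:
  assumes "f \<in> monoid_mor S T"
  shows "s \<in> carrier S \<Longrightarrow> f s \<in> carrier T" "f \<one>\<^bsub>S\<^esub> = \<one>\<^bsub>T\<^esub>"
    "s \<in> carrier S \<Longrightarrow> t \<in> carrier S \<Longrightarrow> f (s \<otimes>\<^bsub>S\<^esub> t) = f s \<otimes>\<^bsub>T\<^esub> f t"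
  using assms by (auto simp: monoid_mor_def hom_def)

lemma cocycle_pullback:
  assumes "monoid S" "f \<in> monoid_mor S T" "cocycle T \<mu>"
  shows "cocycle S (pullback_cocycle f \<mu>)"
  using assms(3) monoid_morD[OF assms(2)] by (simp add: cocycle_def pullback_cocycle_def)

text \<open>The pullback is exactly the cocycle on \<open>S\<close> for which the linear extension
  of \<open>f\<close> is multiplicative into the twist by \<open>\<mu>\<close>.\<close>

lemma pullback_alg_hom:
  assumes "monoid S" "monoid T" and f: "f \<in> monoid_mor S T"
  shows "restrict (lext (\<lambda>s. Poly_Mapping.single (f s) 1)) (carrier (tw_alg S (pullback_cocycle f \<mu>)))
    \<in> alg_hom (tw_alg S (pullback_cocycle f \<mu>)) (tw_alg T \<mu>)"
  using assms by (intro lext_alg_hom) (auto simp: monoid_morD[OF f] pullback_cocycle_def)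

section \<open>Segre maps\<close>

lemma poly_alg_tw_alg: "poly_alg I = tw_alg (nat_vec I) (\<lambda>_ _. 1)"
  by (simp add: poly_alg_def monoid_alg_tw_alg)

lemma tw_coords_poly_alg:
  "tw_coords (nat_vec I) (\<lambda>_ _. 1) (poly_alg I :: ('k::field, _) module)
     (restrict id (carrier (poly_alg I)))"
  unfolding poly_alg_tw_alg by (intro tw_coords_tw_alg monoid_nat_vec cocycle_one)

lemma tw_coords_poly_twist:
  assumes "cocycle (nat_vec I) \<mu>"
  shows "tw_coords (nat_vec I) \<mu> (poly_twist I \<mu>) (restrict id (carrier (poly_alg I)))"
  unfolding poly_twist_def using assms
  by (intro tw_coords_twist[OF tw_coords_poly_alg]) (auto simp: poly_gr_def poly_alg_tw_alg split: if_splits)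

text \<open>The induction runs over the second entry with the first equal to the unit, then over the
  first entry with the second fixed.\<close>

lemma mon_gen_prod:
  assumes "monoid S" "monoid T" "mon_gen S X" "mon_gen T Y"
  shows "mon_gen (S \<times>\<times> T) ((\<lambda>x. (x, \<one>\<^bsub>T\<^esub>)) ` X \<union> Pair \<one>\<^bsub>S\<^esub> ` Y)"
  unfolding mon_gen_def
proof (intro conjI allI impI)
  interpret S: monoid S by fact
  interpret T: monoid T by fact
  show "(\<lambda>x. (x, \<one>\<^bsub>T\<^esub>)) ` X \<union> Pair \<one>\<^bsub>S\<^esub> ` Y \<subseteq> carrier (S \<times>\<times> T)"
    using assms(3,4) by (auto simp: mon_gen_def)
  fix P assume one: "P \<one>\<^bsub>S \<times>\<times> T\<^esub>"
    and P: "\<forall>x\<in>(\<lambda>x. (x, \<one>\<^bsub>T\<^esub>)) ` X \<union> Pair \<one>\<^bsub>S\<^esub> ` Y. \<forall>s\<in>carrier (S \<times>\<times> T).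
      P s \<longrightarrow> P (x \<otimes>\<^bsub>S \<times>\<times> T\<^esub> s)"
  have "P (\<one>\<^bsub>S\<^esub>, t)" if "t \<in> carrier T" for t
  proof -
    have "P (\<one>\<^bsub>S\<^esub>, y \<otimes>\<^bsub>T\<^esub> t)" if "y \<in> Y" "t \<in> carrier T" "P (\<one>\<^bsub>S\<^esub>, t)" for y t
      using P[rule_format, of "(\<one>\<^bsub>S\<^esub>, y)" "(\<one>\<^bsub>S\<^esub>, t)"] that by simp
    then show ?thesis
      using assms(4)[unfolded mon_gen_def, THEN conjunct2, rule_format, of "\<lambda>t. P (\<one>\<^bsub>S\<^esub>, t)"]
        one that by simp
  qed
  moreover have "P (x \<otimes>\<^bsub>S\<^esub> s, t)" if "x \<in> X" "s \<in> carrier S" "P (s, t)" "t \<in> carrier T" for x s t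
    using P[rule_format, of "(x, \<one>\<^bsub>T\<^esub>)" "(s, t)"] that by simp
  ultimately have "P (s, t)" if "s \<in> carrier S" "t \<in> carrier T" for s t
    using assms(3)[unfolded mon_gen_def, THEN conjunct2, rule_format, of "\<lambda>s. P (s, t)"] that by blast
  then show "\<forall>s\<in>carrier (S \<times>\<times> T). P s" by auto
qed

text \<open>One map \<open>\<theta>\<close> gives coordinates on the untwisted tensor product and on
  all its twists. This common \<open>\<theta>\<close> is what later identifies the quantum and the
  classical Segre map as linear maps.\<close>

lemma tw_coords_poly_tensor:
  fixes I :: "'i set" and J :: "'j set"
  obtains \<theta> :: "_ \<Rightarrow> ('i \<Rightarrow>\<^sub>0 nat) \<times> ('j \<Rightarrow>\<^sub>0 nat) \<Rightarrow>\<^sub>0 'k::field"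
  where "tw_coords (nat_vec I \<times>\<times> nat_vec J) (\<lambda>_ _. 1) (poly_tensor I J) \<theta>"
    and "\<And>\<mu>. cocycle (nat_vec I \<times>\<times> nat_vec J) \<mu> \<Longrightarrow>
      tw_coords (nat_vec I \<times>\<times> nat_vec J) \<mu> (poly_tensor_twist I J \<mu>) \<theta>"
    and "\<And>p r. p \<in> carrier (poly_alg I) \<Longrightarrow> r \<in> carrier (poly_alg J) \<Longrightarrow>
      pure_tensor (poly_alg I) (poly_alg J) p r \<in> carrier (poly_tensor I J) \<and>
      \<theta> (pure_tensor (poly_alg I) (poly_alg J) p r) = tens p r"
proof -
  let ?A = "poly_alg I :: ('k, _) module" and ?B = "poly_alg J :: ('k, _) module"
  let ?S = "nat_vec I \<times>\<times> nat_vec J"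
  obtain \<theta> where \<theta>: "tw_coords ?S (prod_cocycle (\<lambda>_ _. 1) (\<lambda>_ _. 1)) (tensor_alg ?A ?B) \<theta>"
    and pure: "\<And>p r. p \<in> carrier ?A \<Longrightarrow> r \<in> carrier ?B \<Longrightarrow>
      pure_tensor ?A ?B p r \<in> carrier (tensor_alg ?A ?B) \<and> \<theta> (pure_tensor ?A ?B p r) =
        tens (restrict id (carrier ?A) p) (restrict id (carrier ?B) r)"
    using tw_coords_tensor_alg[OF tw_coords_poly_alg tw_coords_poly_alg] by blast
  then have pure: "pure_tensor ?A ?B p r \<in> carrier (tensor_alg ?A ?B) \<and> \<theta> (pure_tensor ?A ?B p r) = tens p r"
    if "p \<in> carrier ?A" "r \<in> carrier ?B" for p r using that by simp
  have \<theta>1: "tw_coords ?S (\<lambda>_ _. 1) (tensor_alg ?A ?B) \<theta>"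
    by (rule tw_coords_cong[OF \<theta> _ cocycle_one]) (auto simp: prod_cocycle_def)
  have gr: "tensor_gr ?A ?B poly_gr poly_gr x =
      {u \<in> carrier (tensor_alg ?A ?B). \<exists>k. \<theta> u = Poly_Mapping.single x k}"
    if xS: "x \<in> carrier ?S" for x
  proof -
    obtain s t where x: "x = (s, t)" "keys s \<subseteq> I" "keys t \<subseteq> J" using xS by auto
    have carr: "Poly_Mapping.single s k \<in> carrier ?A" "Poly_Mapping.single t k \<in> carrier ?B" for k
      using x by (simp_all add: poly_alg_tw_alg)
    let ?X = "{pure_tensor ?A ?B a b | a b. a \<in> poly_gr s \<and> b \<in> poly_gr t}"
    let ?U = "{u \<in> carrier (tensor_alg ?A ?B). \<exists>k. \<theta> u = Poly_Mapping.single x k}"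
    note [simp] = tw_coordsD(5-10)[OF \<theta>1] tw_coords_hom[OF \<theta>1]
    have "lin_span (tensor_alg ?A ?B) ?X \<subseteq> ?U"
    proof (rule lin_span_minimal)
      show "?X \<subseteq> ?U" using pure[OF carr] by (auto simp: poly_gr_def x)
      show "\<zero>\<^bsub>tensor_alg ?A ?B\<^esub> \<in> ?U" by (auto intro: exI[of _ 0])
      show "u \<oplus>\<^bsub>tensor_alg ?A ?B\<^esub> v \<in> ?U" if "u \<in> ?U" "v \<in> ?U" for u v
        using that by (auto simp flip: single_add)
      show "k \<odot>\<^bsub>tensor_alg ?A ?B\<^esub> u \<in> ?U" if "u \<in> ?U" for k u
        using that by auto
    qed auto
    \<comment> \<open>The homogeneous component is one-dimensional, so each of its elements is
      already a pure tensor and no sums are needed.\<close>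
    moreover have "?U \<subseteq> ?X"
    proof
      fix u assume "u \<in> ?U"
      then obtain k where u: "u \<in> carrier (tensor_alg ?A ?B)" "\<theta> u = Poly_Mapping.single x k" by auto
      have "u = pure_tensor ?A ?B (Poly_Mapping.single s k) (Poly_Mapping.single t 1)"
        using pure[OF carr, of k 1] u x by (intro tw_coords_inj[OF \<theta>1]) simp_all
      then show "u \<in> ?X" by (auto simp: poly_gr_def)
    qed
    ultimately show ?thesis
      using lin_span_superset[of ?X "tensor_alg ?A ?B"] by (auto simp: tensor_gr_def x)
  qed
  show thesis
  proof (rule that[OF \<theta>1 _ pure])
    fix \<mu> :: "_ \<Rightarrow> _ \<Rightarrow> 'k" assume "cocycle ?S \<mu>"
    then show "tw_coords ?S \<mu> (poly_tensor_twist I J \<mu>) \<theta>"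
      unfolding poly_tensor_twist_def by (rule tw_coords_twist[OF \<theta>1 _ gr])
  qed
qed

lemma mult_antisym_kronecker:
  assumes "mult_antisym I q" "mult_antisym J q'"
  shows "mult_antisym (I \<times> J) (kronecker q q')"
proof -
  have "q i k * q' j l * (q k i * q' l j) = 1" if "i \<in> I" "k \<in> I" "j \<in> J" "l \<in> J" for i k j l
  proof -
    have "q i k * q' j l * (q k i * q' l j) = (q i k * q k i) * (q' j l * q' l j)"
      by (simp only: mult_ac)
    moreover have "q i k * q k i = 1" "q' j l * q' l j = 1"
      using assms that by (simp_all add: mult_antisym_def)
    ultimately show ?thesis by (simp only: mult_1)
  qed
  then show ?thesis using assms by (auto simp: mult_antisym_def kronecker_def)
qed

lemma tens_one [simp]:
  "tens (Poly_Mapping.single s k) 1 = Poly_Mapping.single (s, 0) k"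
  "tens 1 (Poly_Mapping.single t k) = Poly_Mapping.single (0, t) k"
  by (simp_all flip: single_one del: single_one)

lemma poly_var_carrier: "i \<in> I \<Longrightarrow> poly_var i \<in> carrier (poly_alg I)"
  by (simp add: poly_alg_tw_alg poly_var_def)

lemma alg_hom_eq_on_qspace:
  assumes h: "tw_coords (nat_vec I) c (qspace I q) h"
    and gen: "\<And>i. i \<in> I \<Longrightarrow> qspace_gen I q i \<in> carrier (qspace I q) \<and> h (qspace_gen I q i) = poly_var i"
    and "\<phi> \<in> alg_hom (qspace I q) B" "\<phi>' \<in> alg_hom (qspace I q) B"
    and eq: "\<And>i. i \<in> I \<Longrightarrow> \<phi> (qspace_gen I q i) = \<phi>' (qspace_gen I q i)"
  shows "\<phi> = \<phi>'"
proof (rule alg_hom_eqI[OF h mon_gen_nat_vec assms(3,4)])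
  fix a x assume "a \<in> carrier (qspace I q)" "x \<in> unit_vec ` I" "h a = Poly_Mapping.single x 1"
  then obtain i where "i \<in> I" "h a = poly_var i" by (auto simp: poly_var_def)
  then have "a = qspace_gen I q i" using gen \<open>a \<in> _\<close> by (intro tw_coords_inj[OF h]) auto
  then show "\<phi> a = \<phi>' a" using eq \<open>i \<in> I\<close> by simp
qed

lemma alg_hom_compose:
  assumes A: "tw_coords S c A \<alpha>" and h: "h \<in> alg_hom A B" and g: "g \<in> alg_hom B C"
  shows "restrict (\<lambda>a. g (h a)) (carrier A) \<in> alg_hom A C"
  using tw_coordsD[OF A] alg_homD[OF h] alg_homD[OF g]
  by (intro alg_homI) simp_all

text \<open>The two Segre maps have different sources and targets, so their coincidence is a
  commuting square through the identifications. Unique existence of all four maps makes them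
  well-defined and keeps the square from being vacuous.\<close>

theorem proposition4p5:
  fixes n m :: nat
    and \<mu> :: "(nat \<Rightarrow>\<^sub>0 nat) \<times> (nat \<Rightarrow>\<^sub>0 nat) \<Rightarrow> (nat \<Rightarrow>\<^sub>0 nat) \<times> (nat \<Rightarrow>\<^sub>0 nat) \<Rightarrow> 'k::field"
    and \<nu> \<xi> :: "(nat \<Rightarrow>\<^sub>0 nat) \<Rightarrow> (nat \<Rightarrow>\<^sub>0 nat) \<Rightarrow> 'k"
    and q q' :: "nat \<Rightarrow> nat \<Rightarrow> 'k"
    and f :: "(nat \<times> nat \<Rightarrow>\<^sub>0 nat) \<Rightarrow> (nat \<Rightarrow>\<^sub>0 nat) \<times> (nat \<Rightarrow>\<^sub>0 nat)"
  defines "I \<equiv> {0..n}" and "J \<equiv> {0..m}"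
  assumes "n \<ge> 1" and "m \<ge> 1"
    and "f \<in> monoid_mor (nat_vec (I \<times> J)) (nat_vec I \<times>\<times> nat_vec J)"
    and "\<forall>i\<in>I. \<forall>j\<in>J. f (unit_vec (i, j)) = (unit_vec i, unit_vec j)"
    and "cocycle (nat_vec I \<times>\<times> nat_vec J) \<mu>"
    and "cocycle (nat_vec I) \<nu>" and "cocycle (nat_vec J) \<xi>"
    and "\<forall>s\<in>carrier (nat_vec I \<times>\<times> nat_vec J). \<forall>t\<in>carrier (nat_vec I \<times>\<times> nat_vec J).
           \<mu> s t = prod_cocycle \<nu> \<xi> s t"
    and "corresponds I \<nu> q" and "corresponds J \<xi> q'"
  shows "corresponds (I \<times> J) (pullback_cocycle f \<mu>) (kronecker q q') \<and>
    (\<exists>!\<Psi>. is_tensor_ident I J q q' \<mu> \<Psi>) \<and>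
    (\<exists>!\<Phi>. is_poly_ident (I \<times> J) (kronecker q q') (pullback_cocycle f \<mu>) \<Phi>) \<and>
    (\<exists>!\<sigma>. is_quantum_segre I J f \<mu> \<sigma>) \<and>
    (\<exists>!\<phi>. is_nc_segre I J q q' \<phi>) \<and>
    (\<forall>\<sigma>. is_quantum_segre I J f \<mu> \<sigma> \<longrightarrow> is_classical_segre I J \<sigma>) \<and>
    (\<forall>\<Psi> \<Phi> \<sigma> \<phi>. is_tensor_ident I J q q' \<mu> \<Psi> \<longrightarrow>
       is_poly_ident (I \<times> J) (kronecker q q') (pullback_cocycle f \<mu>) \<Phi> \<longrightarrow>
       is_quantum_segre I J f \<mu> \<sigma> \<longrightarrow> is_nc_segre I J q q' \<phi> \<longrightarrow>
       (\<forall>a\<in>carrier (qspace (I \<times> J) (kronecker q q')). \<sigma> (\<Phi> a) = \<Psi> (\<phi> a)))"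
proof -
  note f = \<open>f \<in> monoid_mor _ _\<close> and \<mu> = \<open>cocycle (nat_vec I \<times>\<times> nat_vec J) \<mu>\<close>
    and \<nu> = \<open>cocycle (nat_vec I) \<nu>\<close> and \<xi> = \<open>cocycle (nat_vec J) \<xi>\<close>
    and q = \<open>corresponds I \<nu> q\<close> and q' = \<open>corresponds J \<xi> q'\<close>
  have f_unit: "f (unit_vec (i, j)) = (unit_vec i, unit_vec j)" if "i \<in> I" "j \<in> J" for i j
    using \<open>\<forall>i\<in>I. \<forall>j\<in>J. f (unit_vec (i, j)) = _\<close> that by blast
  have \<mu>_eq: "\<mu> s t = prod_cocycle \<nu> \<xi> s t"
    if "s \<in> carrier (nat_vec I \<times>\<times> nat_vec J)" "t \<in> carrier (nat_vec I \<times>\<times> nat_vec J)" for s t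
    using \<open>\<forall>s\<in>carrier (nat_vec I \<times>\<times> nat_vec J). \<forall>t\<in>carrier (nat_vec I \<times>\<times> nat_vec J). _\<close> that
    by blast
  have \<mu>_prod: "\<mu> (s, t) (s', t') = \<nu> s s' * \<xi> t t'"
    if "keys s \<subseteq> I" "keys t \<subseteq> J" "keys s' \<subseteq> I" "keys t' \<subseteq> J" for s t s' t'
    using \<mu>_eq[of "(s, t)" "(s', t')"] that by (simp add: prod_cocycle_def)
  let ?g = "kronecker q q'" and ?K = "I \<times> J" and ?\<mu>f = "pullback_cocycle f \<mu>"
  let ?S = "nat_vec I \<times>\<times> nat_vec J"
  let ?Q = "qspace I q" and ?Q' = "qspace J q'" and ?G = "qspace ?K ?g"
  let ?T = "tensor_alg ?Q ?Q'" and ?P = "poly_tensor_twist I J \<mu>"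
  note mK = monoid_nat_vec[of ?K] and mS = DirProd_monoid[OF monoid_nat_vec[of I] monoid_nat_vec[of J]]

  \<comment> \<open>The matrix of the pullback cocycle\<close>
  have \<mu>f: "cocycle (nat_vec ?K) ?\<mu>f" by (rule cocycle_pullback[OF mK f \<mu>])
  have \<mu>f_unit: "?\<mu>f (unit_vec x) (unit_vec y) = ?g x y * ?\<mu>f (unit_vec y) (unit_vec x)"
    if "x \<in> ?K" "y \<in> ?K" for x y
  proof -
    obtain i j k l where xy: "x = (i, j)" "i \<in> I" "j \<in> J" "y = (k, l)" "k \<in> I" "l \<in> J"
      using \<open>x \<in> ?K\<close> \<open>y \<in> ?K\<close> by auto
    have "\<nu> (unit_vec i) (unit_vec k) * \<xi> (unit_vec j) (unit_vec l) =
        (q i k * \<nu> (unit_vec k) (unit_vec i)) * (q' j l * \<xi> (unit_vec l) (unit_vec j))"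
      unfolding correspondsD[OF q xy(2,5), symmetric] correspondsD[OF q' xy(3,6), symmetric] ..
    also have "\<dots> = q i k * q' j l * (\<nu> (unit_vec k) (unit_vec i) * \<xi> (unit_vec l) (unit_vec j))"
      by (simp only: mult_ac)
    finally show ?thesis
      using xy by (simp add: pullback_cocycle_def f_unit \<mu>_prod kronecker_def)
  qed
  have corr: "corresponds ?K ?\<mu>f ?g"
  proof (rule correspondsI[OF _ \<mu>f])
    show "finite ?K" by (simp add: I_def J_def)
    show "mult_antisym ?K ?g"
      using q q' by (intro mult_antisym_kronecker) (simp_all add: corresponds_def)
  qed (rule \<mu>f_unit)

  \<comment> \<open>Coordinates of all algebras and of their generators\<close>
  obtain \<alpha> where \<alpha>: "tw_coords (nat_vec I) \<nu> ?Q \<alpha>"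
    and \<alpha>_gen: "\<And>i. i \<in> I \<Longrightarrow> qspace_gen I q i \<in> carrier ?Q \<and> \<alpha> (qspace_gen I q i) = poly_var i"
    using tw_coords_qspace[OF \<nu> correspondsD[OF q]] by blast
  obtain \<beta> where \<beta>: "tw_coords (nat_vec J) \<xi> ?Q' \<beta>"
    and \<beta>_gen: "\<And>j. j \<in> J \<Longrightarrow> qspace_gen J q' j \<in> carrier ?Q' \<and> \<beta> (qspace_gen J q' j) = poly_var j"
    using tw_coords_qspace[OF \<xi> correspondsD[OF q']] by blast
  obtain \<gamma> where \<gamma>: "tw_coords (nat_vec ?K) ?\<mu>f ?G \<gamma>"
    and \<gamma>_gen: "\<And>x. x \<in> ?K \<Longrightarrow> qspace_gen ?K ?g x \<in> carrier ?G \<and> \<gamma> (qspace_gen ?K ?g x) = poly_var x"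
    using tw_coords_qspace[OF \<mu>f \<mu>f_unit] by blast
  obtain \<eta> where "tw_coords ?S (prod_cocycle \<nu> \<xi>) ?T \<eta>"
    and \<eta>_pure: "\<And>a b. a \<in> carrier ?Q \<Longrightarrow> b \<in> carrier ?Q' \<Longrightarrow>
      pure_tensor ?Q ?Q' a b \<in> carrier ?T \<and> \<eta> (pure_tensor ?Q ?Q' a b) = tens (\<alpha> a) (\<beta> b)"
    using tw_coords_tensor_alg[OF \<alpha> \<beta>] by blast
  then have \<eta>: "tw_coords ?S \<mu> ?T \<eta>"
    using \<mu>_eq by (intro tw_coords_cong[OF _ _ \<mu>]) auto
  obtain \<theta> where \<theta>1: "tw_coords ?S (\<lambda>_ _. 1) (poly_tensor I J) \<theta>"
    and \<theta>: "tw_coords ?S \<mu> ?P \<theta>"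
    and \<theta>_pure: "\<And>p r. p \<in> carrier (poly_alg I) \<Longrightarrow> r \<in> carrier (poly_alg J) \<Longrightarrow>
      pure_tensor (poly_alg I) (poly_alg J) p r \<in> carrier (poly_tensor I J) \<and>
      \<theta> (pure_tensor (poly_alg I) (poly_alg J) p r) = tens p r"
    using tw_coords_poly_tensor[where 'k = 'k] \<mu> by metis
  have P_carrier: "carrier ?P = carrier (poly_tensor I J)" by (simp add: poly_tensor_twist_def)
  let ?\<iota> = "restrict id (carrier (poly_alg ?K))"
  have \<iota>: "tw_coords (nat_vec ?K) ?\<mu>f (poly_twist ?K ?\<mu>f) ?\<iota>"
    by (rule tw_coords_poly_twist[OF \<mu>f])
  have tw_carrier: "carrier (poly_twist ?K ?\<mu>f) = carrier (poly_alg ?K)" by (simp add: poly_twist_def)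

  let ?X = "\<lambda>i. pure_tensor ?Q ?Q' (qspace_gen I q i) \<one>\<^bsub>?Q'\<^esub>"
  let ?Y = "\<lambda>j. pure_tensor ?Q ?Q' \<one>\<^bsub>?Q\<^esub> (qspace_gen J q' j)"
  let ?x = "\<lambda>i. pure_tensor (poly_alg I) (poly_alg J) (poly_var i) \<one>\<^bsub>poly_alg J\<^esub>"
  let ?y = "\<lambda>j. pure_tensor (poly_alg I) (poly_alg J) \<one>\<^bsub>poly_alg I\<^esub> (poly_var j)"
  let ?xy = "\<lambda>i j. pure_tensor (poly_alg I) (poly_alg J) (poly_var i) (poly_var j)"
  let ?XY = "\<lambda>i j. pure_tensor ?Q ?Q' (qspace_gen I q i) (qspace_gen J q' j)"
  have one: "\<one>\<^bsub>poly_alg A\<^esub> = Poly_Mapping.single 0 1" "\<one>\<^bsub>poly_alg A\<^esub> \<in> carrier (poly_alg A)"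
    for A :: "nat set" by (simp_all add: poly_alg_tw_alg)
  have X: "?X i \<in> carrier ?T" "\<eta> (?X i) = Poly_Mapping.single (unit_vec i, 0) 1" if "i \<in> I" for i
    using \<eta>_pure[of "qspace_gen I q i" "\<one>\<^bsub>?Q'\<^esub>"] \<alpha>_gen[OF that] tw_coordsD(6)[OF \<beta>]
      tw_coords_hom(4)[OF \<beta>] by (auto simp: poly_var_def)
  have Y: "?Y j \<in> carrier ?T" "\<eta> (?Y j) = Poly_Mapping.single (0, unit_vec j) 1" if "j \<in> J" for j
    using \<eta>_pure[of "\<one>\<^bsub>?Q\<^esub>" "qspace_gen J q' j"] \<beta>_gen[OF that] tw_coordsD(6)[OF \<alpha>]
      tw_coords_hom(4)[OF \<alpha>] by (auto simp: poly_var_def)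
  have XY: "?XY i j \<in> carrier ?T" "\<eta> (?XY i j) = Poly_Mapping.single (unit_vec i, unit_vec j) 1"
    if "i \<in> I" "j \<in> J" for i j
    using \<eta>_pure[of "qspace_gen I q i" "qspace_gen J q' j"] \<alpha>_gen[OF that(1)] \<beta>_gen[OF that(2)]
    by (auto simp: poly_var_def)
  have x: "?x i \<in> carrier ?P" "\<theta> (?x i) = Poly_Mapping.single (unit_vec i, 0) 1" if "i \<in> I" for i
    using \<theta>_pure[OF poly_var_carrier[OF that] one(2)] by (auto simp: P_carrier poly_var_def one(1))
  have y: "?y j \<in> carrier ?P" "\<theta> (?y j) = Poly_Mapping.single (0, unit_vec j) 1" if "j \<in> J" for j
    using \<theta>_pure[OF one(2) poly_var_carrier[OF that]] by (auto simp: P_carrier poly_var_def one(1))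
  have xy: "?xy i j \<in> carrier ?P" "\<theta> (?xy i j) = Poly_Mapping.single (unit_vec i, unit_vec j) 1"
    if "i \<in> I" "j \<in> J" for i j
    using \<theta>_pure[OF poly_var_carrier[OF that(1)] poly_var_carrier[OF that(2)]]
    by (auto simp: P_carrier poly_var_def)

  \<comment> \<open>Identification of the tensor product of quantum spaces with the twist\<close>
  note genS = mon_gen_prod[OF monoid_nat_vec monoid_nat_vec mon_gen_nat_vec[of I] mon_gen_nat_vec[of J]]
  have \<Psi>_ex: "\<exists>\<Psi>. is_tensor_ident I J q q' \<mu> \<Psi> \<and> (\<forall>a\<in>carrier ?T. \<theta> (\<Psi> a) = \<eta> a)"
  proof -
    obtain \<Psi> where \<Psi>: "\<Psi> \<in> alg_iso ?T ?P" "\<And>a. a \<in> carrier ?T \<Longrightarrow> \<theta> (\<Psi> a) = \<eta> a"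
      using tw_coords_lift_iso[OF \<eta> \<theta>] by blast
    have carr: "\<Psi> a \<in> carrier ?P" if "a \<in> carrier ?T" for a
      using \<Psi>(1) that alg_homD(1)[of \<Psi> ?T ?P a] by (simp add: alg_iso_def)
    have "\<Psi> (?X i) = ?x i" if "i \<in> I" for i
      using X[OF that] x[OF that] \<Psi>(2) carr by (intro tw_coords_inj[OF \<theta>]) auto
    moreover have "\<Psi> (?Y j) = ?y j" if "j \<in> J" for j
      using Y[OF that] y[OF that] \<Psi>(2) carr by (intro tw_coords_inj[OF \<theta>]) auto
    ultimately show ?thesis using \<Psi> unfolding is_tensor_ident_def by blast
  qed
  have \<Psi>_unique: "\<Psi> = \<Psi>'"
    if "is_tensor_ident I J q q' \<mu> \<Psi>" "is_tensor_ident I J q q' \<mu> \<Psi>'" for \<Psi> \<Psi>'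
  proof (rule alg_hom_eqI[OF \<eta> genS])
    show "\<Psi> \<in> alg_hom ?T ?P" "\<Psi>' \<in> alg_hom ?T ?P"
      using that by (auto simp: is_tensor_ident_def alg_iso_def)
    fix a s assume a: "a \<in> carrier ?T" "\<eta> a = Poly_Mapping.single s 1"
      and "s \<in> (\<lambda>x. (x, \<one>\<^bsub>nat_vec J\<^esub>)) ` unit_vec ` I \<union> Pair \<one>\<^bsub>nat_vec I\<^esub> ` unit_vec ` J"
    then consider i where "i \<in> I" "s = (unit_vec i, 0)" | j where "j \<in> J" "s = (0, unit_vec j)" by auto
    then show "\<Psi> a = \<Psi>' a"
    proof cases
      case 1
      then have "a = ?X i" using a X by (intro tw_coords_inj[OF \<eta>]) auto
      then show ?thesis using that 1 by (simp add: is_tensor_ident_def)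
    next
      case 2
      then have "a = ?Y j" using a Y by (intro tw_coords_inj[OF \<eta>]) auto
      then show ?thesis using that 2 by (simp add: is_tensor_ident_def)
    qed
  qed
  \<comment> \<open>An identification is prescribed only on the generators of each factor. By
    uniqueness it preserves coordinates, and a mixed tensor has the same coordinates on both sides,
    so no scalar appears.\<close>
  have \<Psi>_XY: "\<Psi> (?XY i j) = ?xy i j"
    if \<Psi>: "is_tensor_ident I J q q' \<mu> \<Psi>" and ij: "i \<in> I" "j \<in> J" for \<Psi> i j
  proof -
    obtain \<Psi>' where "is_tensor_ident I J q q' \<mu> \<Psi>'" and \<Psi>': "\<And>a. a \<in> carrier ?T \<Longrightarrow> \<theta> (\<Psi>' a) = \<eta> a"
      using \<Psi>_ex by blast
    then have eq: "\<theta> (\<Psi> a) = \<eta> a" if "a \<in> carrier ?T" for a using \<Psi>_unique[OF \<Psi>] that by simp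
    have "\<Psi> \<in> alg_hom ?T ?P" using \<Psi> by (simp add: is_tensor_ident_def alg_iso_def)
    from alg_homD(1)[OF this XY(1)[OF ij]] show ?thesis
      using xy[OF ij] XY[OF ij] eq by (intro tw_coords_inj[OF \<theta>]) auto
  qed

  \<comment> \<open>Identification of the quantum space of the Kronecker product\<close>
  have \<Phi>_ex: "\<exists>\<Phi>. is_poly_ident ?K ?g ?\<mu>f \<Phi>"
  proof -
    obtain \<Phi> where \<Phi>: "\<Phi> \<in> alg_iso ?G (poly_twist ?K ?\<mu>f)" "\<And>a. a \<in> carrier ?G \<Longrightarrow> ?\<iota> (\<Phi> a) = \<gamma> a"
      using tw_coords_lift_iso[OF \<gamma> \<iota>] by blast
    have "\<Phi> (qspace_gen ?K ?g x) = poly_var x" if "x \<in> ?K" for x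
    proof -
      have "\<Phi> (qspace_gen ?K ?g x) \<in> carrier (poly_alg ?K)"
        using \<Phi>(1) alg_homD(1)[of \<Phi> ?G "poly_twist ?K ?\<mu>f"] \<gamma>_gen[OF that]
        by (simp add: alg_iso_def tw_carrier)
      then show ?thesis using \<Phi>(2) \<gamma>_gen[OF that] by fastforce
    qed
    then show ?thesis using \<Phi> unfolding is_poly_ident_def by blast
  qed
  have \<Phi>_unique: "\<Phi> = \<Phi>'" if "is_poly_ident ?K ?g ?\<mu>f \<Phi>" "is_poly_ident ?K ?g ?\<mu>f \<Phi>'" for \<Phi> \<Phi>'
    by (rule alg_hom_eq_on_qspace[OF \<gamma> \<gamma>_gen, where B = "poly_twist ?K ?\<mu>f"])
      (use that in \<open>auto simp: is_poly_ident_def alg_iso_def\<close>)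

  \<comment> \<open>The quantum and the classical Segre map\<close>
  let ?f = "lext (\<lambda>s. Poly_Mapping.single (f s) (1::'k))"
  \<comment> \<open>The construction is uniform in the cocycle \<open>\<kappa>\<close>, and its
    coordinate formula \<open>?f\<close> does not mention \<open>\<kappa>\<close>. Taking
    \<open>\<mu>\<close> yields the quantum map, the trivial cocycle the classical one.\<close>
  have segre_hom: "\<exists>\<sigma>\<in>alg_hom A B. (\<forall>i\<in>I. \<forall>j\<in>J. \<sigma> (poly_var (i, j)) = ?xy i j) \<and>
      (\<forall>a\<in>carrier (poly_alg ?K). \<theta> (\<sigma> a) = ?f a)"
    if A: "tw_coords (nat_vec ?K) (pullback_cocycle f \<kappa>) A ?\<iota>" and B: "tw_coords ?S \<kappa> B \<theta>"
      and carr: "carrier A = carrier (poly_alg ?K)" "carrier B = carrier (poly_tensor I J)"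
    for \<kappa> and A :: "('k, (nat \<times> nat \<Rightarrow>\<^sub>0 nat) \<Rightarrow>\<^sub>0 'k) module" and B :: "('k, _) module"
  proof -
    obtain \<sigma> where \<sigma>: "\<sigma> \<in> alg_hom A B"
      "\<And>a. a \<in> carrier A \<Longrightarrow> \<theta> (\<sigma> a) =
        restrict ?f (carrier (tw_alg (nat_vec ?K) (pullback_cocycle f \<kappa>))) (?\<iota> a)"
      using tw_coords_lift_hom[OF A B pullback_alg_hom[OF mK mS f]] by blast
    have \<sigma>_f: "\<theta> (\<sigma> a) = ?f a" if "a \<in> carrier (poly_alg ?K)" for a
      using \<sigma>(2)[of a] that by (simp add: carr) (simp add: poly_alg_tw_alg)
    have "\<sigma> (poly_var (i, j)) = ?xy i j" if "i \<in> I" "j \<in> J" for i j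
    proof -
      have z: "poly_var (i, j) \<in> carrier A" unfolding carr using that by (intro poly_var_carrier) auto
      have "\<theta> (\<sigma> (poly_var (i, j))) = Poly_Mapping.single (unit_vec i, unit_vec j) 1"
        using \<sigma>_f[of "poly_var (i, j)"] z that by (simp add: carr) (simp add: poly_var_def f_unit)
      then show ?thesis
        using alg_homD(1)[OF \<sigma>(1) z] xy[OF that]
        by (intro tw_coords_inj[OF \<theta>]) (auto simp: carr P_carrier)
    qed
    then show ?thesis using \<sigma>(1) \<sigma>_f by blast
  qed
  obtain \<sigma>\<^sub>0 where \<sigma>\<^sub>0: "is_quantum_segre I J f \<mu> \<sigma>\<^sub>0"
    and \<sigma>\<^sub>0_f: "\<And>a. a \<in> carrier (poly_alg ?K) \<Longrightarrow> \<theta> (\<sigma>\<^sub>0 a) = ?f a"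
    using segre_hom[OF \<iota> \<theta> tw_carrier P_carrier] unfolding is_quantum_segre_def by blast
  have "pullback_cocycle f (\<lambda>_ _. 1) = (\<lambda>_ _. 1 :: 'k)"
    by (simp add: pullback_cocycle_def)
  then have "tw_coords (nat_vec ?K) (pullback_cocycle f (\<lambda>_ _. 1 :: 'k)) (poly_alg ?K) ?\<iota>"
    using tw_coords_poly_alg[of ?K] by simp
  from segre_hom[OF this \<theta>1 refl refl]
  obtain \<sigma>\<^sub>1 where \<sigma>\<^sub>1: "is_classical_segre I J \<sigma>\<^sub>1"
    and \<sigma>\<^sub>1_f: "\<And>a. a \<in> carrier (poly_alg ?K) \<Longrightarrow> \<theta> (\<sigma>\<^sub>1 a) = ?f a"
    unfolding is_classical_segre_def by blast
  have \<sigma>_unique: "\<sigma> = \<sigma>'" if "is_quantum_segre I J f \<mu> \<sigma>" "is_quantum_segre I J f \<mu> \<sigma>'" for \<sigma> \<sigma>'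
  proof (rule alg_hom_eqI[OF \<iota> mon_gen_nat_vec])
    show "\<sigma> \<in> alg_hom (poly_twist ?K ?\<mu>f) ?P" "\<sigma>' \<in> alg_hom (poly_twist ?K ?\<mu>f) ?P"
      using that by (auto simp: is_quantum_segre_def)
    fix a x assume "a \<in> carrier (poly_twist ?K ?\<mu>f)" "x \<in> unit_vec ` ?K"
      "?\<iota> a = Poly_Mapping.single x 1"
    then obtain i j where "i \<in> I" "j \<in> J" "a = poly_var (i, j)"
      by (auto simp: tw_carrier poly_var_def)
    then show "\<sigma> a = \<sigma>' a" using that by (simp add: is_quantum_segre_def)
  qed
  \<comment> \<open>Both maps have the coordinate formula \<open>?f\<close> under the same
    \<open>\<theta>\<close> and are extensional on the same carrier, although they are morphisms for
    different products.\<close>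
  have "\<sigma>\<^sub>0 = \<sigma>\<^sub>1"
  proof (rule extensionalityI[of _ "carrier (poly_alg ?K)"])
    have h\<^sub>0: "\<sigma>\<^sub>0 \<in> alg_hom (poly_twist ?K ?\<mu>f) ?P" and h\<^sub>1: "\<sigma>\<^sub>1 \<in> alg_hom (poly_alg ?K) (poly_tensor I J)"
      using \<sigma>\<^sub>0 \<sigma>\<^sub>1 by (simp_all add: is_quantum_segre_def is_classical_segre_def)
    show "\<sigma>\<^sub>0 \<in> extensional (carrier (poly_alg ?K))" "\<sigma>\<^sub>1 \<in> extensional (carrier (poly_alg ?K))"
      using alg_homD(6)[OF h\<^sub>0] alg_homD(6)[OF h\<^sub>1] by (simp_all add: tw_carrier)
    fix a :: "(nat \<times> nat \<Rightarrow>\<^sub>0 nat) \<Rightarrow>\<^sub>0 'k" assume a: "a \<in> carrier (poly_alg ?K)"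
    then show "\<sigma>\<^sub>0 a = \<sigma>\<^sub>1 a"
      using \<sigma>\<^sub>0_f[OF a] \<sigma>\<^sub>1_f[OF a] alg_homD(1)[OF h\<^sub>0, of a] alg_homD(1)[OF h\<^sub>1, of a]
      by (intro tw_coords_inj[OF \<theta>1]) (simp_all add: tw_carrier P_carrier)
  qed
  then have classical: "is_classical_segre I J \<sigma>" if "is_quantum_segre I J f \<mu> \<sigma>" for \<sigma>
    using \<sigma>_unique[OF that \<sigma>\<^sub>0] \<sigma>\<^sub>1 by simp

  \<comment> \<open>The noncommutative Segre map\<close>
  have nc_ex: "\<exists>\<phi>. is_nc_segre I J q q' \<phi>"
  proof -
    obtain \<phi> where \<phi>: "\<phi> \<in> alg_hom ?G ?T"
      "\<And>a. a \<in> carrier ?G \<Longrightarrow> \<eta> (\<phi> a) = restrict ?f (carrier (tw_alg (nat_vec ?K) ?\<mu>f)) (\<gamma> a)"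
      using tw_coords_lift_hom[OF \<gamma> \<eta> pullback_alg_hom[OF mK mS f]] by blast
    have "\<phi> (qspace_gen ?K ?g (i, j)) = ?XY i j" if "i \<in> I" "j \<in> J" for i j
    proof -
      have g: "qspace_gen ?K ?g (i, j) \<in> carrier ?G" "\<gamma> (qspace_gen ?K ?g (i, j)) = poly_var (i, j)"
        using \<gamma>_gen[of "(i, j)"] that by auto
      have "\<eta> (\<phi> (qspace_gen ?K ?g (i, j))) = Poly_Mapping.single (unit_vec i, unit_vec j) 1"
        using \<phi>(2)[OF g(1)] that unfolding g(2) by (simp add: poly_var_def f_unit)
      then show ?thesis
        using alg_homD(1)[OF \<phi>(1) g(1)] XY[OF that] by (intro tw_coords_inj[OF \<eta>]) auto
    qed
    then show ?thesis using \<phi>(1) unfolding is_nc_segre_def by blast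
  qed
  have nc_unique: "\<phi> = \<phi>'" if "is_nc_segre I J q q' \<phi>" "is_nc_segre I J q q' \<phi>'" for \<phi> \<phi>'
    by (rule alg_hom_eq_on_qspace[OF \<gamma> \<gamma>_gen, where B = ?T])
      (use that in \<open>auto simp: is_nc_segre_def\<close>)

  \<comment> \<open>Commutativity of the square\<close>
  have square: "\<sigma> (\<Phi> a) = \<Psi> (\<phi> a)"
    if \<Psi>: "is_tensor_ident I J q q' \<mu> \<Psi>" and \<Phi>: "is_poly_ident ?K ?g ?\<mu>f \<Phi>"
      and \<sigma>: "is_quantum_segre I J f \<mu> \<sigma>" and \<phi>: "is_nc_segre I J q q' \<phi>" and a: "a \<in> carrier ?G"
    for \<Psi> \<Phi> \<sigma> \<phi> a
  proof -
    have "\<Phi> \<in> alg_hom ?G (poly_twist ?K ?\<mu>f)" "\<sigma> \<in> alg_hom (poly_twist ?K ?\<mu>f) ?P"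
      "\<phi> \<in> alg_hom ?G ?T" "\<Psi> \<in> alg_hom ?T ?P"
      using \<Psi> \<Phi> \<sigma> \<phi>
      by (auto simp: is_tensor_ident_def is_poly_ident_def is_quantum_segre_def is_nc_segre_def alg_iso_def)
    note h = alg_hom_compose[OF \<gamma> this(1,2)] alg_hom_compose[OF \<gamma> this(3,4)]
    \<comment> \<open>Both composites are algebra morphisms on the quantum space of the Kronecker
      product, so it suffices that they send each generator to the tensor of the two
      variables.\<close>
    have "restrict (\<lambda>a. \<sigma> (\<Phi> a)) (carrier ?G) = restrict (\<lambda>a. \<Psi> (\<phi> a)) (carrier ?G)"
    proof (rule alg_hom_eq_on_qspace[OF \<gamma> \<gamma>_gen h])
      fix x assume x: "x \<in> ?K"
      then obtain i j where ij: "x = (i, j)" "i \<in> I" "j \<in> J" by auto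
      have "\<sigma> (\<Phi> (qspace_gen ?K ?g x)) = ?xy i j"
        using \<Phi> \<sigma> ij by (simp add: is_poly_ident_def is_quantum_segre_def)
      moreover have "\<Psi> (\<phi> (qspace_gen ?K ?g x)) = ?xy i j"
        using \<phi> \<Psi>_XY[OF \<Psi> ij(2,3)] ij by (simp add: is_nc_segre_def)
      ultimately show "restrict (\<lambda>a. \<sigma> (\<Phi> a)) (carrier ?G) (qspace_gen ?K ?g x) =
          restrict (\<lambda>a. \<Psi> (\<phi> a)) (carrier ?G) (qspace_gen ?K ?g x)"
        using \<gamma>_gen[OF x] by simp
    qed auto
    from fun_cong[OF this, of a] a show ?thesis by simp
  qed
  show ?thesis
  proof (intro conjI)
    show "corresponds ?K ?\<mu>f ?g" by (rule corr)
    show "\<exists>!\<Psi>. is_tensor_ident I J q q' \<mu> \<Psi>" using \<Psi>_ex \<Psi>_unique by blast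
    show "\<exists>!\<Phi>. is_poly_ident ?K ?g ?\<mu>f \<Phi>" using \<Phi>_ex \<Phi>_unique by blast
    show "\<exists>!\<sigma>. is_quantum_segre I J f \<mu> \<sigma>" using \<sigma>\<^sub>0 \<sigma>_unique by blast
    show "\<exists>!\<phi>. is_nc_segre I J q q' \<phi>" using nc_ex nc_unique by blast
    show "\<forall>\<sigma>. is_quantum_segre I J f \<mu> \<sigma> \<longrightarrow> is_classical_segre I J \<sigma>" using classical by blast
  qed (use square in blast)
qed

end
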